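(* Let $\alpha\in[0,1)$. Put $\widetilde\gamma_0(\alpha)=1$; let $\widetilde\gamma_1(\alpha)\in[1,\infty)$ be the only positive root of $$\widetilde\Phi_{1,\alpha}(x)=(1-\alpha)^2x^2-\alpha^2x-2\alpha(1-\alpha)x^{\frac12}-(1-\alpha)^2,$$ and, for every integer $n\ge2$, let $\widetilde\gamma_n(\alpha)\in(1,\infty)$ be the only positive root of $$\widetilde\Phi_{n,\alpha}(x)=(1-\alpha)^2x^{n+1}-\alpha^2x^n-2\alpha(1-\alpha)\sum_{i=1}^{n}x^{n-i+\frac12}-(1-2\alpha+2\alpha^2)\sum_{i=1}^{n-1}x^i-(1-\alpha)^2$$ (these roots exist and are unique as indicated). For every integer $n\ge0$ let $$\eta_n(\alpha)=2\alpha+(1-\alpha)\widetilde\gamma_n(\alpha)^{\frac12}+(1-\alpha)\widetilde\gamma_n(\alpha)^{-\frac12}.$$ Then $2=\eta_0(0)=\eta_1(0)<\eta_2(0)<\cdots$ if $\alpha=0$, and $2=\eta_0(\alpha)<\eta_1(\alpha)<\eta_2(\alpha)<\cdots$ if $\alpha\in(0,1)$. Moreover $\lim_{n\to\infty}\eta_n(\alpha)=\Psi(\alpha)$, and the numbers $\eta_n(\alpha)$, $n\ge0$, are precisely all the limit points of the $A_\alpha$-spectral radius of graphs that are smaller than $\Psi(\alpha)$.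
   Context: Graphs are finite, simple and undirected. For a graph $G$ with adjacency matrix $A(G)$ and diagonal degree matrix $D(G)$, and $\alpha\in[0,1]$, let $A_\alpha(G)=\alpha D(G)+(1-\alpha)A(G)$, and let $\rho_{A_\alpha}(G)$ (the $A_\alpha$-spectral radius) be the largest absolute value of an eigenvalue of $A_\alpha(G)$. A real number $\gamma$ is a limit point of the $A_\alpha$-spectral radius of graphs if there is a sequence of graphs $(G_k)_{k\in\mathbb N}$ with $\rho_{A_\alpha}(G_i)\ne\rho_{A_\alpha}(G_j)$ whenever $i\neq j$ and $\lim_{k\to\infty}\rho_{A_\alpha}(G_k)=\gamma$. $P_n$ is the path on $n$ vertices. $P_2(P_m,P_n)$ is the tree obtained from the disjoint union of $P_2$, $P_m$ and $P_n$ by joining one fixed vertex $u$ of $P_2$ by an edge to an end-vertex of $P_m$ and by an edge to an end-vertex of $P_n$ (so $u$ has degree 3 and is adjacent to a pendant vertex, and removing $u$ leaves $P_1\cup P_m\cup P_n$). Define $\Psi(\alpha)=\lim_{n\to\infty}\rho_{A_\alpha}(P_2(P_n,P_n))$ (this limit exists). *)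

theory Defs
  imports
    "Graph_Theory.Pair_Digraph"
    "Jordan_Normal_Form.Spectral_Radius"
begin

text \<open>
  Finite simple undirected graphs are non-empty, finite, loopless, symmetric digraphs without
  parallel arcs (each edge is a pair of opposite arcs). The vertices are labelled
  \<open>0, \<dots>, n - 1\<close>, which costs no generality up to isomorphism and makes them directly
  usable as matrix indices. A graph without vertices has no eigenvalues and is excluded.
\<close>

definition simple_graph :: "nat pair_pre_digraph \<Rightarrow> bool" where
  "simple_graph G \<longleftrightarrow> pair_graph G \<and> (\<exists>n\<ge>1. pverts G = {0..<n})"

definition adj_mat :: "nat pair_pre_digraph \<Rightarrow> real mat" where
  "adj_mat G = mat (card (pverts G)) (card (pverts G))
     (\<lambda>(i, j). if (i, j) \<in> parcs G then 1 else 0)"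

text \<open>By symmetry, the degree of a vertex is the number of arcs leaving it.\<close>

definition deg_mat :: "nat pair_pre_digraph \<Rightarrow> real mat" where
  "deg_mat G = mat (card (pverts G)) (card (pverts G))
     (\<lambda>(i, j). if i = j then real (out_degree (with_proj G) i) else 0)"

definition A_alpha :: "real \<Rightarrow> nat pair_pre_digraph \<Rightarrow> real mat" where
  "A_alpha \<alpha> G = \<alpha> \<cdot>\<^sub>m deg_mat G + (1 - \<alpha>) \<cdot>\<^sub>m adj_mat G"

definition rho :: "real \<Rightarrow> nat pair_pre_digraph \<Rightarrow> real" where
  "rho \<alpha> G = spectral_radius (map_mat complex_of_real (A_alpha \<alpha> G))"

definition rho_limit_point :: "real \<Rightarrow> real \<Rightarrow> bool" where
  "rho_limit_point \<alpha> \<gamma> \<longleftrightarrow>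
     (\<exists>G :: nat \<Rightarrow> nat pair_pre_digraph.
        (\<forall>k. simple_graph (G k)) \<and>
        (\<forall>i j. i \<noteq> j \<longrightarrow> rho \<alpha> (G i) \<noteq> rho \<alpha> (G j)) \<and>
        (\<lambda>k. rho \<alpha> (G k)) \<longlonglongrightarrow> \<gamma>)"

text \<open>
  \<open>P2_paths m n\<close> is \<open>P\<^sub>2(P\<^sub>m, P\<^sub>n)\<close>: \<open>P\<^sub>2\<close> has the vertices \<open>0\<close> (the vertex \<open>u\<close>) and \<open>1\<close>,
  \<open>P\<^sub>m\<close> the vertices \<open>2, \<dots>, m + 1\<close> and \<open>P\<^sub>n\<close> the vertices \<open>m + 2, \<dots>, m + n + 1\<close>.
  Only \<open>m, n \<ge> 1\<close> is meaningful.
\<close>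

definition P2_paths :: "nat \<Rightarrow> nat \<Rightarrow> nat pair_pre_digraph" where
  "P2_paths m n =
     (let E = {(0, 1), (0, 2), (0, m + 2)}
            \<union> {(i, i + 1) | i. 2 \<le> i \<and> i + 1 \<le> m + 1}
            \<union> {(i, i + 1) | i. m + 2 \<le> i \<and> i + 1 \<le> m + n + 1}
      in \<lparr> pverts = {0..<m + n + 2}, parcs = E \<union> E\<inverse> \<rparr>)"

lemma simple_graph_P2_paths:
  assumes "m \<ge> 1" "n \<ge> 1"
  shows "simple_graph (P2_paths m n)"
proof -
  let ?G = "P2_paths m n"
  have arcs: "parcs ?G \<subseteq> {0..<m + n + 2} \<times> {0..<m + n + 2}"
    using assms by (auto simp: P2_paths_def Let_def)
  have verts: "pverts ?G = {0..<m + n + 2}"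
    by (simp add: P2_paths_def Let_def)
  have "finite (parcs ?G)"
    using arcs by (rule finite_subset) simp
  moreover have "sym (parcs ?G)"
    by (simp only: P2_paths_def Let_def pair_pre_digraph.simps sym_Un_converse)
  moreover have "fst e \<noteq> snd e" if "e \<in> parcs ?G" for e
    using that by (auto simp: P2_paths_def Let_def)
  ultimately have "pair_graph ?G"
    using arcs verts by unfold_locales (auto simp: symmetric_def)
  then show ?thesis
    unfolding simple_graph_def verts by (intro conjI exI[of _ "m + n + 2"]) auto
qed

definition Psi :: "real \<Rightarrow> real" where
  "Psi \<alpha> = lim (\<lambda>n. rho \<alpha> (P2_paths n n))"

definition Phi_tilde :: "real \<Rightarrow> nat \<Rightarrow> real \<Rightarrow> real" where
  "Phi_tilde \<alpha> n x =
     (1 - \<alpha>)^2 * x ^ (n + 1) - \<alpha>^2 * x ^ n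
     - 2 * \<alpha> * (1 - \<alpha>) * (\<Sum>i = 1..n. x powr (real n - real i + 1 / 2))
     - (1 - 2 * \<alpha> + 2 * \<alpha>^2) * (\<Sum>i = 1..n - 1. x ^ i)
     - (1 - \<alpha>)^2"

text \<open>The case \<open>n = 1\<close>, where the second sum is empty.\<close>

lemma Phi_tilde_1:
  "Phi_tilde \<alpha> 1 x =
     (1 - \<alpha>)^2 * x^2 - \<alpha>^2 * x - 2 * \<alpha> * (1 - \<alpha>) * x powr (1 / 2) - (1 - \<alpha>)^2"
  by (simp add: Phi_tilde_def power2_eq_square)

definition gamma_tilde :: "real \<Rightarrow> nat \<Rightarrow> real" where
  "gamma_tilde \<alpha> n = (if n = 0 then 1 else (THE x. x > 0 \<and> Phi_tilde \<alpha> n x = 0))"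

definition eta :: "real \<Rightarrow> nat \<Rightarrow> real" where
  "eta \<alpha> n = 2 * \<alpha> + (1 - \<alpha>) * gamma_tilde \<alpha> n powr (1 / 2)
             + (1 - \<alpha>) * gamma_tilde \<alpha> n powr (- 1 / 2)"

end

theory Submission
  imports Defs "HOL-Analysis.Convex"
begin

text \<open>
  Write \<open>eta \<alpha> n = lam t\<close> with \<open>lam t = 2\<alpha> + (1 - \<alpha>)(t + 1/t)\<close>: along a path whose inner vertices have
  degree 2, the eigenvalue equation for \<open>lam t\<close> is solved by the powers of \<open>1/t\<close>. The number \<open>eta \<alpha> n\<close>
  is the limit of the spectral radii of \<open>P2_paths n k\<close> for \<open>k \<longrightarrow> \<infinity>\<close>, and \<open>Psi \<alpha>\<close> is the limit of
  \<open>eta \<alpha> n\<close>.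

  Let \<open>\<gamma> < Psi \<alpha>\<close> be a limit point. Only finitely many values come from components of bounded size,
  and degrees are bounded by \<open>\<rho>\<^sup>2\<close>, so connected graphs with long paths remain. An inner vertex
  of the path far from its ends has degree 2, as otherwise the graph contains \<open>P2_paths L L\<close> or another
  graph with spectral radius close to at least \<open>Psi \<alpha>\<close>. A unit vector has little weight on some edge in
  the middle; deleting that edge hardly changes the spectral radius and leaves a graph with a long
  pendant path. Follow this path to its first branching vertex: an explicit test vector, decaying
  geometrically along the path, pushes the spectral radius up to \<open>Psi \<alpha>\<close> unless the graph is a path
  or some \<open>P2_paths m k\<close>.
\<close>

section \<open>A variational form of the spectral radius\<close>

text \<open>With \<open>rad\<close>, all comparisons become inequalities between finite sums: test
  vectors bound it from below and positive supersolutions from above, and it is identified with the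
  matrix spectral radius only once. The obstacle is uniformity. The values \<open>eta\<close> live
  on infinite trees while the graphs are finite, and for \<open>eta 0\<close>, as for
  \<open>eta 1\<close> when \<alpha> = 0, the vector along the ray does not decay at all (t = 1).
  The error of truncating at length L is therefore measured not by a power of 1 / t but by averaging
  over L + 1 vertices, which gives 2 / (L + 1) in every case. The classification is accordingly
  proved in a finite form: a connected graph with a path of 6 L + 2 edges and radius below
  \<open>cutoff L\<close> lies within 2 / (L + 1) of some \<open>eta m\<close>; the limit comes
  last. At the vertex where a long pendant path stops, three configurations are excluded because
  they force Psi up to this error: three further neighbours, two further neighbours that both
  continue, and a second branching beyond a vertex that has a pendant neighbour.\<close>

text \<open>
  A graph is represented by its arcs alone. Isolated vertices only contribute the eigenvalue \<open>0\<close>,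
  which does not affect the supremum \<open>rad\<close> of the Rayleigh quotients below.
\<close>

definition ugraph :: "('v \<times> 'v) set \<Rightarrow> bool" where
  "ugraph E \<longleftrightarrow> finite E \<and> sym E \<and> irrefl E"

lemma ugraphD:
  assumes "ugraph E"
  shows "finite E" "(v, w) \<in> E \<Longrightarrow> (w, v) \<in> E" "(v, v) \<notin> E"
    "finite (Field E)" "finite (E `` A)"
  using assms unfolding ugraph_def sym_def irrefl_def
  by (auto simp: finite_Field intro: finite_Image)

locale aspec =
  fixes \<alpha> :: real
  assumes alpha_ge0: "0 \<le> \<alpha>" and alpha_lt1: "\<alpha> < 1"
begin

text \<open>The degree term is spread over the neighbours, one \<alpha> * x v for each. A row of
  \<open>A_alpha\<close> thus becomes a single sum over neighbours, and for a nonnegative vector any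
  set of neighbours yields a lower bound.\<close>

definition act :: "('v \<times> 'v) set \<Rightarrow> ('v \<Rightarrow> real) \<Rightarrow> 'v \<Rightarrow> real" where
  "act E x v = (\<Sum>w\<in>E `` {v}. \<alpha> * x v + (1 - \<alpha>) * x w)"

definition quad :: "('v \<times> 'v) set \<Rightarrow> ('v \<Rightarrow> real) \<Rightarrow> real" where
  "quad E x = (\<Sum>(v, w)\<in>E. \<alpha> * (x v)\<^sup>2 + (1 - \<alpha>) * (x v * x w))"

definition nsq :: "('v \<times> 'v) set \<Rightarrow> ('v \<Rightarrow> real) \<Rightarrow> real" where
  "nsq E x = (\<Sum>v\<in>Field E. (x v)\<^sup>2)"

definition rad :: "('v \<times> 'v) set \<Rightarrow> real" where
  "rad E = Sup {quad E x | x. nsq E x \<le> 1}"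

lemma sum_arcs:
  assumes "finite E" "finite V" "Field E \<subseteq> V"
  shows "(\<Sum>(v, w)\<in>E. g v w) = (\<Sum>v\<in>V. \<Sum>w\<in>E `` {v}. g v w)"
proof -
  have "Sigma V (\<lambda>v. E `` {v}) = E"
    using assms(3) by (auto simp: Field_def)
  moreover have "(\<Sum>v\<in>V. \<Sum>w\<in>E `` {v}. g v w) = (\<Sum>(v, w)\<in>Sigma V (\<lambda>v. E `` {v}). g v w)"
    by (rule sum.Sigma) (use assms in \<open>auto intro: finite_Image\<close>)
  ultimately show ?thesis by simp
qed

lemma quad_act:
  assumes "finite E" "finite V" "Field E \<subseteq> V"
  shows "quad E x = (\<Sum>v\<in>V. x v * act E x v)"
  unfolding quad_def act_def sum_arcs[OF assms] sum_distrib_left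
  by (intro sum.cong refl) (simp add: algebra_simps power2_eq_square)

lemma nsq_nonneg: "0 \<le> nsq E x"
  unfolding nsq_def by (rule sum_nonneg) simp

lemma sum_arcs_swap:
  assumes "sym E"
  shows "(\<Sum>(v, w)\<in>E. g v w) = (\<Sum>(v, w)\<in>E. g w v)"
proof -
  have "prod.swap ` E = E"
    using assms by (force simp: sym_def image_iff)
  then have "(\<Sum>(v, w)\<in>E. g v w) = sum (\<lambda>(v, w). g v w) (prod.swap ` E)" by simp
  also have "\<dots> = (\<Sum>(v, w)\<in>E. g w v)"
    by (subst sum.reindex) (auto simp: case_prod_unfold o_def inj_on_def)
  finally show ?thesis .
qed

text \<open>The weights \<open>y\<close> turn AM-GM into 2 x_v x_w \<le> x_v^2 y_w / y_v + x_w^2 y_v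
  / y_w. Summing over both orientations of each edge collects at v the factor (A y)_v / y_v, which
  is at most l. This takes the place of Perron-Frobenius in the upper bounds for
  \<open>rad\<close>.\<close>

lemma quad_le_supersolution:
  assumes E: "ugraph E" and V: "finite V" "Field E \<subseteq> V"
    and pos: "\<And>v. v \<in> V \<Longrightarrow> y v > 0"
    and sup: "\<And>v. v \<in> V \<Longrightarrow> act E y v \<le> l * y v"
  shows "quad E x \<le> l * (\<Sum>v\<in>V. (x v)\<^sup>2)"
proof -
  note fin = ugraphD(1)[OF E]
  let ?h = "\<lambda>v w. (x v)\<^sup>2 * (y w / y v)"
  have inV: "v \<in> V" "w \<in> V" if "(v, w) \<in> E" for v w
    using that V(2) by (auto simp: Field_def)
  have "quad E x \<le> (\<Sum>(v, w)\<in>E. \<alpha> * (x v)\<^sup>2 + (1 - \<alpha>) * ((?h v w + ?h w v) / 2))"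
    unfolding quad_def
  proof (rule sum_mono, clarify)
    fix v w assume "(v, w) \<in> E"
    then have p: "y v > 0" "y w > 0" using inV pos by auto
    have "0 \<le> (x v * y w - x w * y v)\<^sup>2 / (y v * y w)" using p by simp
    also have "\<dots> = ?h v w + ?h w v - 2 * (x v * x w)"
      using p by (simp add: field_simps power2_eq_square)
    finally show "\<alpha> * (x v)\<^sup>2 + (1 - \<alpha>) * (x v * x w) \<le> \<alpha> * (x v)\<^sup>2 + (1 - \<alpha>) * ((?h v w + ?h w v) / 2)"
      using alpha_lt1 by (intro add_left_mono mult_left_mono) auto
  qed
  also have "\<dots> = (\<Sum>(v, w)\<in>E. \<alpha> * (x v)\<^sup>2 + (1 - \<alpha>) * ?h v w)"
  proof -
    let ?k = "\<lambda>v w. (1 - \<alpha>) / 2 * ?h v w"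
    have "(\<Sum>(v, w)\<in>E. \<alpha> * (x v)\<^sup>2 + (1 - \<alpha>) * ((?h v w + ?h w v) / 2))
        = (\<Sum>(v, w)\<in>E. \<alpha> * (x v)\<^sup>2 + ?k v w) + (\<Sum>(v, w)\<in>E. ?k w v)"
      unfolding sum.distrib[symmetric]
      by (intro sum.cong refl) (simp add: case_prod_unfold algebra_simps add_divide_distrib)
    also have "(\<Sum>(v, w)\<in>E. ?k w v) = (\<Sum>(v, w)\<in>E. ?k v w)"
      using sum_arcs_swap[of E ?k] E by (simp add: ugraph_def)
    also have "(\<Sum>(v, w)\<in>E. \<alpha> * (x v)\<^sup>2 + ?k v w) + (\<Sum>(v, w)\<in>E. ?k v w)
        = (\<Sum>(v, w)\<in>E. \<alpha> * (x v)\<^sup>2 + (1 - \<alpha>) * ?h v w)"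
      unfolding sum.distrib[symmetric]
      by (intro sum.cong refl) (simp add: case_prod_unfold field_simps)
    finally show ?thesis .
  qed
  also have "\<dots> = (\<Sum>v\<in>V. (x v)\<^sup>2 / y v * act E y v)"
    unfolding sum_arcs[OF fin V] act_def sum_distrib_left
    by (intro sum.cong refl) (use pos in \<open>force simp: field_simps\<close>)
  also have "\<dots> \<le> (\<Sum>v\<in>V. (x v)\<^sup>2 / y v * (l * y v))"
    by (intro sum_mono mult_left_mono sup) (use pos in \<open>auto intro!: divide_nonneg_pos\<close>)
  also have "\<dots> = (\<Sum>v\<in>V. l * (x v)\<^sup>2)"
    by (intro sum.cong refl) (use pos in force)
  finally show ?thesis by (simp add: sum_distrib_left)
qed

lemma quad_bounded:
  assumes "ugraph E"
  shows "quad E x \<le> real (card E) * nsq E x"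
  unfolding nsq_def
proof (rule quad_le_supersolution[OF assms, where y = "\<lambda>_. 1"])
  fix v assume "v \<in> Field E"
  have "card (E `` {v}) \<le> card (snd ` E)"
    by (rule card_mono) (use ugraphD(1)[OF assms] in force)+
  also have "\<dots> \<le> card E" using ugraphD(1)[OF assms] by (rule card_image_le)
  finally show "act E (\<lambda>_. 1) v \<le> real (card E) * 1" by (simp add: act_def)
qed (use ugraphD(4)[OF assms] in auto)

lemma quad_scale: "quad E (\<lambda>v. c * x v) = c\<^sup>2 * quad E x"
  unfolding quad_def sum_distrib_left
  by (intro sum.cong refl) (auto simp: algebra_simps power2_eq_square)

lemma nsq_scale: "nsq E (\<lambda>v. c * x v) = c\<^sup>2 * nsq E x"
  unfolding nsq_def sum_distrib_left by (simp add: power_mult_distrib)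

lemma quad_set_bdd:
  assumes "ugraph E"
  shows "bdd_above {quad E x | x. nsq E x \<le> 1}"
proof (rule bdd_aboveI, clarify)
  fix x :: "'a \<Rightarrow> real" assume "nsq E x \<le> 1"
  then show "quad E x \<le> real (card E)"
    using quad_bounded[OF assms, of x] mult_left_mono[of "nsq E x" 1 "real (card E)"] by simp
qed

lemma quad_le_rad1: "ugraph E \<Longrightarrow> nsq E x \<le> 1 \<Longrightarrow> quad E x \<le> rad E"
  unfolding rad_def by (rule cSup_upper[OF _ quad_set_bdd]) auto

lemma quad_zero: "quad E (\<lambda>_. 0) = 0" "nsq E (\<lambda>_. 0) = 0"
  by (simp_all add: quad_def nsq_def)

lemma rad_nonneg: "ugraph E \<Longrightarrow> 0 \<le> rad E"
  using quad_le_rad1[of E "\<lambda>_. 0"] by (simp add: quad_zero)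

lemma quad_nsq0:
  assumes "ugraph E" "nsq E x = 0"
  shows "quad E x = 0"
proof -
  have "x v = 0" if "v \<in> Field E" for v
    using that assms(2) ugraphD(4)[OF assms(1)] unfolding nsq_def
    by (subst (asm) sum_nonneg_eq_0_iff) auto
  then show ?thesis unfolding quad_def by (intro sum.neutral) (clarsimp simp: FieldI1)
qed

lemma quad_le_rad:
  assumes E: "ugraph E"
  shows "quad E x \<le> rad E * nsq E x"
proof (cases "nsq E x = 0")
  case True
  then show ?thesis using quad_nsq0[OF E] by simp
next
  case False
  then have p: "nsq E x > 0" using nsq_nonneg[of E x] by simp
  define c where "c = 1 / sqrt (nsq E x)"
  have c2: "c\<^sup>2 = 1 / nsq E x" using p by (simp add: c_def power_divide)
  have "c\<^sup>2 * quad E x \<le> rad E"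
    using quad_le_rad1[OF E, of "\<lambda>v. c * x v"] p by (simp add: quad_scale nsq_scale c2)
  then show ?thesis using p by (simp add: c2 field_simps)
qed

lemma rad_le:
  assumes "ugraph E" "0 \<le> l" "\<And>x. quad E x \<le> l * nsq E x"
  shows "rad E \<le> l"
  unfolding rad_def
proof (rule cSup_least)
  show "{quad E x | x. nsq E x \<le> 1} \<noteq> {}"
    using quad_zero(2)[of E] by (metis (mono_tags, lifting) empty_iff mem_Collect_eq zero_le_one)
next
  fix r assume "r \<in> {quad E x | x. nsq E x \<le> 1}"
  then obtain x where "r = quad E x" "nsq E x \<le> 1" by auto
  then show "r \<le> l" using assms(3)[of x] mult_left_mono[of "nsq E x" 1 l] assms(2) by simp
qed

lemma rad_le_supersolution:
  assumes E: "ugraph E" and "0 \<le> l"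
    and "\<And>v. v \<in> Field E \<Longrightarrow> y v > 0"
    and "\<And>v. v \<in> Field E \<Longrightarrow> act E y v \<le> l * y v"
  shows "rad E \<le> l"
  using assms quad_le_supersolution[OF E ugraphD(4)[OF E] subset_refl, of y l]
  by (intro rad_le) (auto simp: nsq_def)

text \<open>Vertices of \<open>V\<close> outside the field only enlarge the norm, which is harmless
  because \<open>rad E\<close> is nonnegative.\<close>

lemma rad_ge:
  assumes E: "ugraph E" and V: "finite V" "Field E \<subseteq> V"
    and pos: "(\<Sum>v\<in>V. (x v)\<^sup>2) > 0" and Q: "quad E x \<ge> l * (\<Sum>v\<in>V. (x v)\<^sup>2)"
  shows "l \<le> rad E"
proof -
  have "nsq E x \<le> (\<Sum>v\<in>V. (x v)\<^sup>2)"
    unfolding nsq_def by (rule sum_mono2) (use V in auto)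
  then have "rad E * nsq E x \<le> rad E * (\<Sum>v\<in>V. (x v)\<^sup>2)"
    by (rule mult_left_mono) (rule rad_nonneg[OF E])
  then have "l * (\<Sum>v\<in>V. (x v)\<^sup>2) \<le> rad E * (\<Sum>v\<in>V. (x v)\<^sup>2)"
    using Q quad_le_rad[OF E, of x] by linarith
  then show ?thesis using pos by simp
qed

text \<open>The test vector is moved along \<open>f\<close> with absolute values, so that arcs of
  \<open>E'\<close> outside the image contribute nonnegative terms. This covers both subgraphs and
  relabelling.\<close>

lemma rad_mono_hom:
  assumes E: "ugraph E" and E': "ugraph E'"
    and inj: "inj_on f (Field E)" and hom: "\<And>v w. (v, w) \<in> E \<Longrightarrow> (f v, f w) \<in> E'"
  shows "rad E \<le> rad E'"
proof (rule rad_le[OF E rad_nonneg[OF E']])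
  fix x :: "'a \<Rightarrow> real"
  define g where "g = the_inv_into (Field E) f"
  have g: "g (f v) = v" if "v \<in> Field E" for v
    unfolding g_def by (rule the_inv_into_f_f[OF inj that])
  define y where "y = (\<lambda>w. if w \<in> f ` Field E then \<bar>x (g w)\<bar> else 0)"
  have y: "y (f v) = \<bar>x v\<bar>" if "v \<in> Field E" for v
    using that by (simp add: y_def g)
  have y0: "y w \<ge> 0" for w by (simp add: y_def)
  have fld: "f ` Field E \<subseteq> Field E'" using hom by (force simp: Field_def)
  have injE: "inj_on (map_prod f f) E"
    by (intro inj_onI) (auto dest!: inj_onD[OF inj] simp: FieldI1 FieldI2)
  have sub: "map_prod f f ` E \<subseteq> E'" using hom by auto
  have "quad E x \<le> (\<Sum>(v, w)\<in>E. \<alpha> * \<bar>x v\<bar>\<^sup>2 + (1 - \<alpha>) * (\<bar>x v\<bar> * \<bar>x w\<bar>))"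
    unfolding quad_def
    by (intro sum_mono) (use alpha_lt1 in \<open>auto intro!: mult_left_mono simp: abs_mult[symmetric]\<close>)
  also have "\<dots> = (\<Sum>(v, w)\<in>E. \<alpha> * (y (f v))\<^sup>2 + (1 - \<alpha>) * (y (f v) * y (f w)))"
    by (intro sum.cong refl) (auto simp: y FieldI1 FieldI2)
  also have "\<dots> = (\<Sum>(v, w)\<in>map_prod f f ` E. \<alpha> * (y v)\<^sup>2 + (1 - \<alpha>) * (y v * y w))"
    by (subst sum.reindex[OF injE]) (auto intro!: sum.cong)
  also have "\<dots> \<le> quad E' y"
    unfolding quad_def
    by (rule sum_mono2[OF ugraphD(1)[OF E'] sub]) (use y0 alpha_ge0 alpha_lt1 in auto)
  also have "\<dots> \<le> rad E' * nsq E' y" by (rule quad_le_rad[OF E'])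
  also have "nsq E' y = (\<Sum>w\<in>f ` Field E. (y w)\<^sup>2)"
    unfolding nsq_def
    by (rule sum.mono_neutral_right[OF ugraphD(4)[OF E'] fld]) (auto simp: y_def)
  also have "\<dots> = nsq E x"
    unfolding nsq_def by (subst sum.reindex[OF inj]) (auto intro!: sum.cong simp: y)
  finally show "quad E x \<le> rad E' * nsq E x" .
qed

lemma rad_mono:
  assumes "ugraph E" "ugraph E'" "E \<subseteq> E'"
  shows "rad E \<le> rad E'"
  using rad_mono_hom[OF assms(1,2), of "\<lambda>v. v"] assms(3) by auto

lemma rad_disjoint_union:
  assumes E1: "ugraph E1" and E2: "ugraph E2" and dis: "Field E1 \<inter> Field E2 = {}"
  shows "rad (E1 \<union> E2) \<le> max (rad E1) (rad E2)"
proof (rule rad_le)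
  show U: "ugraph (E1 \<union> E2)"
    using E1 E2 by (auto simp: ugraph_def irrefl_def intro: sym_Un)
  show "0 \<le> max (rad E1) (rad E2)" using rad_nonneg[OF E1] by simp
  fix x
  have d: "E1 \<inter> E2 = {}" using dis by (auto simp: Field_def)
  have "quad (E1 \<union> E2) x = quad E1 x + quad E2 x"
    unfolding quad_def by (rule sum.union_disjoint) (use E1 E2 d in \<open>auto simp: ugraph_def\<close>)
  also have "\<dots> \<le> max (rad E1) (rad E2) * nsq E1 x + max (rad E1) (rad E2) * nsq E2 x"
    using quad_le_rad[OF E1, of x] quad_le_rad[OF E2, of x]
      mult_right_mono[OF max.cobounded1[of "rad E1" "rad E2"] nsq_nonneg[of E1 x]]
      mult_right_mono[OF max.cobounded2[of "rad E2" "rad E1"] nsq_nonneg[of E2 x]]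
    by linarith
  also have "\<dots> = max (rad E1) (rad E2) * nsq (E1 \<union> E2) x"
    unfolding nsq_def Field_Un
    by (subst sum.union_disjoint) (use ugraphD(4)[OF E1] ugraphD(4)[OF E2] dis in \<open>auto simp: distrib_left\<close>)
  finally show "quad (E1 \<union> E2) x \<le> max (rad E1) (rad E2) * nsq (E1 \<union> E2) x" .
qed

text \<open>The test vector is that of the star at v: sqrt d at the centre and 1 at its neighbours.
  A bound on the radius thereby bounds all degrees.\<close>

lemma sqrt_degree_le_rad:
  assumes E: "ugraph E" and v: "v \<in> Field E"
  shows "sqrt (real (card (E `` {v}))) \<le> rad E"
proof -
  let ?N = "E `` {v}"
  let ?d = "real (card ?N)"
  note fin = ugraphD[OF E]
  define x where "x = (\<lambda>w. if w = v then sqrt ?d else if w \<in> ?N then 1 else 0)"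
  define S where "S = insert v ?N"
  have vN: "v \<notin> ?N" using fin(3) by auto
  have x0: "x w \<ge> 0" for w by (simp add: x_def)
  have xv: "x v = sqrt ?d" by (simp add: x_def)
  have "?N \<noteq> {}"
    using v fin(2) by (auto simp: Field_def)
  then have d1: "?d \<ge> 1" using fin(5)[of "{v}"]
    by (metis One_nat_def Suc_leI card_gt_0_iff of_nat_1 of_nat_mono)
  have Sf: "S \<subseteq> Field E" using v by (auto simp: S_def Field_def)
  have n: "(\<Sum>w\<in>Field E. (x w)\<^sup>2) = 2 * ?d"
  proof -
    have "(\<Sum>w\<in>Field E. (x w)\<^sup>2) = (\<Sum>w\<in>S. (x w)\<^sup>2)"
      by (rule sum.mono_neutral_right[OF fin(4) Sf]) (auto simp: x_def S_def)
    also have "\<dots> = ?d + (\<Sum>w\<in>?N. (x w)\<^sup>2)"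
      unfolding S_def using vN fin(5)[of "{v}"] by (simp add: x_def)
    also have "(\<Sum>w\<in>?N. (x w)\<^sup>2) = (\<Sum>w\<in>?N. 1)"
      by (intro sum.cong refl) (use vN in \<open>auto simp: x_def\<close>)
    finally show ?thesis by simp
  qed
  have nb: "act E x w \<ge> \<alpha> + (1 - \<alpha>) * sqrt ?d" if w: "w \<in> ?N" for w
  proof -
    have "(\<Sum>u\<in>{v}. \<alpha> * x w + (1 - \<alpha>) * x u) \<le> act E x w"
      unfolding act_def by (rule sum_mono2[OF fin(5)]) (use fin(2) w x0 alpha_ge0 alpha_lt1 in auto)
    moreover have "x w = 1" "x v = sqrt ?d" using w vN by (auto simp: x_def)
    ultimately show ?thesis by simp
  qed
  have ctr: "act E x v = ?d * (\<alpha> * sqrt ?d + (1 - \<alpha>))"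
  proof -
    have "act E x v = (\<Sum>w\<in>?N. \<alpha> * sqrt ?d + (1 - \<alpha>))"
      unfolding act_def by (intro sum.cong refl) (use vN in \<open>auto simp: x_def\<close>)
    then show ?thesis by simp
  qed
  have "(\<Sum>w\<in>S. x w * act E x w) \<le> (\<Sum>w\<in>Field E. x w * act E x w)"
    by (rule sum_mono2[OF fin(4) Sf])
      (use x0 alpha_ge0 alpha_lt1 in \<open>auto simp: act_def intro!: mult_nonneg_nonneg sum_nonneg add_nonneg_nonneg\<close>)
  moreover have "(\<Sum>w\<in>S. x w * act E x w) = x v * act E x v + (\<Sum>w\<in>?N. x w * act E x w)"
    unfolding S_def using vN fin(5)[of "{v}"] by simp
  moreover have "(\<Sum>w\<in>?N. x w * act E x w) \<ge> (\<Sum>w\<in>?N. \<alpha> + (1 - \<alpha>) * sqrt ?d)"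
  proof (rule sum_mono)
    fix w assume w: "w \<in> ?N"
    then have "x w = 1" using vN by (auto simp: x_def)
    then show "\<alpha> + (1 - \<alpha>) * sqrt ?d \<le> x w * act E x w" using nb[OF w] by simp
  qed
  ultimately have "sqrt ?d * (?d * (\<alpha> * sqrt ?d + (1 - \<alpha>))) + ?d * (\<alpha> + (1 - \<alpha>) * sqrt ?d) \<le> quad E x"
    unfolding quad_act[OF fin(1,4) subset_refl] ctr xv by simp
  moreover have "sqrt ?d * (2 * ?d) \<le> sqrt ?d * (?d * (\<alpha> * sqrt ?d + (1 - \<alpha>))) + ?d * (\<alpha> + (1 - \<alpha>) * sqrt ?d)"
  proof -
    \<comment> \<open>The two sides differ exactly by this square term.\<close>
    have "0 \<le> (?d * \<alpha>) * (sqrt ?d - 1)\<^sup>2" using alpha_ge0 by simp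
    then show ?thesis by (simp add: algebra_simps power2_eq_square)
  qed
  ultimately show ?thesis
    by (intro rad_ge[OF E fin(4) subset_refl, of x]) (use n d1 in auto)
qed

text \<open>Relabelling by 0, ..., N - 1 leaves finitely many arc sets. Graphs of bounded size
  therefore cannot supply infinitely many distinct radii.\<close>

lemma finite_rad_values:
  "finite {rad E | E :: (nat \<times> nat) set. ugraph E \<and> card (Field E) \<le> N}"
proof (rule finite_subset)
  show "{rad E | E :: (nat \<times> nat) set. ugraph E \<and> card (Field E) \<le> N} \<subseteq> rad ` Pow ({0..<N} \<times> {0..<N})"
  proof clarify
    fix E :: "(nat \<times> nat) set" assume E: "ugraph E" and c: "card (Field E) \<le> N"
    obtain f where f: "bij_betw f (Field E) {0..<card (Field E)}"
      using ex_bij_betw_finite_nat[OF ugraphD(4)[OF E]] by auto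
    let ?E' = "map_prod f f ` E"
    define g where "g = the_inv_into (Field E) f"
    have inj: "inj_on f (Field E)" using f by (simp add: bij_betw_def)
    have img: "f v < card (Field E)" if "v \<in> Field E" for v
      using f that by (auto simp: bij_betw_def)
    have F': "Field ?E' = f ` Field E" by (force simp: Field_def Domain_iff Range_iff image_iff)
    have E': "ugraph ?E'"
      unfolding ugraph_def
    proof (intro conjI)
      show "finite ?E'" using ugraphD(1)[OF E] by simp
      show "sym ?E'" using ugraphD(2)[OF E] by (force simp: sym_def)
      show "irrefl ?E'"
        unfolding irrefl_def
        using inj_onD[OF inj] ugraphD(3)[OF E] FieldI1 FieldI2 by fastforce
    qed
    have "rad E \<le> rad ?E'" by (rule rad_mono_hom[OF E E' inj]) auto
    moreover have "rad ?E' \<le> rad E"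
      by (rule rad_mono_hom[OF E' E, of g])
        (simp add: F' g_def inj_on_the_inv_into[OF inj],
         auto simp: g_def the_inv_into_f_f[OF inj] FieldI1 FieldI2)
    moreover have "?E' \<subseteq> {0..<N} \<times> {0..<N}"
    proof -
      have "f v < N" if "v \<in> Field E" for v using img[OF that] c by simp
      then show ?thesis by (auto simp: FieldI1 FieldI2)
    qed
    ultimately show "rad E \<in> rad ` Pow ({0..<N} \<times> {0..<N})"
      by (intro image_eqI[of _ _ ?E']) auto
  qed
qed auto

end

section \<open>The quadratic form and the matrix spectral radius\<close>

context aspec
begin

lemma act_selfadjoint:
  assumes E: "ugraph E" and V: "finite V" "Field E \<subseteq> V"
  shows "(\<Sum>v\<in>V. x v * act E y v) = (\<Sum>v\<in>V. y v * act E x v)"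
proof -
  note fin = ugraphD(1)[OF E]
  have eq: "(\<Sum>v\<in>V. f v * act E g v) = (\<Sum>(v, w)\<in>E. \<alpha> * (f v * g v)) + (\<Sum>(v, w)\<in>E. (1 - \<alpha>) * (f v * g w))"
    for f g
    unfolding act_def sum_distrib_left sum_arcs[OF fin V] sum.distrib[symmetric]
    by (intro sum.cong refl) (simp add: algebra_simps)
  have "(\<Sum>(v, w)\<in>E. (1 - \<alpha>) * (x v * y w)) = (\<Sum>(v, w)\<in>E. (1 - \<alpha>) * (x w * y v))"
    by (rule sum_arcs_swap) (use E in \<open>simp add: ugraph_def\<close>)
  then show ?thesis unfolding eq by (simp add: mult.commute mult.left_commute)
qed

text \<open>The ratios of the norms of successive iterates do not decrease, by the Cauchy-Schwarz inequality.\<close>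

lemma selfadjoint_iterates_unbounded:
  fixes y :: "nat \<Rightarrow> 'v \<Rightarrow> real" and V :: "'v set"
  assumes adj: "\<And>k. (\<Sum>v\<in>V. y k v * y (Suc (Suc k)) v) = (\<Sum>v\<in>V. (y (Suc k) v)\<^sup>2)"
    and s: "s > 1" and pos: "(\<Sum>v\<in>V. (y 0 v)\<^sup>2) > 0"
    and start: "(\<Sum>v\<in>V. y 0 v * y 1 v) \<ge> s * (\<Sum>v\<in>V. (y 0 v)\<^sup>2)"
  shows "\<exists>k. (\<Sum>v\<in>V. (y k v)\<^sup>2) > M"
proof -
  define a where "a = (\<lambda>k. \<Sum>v\<in>V. (y k v)\<^sup>2)"
  have a0: "a 0 > 0" using pos by (simp add: a_def)
  have step: "a k > 0 \<and> a (Suc k) \<ge> s\<^sup>2 * a k" for k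
  proof (induction k)
    case 0
    have "(s * a 0)\<^sup>2 \<le> (\<Sum>v\<in>V. y 0 v * y 1 v)\<^sup>2"
      by (rule power_mono) (use start s a0 in \<open>auto simp: a_def\<close>)
    also have "\<dots> \<le> a 0 * a 1" unfolding a_def by (rule Cauchy_Schwarz_ineq_sum)
    finally have "a 0 * (s\<^sup>2 * a 0) \<le> a 0 * a 1" by (simp add: power2_eq_square algebra_simps)
    then show ?case using a0 by simp
  next
    case (Suc k)
    then have p: "a (Suc k) > 0"
      using s by (smt (verit) mult_pos_pos zero_less_power)
    have "(a (Suc k))\<^sup>2 \<le> a k * a (Suc (Suc k))"
      using Cauchy_Schwarz_ineq_sum[of "y k" "y (Suc (Suc k))" V] unfolding adj a_def .
    moreover have "a k * (s\<^sup>2 * a (Suc k)) \<le> (a (Suc k))\<^sup>2"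
      using mult_right_mono[of "s\<^sup>2 * a k" "a (Suc k)" "a (Suc k)"] Suc p
      by (simp add: power2_eq_square algebra_simps)
    ultimately have "a k * (s\<^sup>2 * a (Suc k)) \<le> a k * a (Suc (Suc k))" by linarith
    then show ?case using Suc p by simp
  qed
  have ak: "a k \<ge> (s\<^sup>2) ^ k * a 0" for k
  proof (induction k)
    case (Suc k)
    have "(s\<^sup>2) ^ Suc k * a 0 = s\<^sup>2 * ((s\<^sup>2) ^ k * a 0)" by simp
    also have "\<dots> \<le> s\<^sup>2 * a k" by (rule mult_left_mono[OF Suc]) simp
    also have "\<dots> \<le> a (Suc k)" using step[of k] by simp
    finally show ?case .
  qed simp
  have "s\<^sup>2 > 1" using s by (simp add: one_less_power)
  then obtain k where "M / a 0 < (s\<^sup>2) ^ k" using real_arch_pow by blast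
  then have "M < (s\<^sup>2) ^ k * a 0" using a0 by (simp add: field_simps)
  then show ?thesis using ak[of k] by (auto simp: a_def intro!: exI[of _ k])
qed

section \<open>From graphs to complex matrices\<close>

lemma simple_graph_facts:
  assumes "simple_graph G"
  obtains n where "n > 0" "pverts G = {0..<n}" "ugraph (parcs G)" "Field (parcs G) \<subseteq> {0..<n}"
proof -
  from assms obtain n where n: "n \<ge> 1" "pverts G = {0..<n}" and pg: "pair_graph G"
    unfolding simple_graph_def by auto
  interpret pair_graph G by (rule pg)
  have "ugraph (parcs G)"
    unfolding ugraph_def irrefl_def
    using pair_finite_arcs pair_sym_arcs pair_no_loops by (force simp: symmetric_def)
  moreover have "Field (parcs G) \<subseteq> {0..<n}"
    unfolding Field_def using arc_fst_in_verts arc_snd_in_verts n(2) by force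
  ultimately show ?thesis using n by (intro that[of n]) simp_all
qed

lemma A_alpha_index:
  assumes "pverts G = {0..<n}" "i < n" "j < n"
  shows "A_alpha \<alpha> G $$ (i, j) =
    \<alpha> * (if i = j then real (card (parcs G `` {i})) else 0) + (1 - \<alpha>) * (if (i, j) \<in> parcs G then 1 else 0)"
proof -
  have "out_degree (with_proj G) i = card (parcs G `` {i})" for i
  proof -
    have "out_arcs (with_proj G) i = Pair i ` (parcs G `` {i})"
      by (auto simp: out_arcs_def)
    then show ?thesis by (simp add: out_degree_def card_image inj_on_def)
  qed
  then show ?thesis using assms by (simp add: A_alpha_def adj_mat_def deg_mat_def)
qed

lemma A_alpha_carrier: "pverts G = {0..<n} \<Longrightarrow> A_alpha \<alpha> G \<in> carrier_mat n n"
  by (simp add: A_alpha_def adj_mat_def deg_mat_def)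

lemma A_alpha_mult_vec:
  assumes G: "pverts G = {0..<n}" "Field (parcs G) \<subseteq> {0..<n}" and i: "i < n"
    and v: "v \<in> carrier_vec n"
  shows "(map_mat complex_of_real (A_alpha \<alpha> G) *\<^sub>v v) $ i =
    (\<Sum>w\<in>parcs G `` {i}. of_real \<alpha> * v $ i + of_real (1 - \<alpha>) * v $ w)"
proof -
  let ?E = "parcs G"
  have sub: "?E `` {i} \<subseteq> {0..<n}" using G(2) by (auto simp: Field_def)
  have "(map_mat complex_of_real (A_alpha \<alpha> G) *\<^sub>v v) $ i =
      (\<Sum>j\<in>{0..<n}. of_real (A_alpha \<alpha> G $$ (i, j)) * v $ j)"
    using A_alpha_carrier[OF G(1)] i v by (auto simp: scalar_prod_def intro!: sum.cong)
  also have "\<dots> = (\<Sum>j\<in>{0..<n}. (if j = i then of_real (\<alpha> * real (card (?E `` {i}))) * v $ i else 0)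
      + (if j \<in> ?E `` {i} then of_real (1 - \<alpha>) * v $ j else 0))"
    by (intro sum.cong refl) (use i in \<open>auto simp: A_alpha_index[OF G(1)] algebra_simps\<close>)
  also have "\<dots> = of_real (\<alpha> * real (card (?E `` {i}))) * v $ i
      + (\<Sum>j\<in>{0..<n}. if j \<in> ?E `` {i} then of_real (1 - \<alpha>) * v $ j else 0)"
    using i by (simp add: sum.distrib)
  also have "(\<Sum>j\<in>{0..<n}. if j \<in> ?E `` {i} then of_real (1 - \<alpha>) * v $ j else 0)
      = (\<Sum>j\<in>?E `` {i}. of_real (1 - \<alpha>) * v $ j)"
    using sum.inter_restrict[of "{0..<n}" "\<lambda>j. of_real (1 - \<alpha>) * v $ j" "?E `` {i}"] sub
    by (simp add: inf.absorb2)
  also have "of_real (\<alpha> * real (card (?E `` {i}))) * v $ i + \<dots>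
      = (\<Sum>w\<in>?E `` {i}. of_real \<alpha> * v $ i + of_real (1 - \<alpha>) * v $ w)"
    by (simp add: sum.distrib)
  finally show ?thesis .
qed

text \<open>The absolute values of a complex eigenvector for an eigenvalue of maximal modulus: the
  triangle inequality makes them a subsolution. The inequality suffices below, so no
  Perron-Frobenius theorem is invoked.\<close>

lemma perron_vector:
  assumes G: "simple_graph G"
  obtains x where "\<And>v. 0 \<le> x v" "\<exists>v\<in>pverts G. x v > 0"
    "\<And>v. v \<in> pverts G \<Longrightarrow> act (parcs G) x v \<ge> rho \<alpha> G * x v"
proof -
  from simple_graph_facts[OF G] obtain n
    where n: "n > 0" "pverts G = {0..<n}" "ugraph (parcs G)" "Field (parcs G) \<subseteq> {0..<n}" .
  let ?A = "map_mat complex_of_real (A_alpha \<alpha> G)"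
  have A: "?A \<in> carrier_mat n n" using A_alpha_carrier[OF n(2)] by simp
  from spectral_radius_mem_max(1)[OF A n(1)] obtain ev
    where ev: "eigenvalue ?A ev" "rho \<alpha> G = norm ev"
    unfolding rho_def spectrum_def by auto
  then obtain v where v: "v \<in> carrier_vec n" "v \<noteq> 0\<^sub>v n" "?A *\<^sub>v v = ev \<cdot>\<^sub>v v"
    using A unfolding eigenvalue_def eigenvector_def by auto
  define x where "x = (\<lambda>i. norm (v $ i))"
  have "\<exists>i<n. v $ i \<noteq> 0"
    using v(1,2) by (metis carrier_vecD eq_vecI index_zero_vec(1) index_zero_vec(2))
  then have "\<exists>i\<in>pverts G. x i > 0" by (auto simp: x_def n(2))
  moreover have "act (parcs G) x i \<ge> rho \<alpha> G * x i" if "i \<in> pverts G" for i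
  proof -
    have i: "i < n" using that n(2) by simp
    have "rho \<alpha> G * x i = norm ((?A *\<^sub>v v) $ i)"
      using v i by (simp add: ev(2) x_def norm_mult)
    also have "\<dots> \<le> (\<Sum>w\<in>parcs G `` {i}. norm (of_real \<alpha> * v $ i + of_real (1 - \<alpha>) * v $ w))"
      unfolding A_alpha_mult_vec[OF n(2,4) i v(1)] by (rule norm_sum)
    also have "\<dots> \<le> act (parcs G) x i"
      unfolding act_def
    proof (rule sum_mono)
      fix w
      show "norm (of_real \<alpha> * v $ i + of_real (1 - \<alpha>) * v $ w) \<le> \<alpha> * x i + (1 - \<alpha>) * x w"
        using norm_triangle_ineq[of "of_real \<alpha> * v $ i" "of_real (1 - \<alpha>) * v $ w"] alpha_ge0 alpha_lt1
        by (simp add: norm_mult x_def del: of_real_diff)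
    qed
    finally show ?thesis .
  qed
  ultimately show ?thesis using that[of x] by (simp add: x_def)
qed

text \<open>This avoids diagonalisation. If a Rayleigh quotient exceeded rho, choose m strictly
  between them. The matrix A / m has spectral radius below 1, so its powers are bounded, whereas
  self-adjointness makes the iterates of the test vector unbounded.\<close>

lemma quad_le_rho:
  assumes G: "simple_graph G"
  shows "quad (parcs G) x \<le> rho \<alpha> G * (\<Sum>v\<in>pverts G. (x v)\<^sup>2)"
proof (rule ccontr)
  assume neg: "\<not> ?thesis"
  from simple_graph_facts[OF G] obtain n
    where n: "n > 0" "pverts G = {0..<n}" "ugraph (parcs G)" "Field (parcs G) \<subseteq> {0..<n}" .
  let ?A = "map_mat complex_of_real (A_alpha \<alpha> G)"
  let ?E = "parcs G"
  let ?V = "{0..<n}"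
  define N where "N = (\<Sum>v\<in>?V. (x v)\<^sup>2)"
  have A: "?A \<in> carrier_mat n n" using A_alpha_carrier[OF n(2)] by simp
  have rho0: "rho \<alpha> G \<ge> 0"
    using spectral_radius_mem_max(1)[OF A n(1)] by (auto simp: rho_def)
  have N0: "N \<ge> 0" unfolding N_def by (rule sum_nonneg) simp
  have Npos: "N > 0"
  proof (rule ccontr)
    assume "\<not> N > 0"
    then have "N = 0" using N0 by simp
    then have "x v = 0" if "v \<in> ?V" for v
      using that unfolding N_def by (subst (asm) sum_nonneg_eq_0_iff) auto
    then have "quad ?E x = 0"
      unfolding quad_act[OF ugraphD(1)[OF n(3)] finite_atLeastLessThan n(4)] by simp
    then show False using neg \<open>N = 0\<close> by (simp add: n(2) N_def)
  qed
  have "rho \<alpha> G < quad ?E x / N" using neg Npos by (simp add: field_simps n(2) N_def)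
  then obtain m where m: "rho \<alpha> G < m" "m < quad ?E x / N" using dense by blast
  then have m0: "m > 0" using rho0 by simp
  define s where "s = quad ?E x / N / m"
  have s: "s > 1" unfolding s_def using m(2) m0 by (simp only: less_divide_eq_1_pos)
  define B where "B = complex_of_real (1 / m) \<cdot>\<^sub>m ?A"
  have B: "B \<in> carrier_mat n n" using A by (simp add: B_def)
  have sr: "spectral_radius B < 1"
  proof -
    from spectral_radius_mem_max(1)[OF B n(1)] obtain ev
      where ev: "eigenvalue B ev" "spectral_radius B = norm ev"
      unfolding spectrum_def by auto
    then obtain v where v: "v \<in> carrier_vec n" "v \<noteq> 0\<^sub>v n" "B *\<^sub>v v = ev \<cdot>\<^sub>v v"
      using B unfolding eigenvalue_def eigenvector_def by auto
    have Bv: "B *\<^sub>v v = complex_of_real (1 / m) \<cdot>\<^sub>v (?A *\<^sub>v v)"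
      unfolding B_def by (rule eq_vecI) (use A v(1) in \<open>auto simp: scalar_prod_def sum_distrib_left mult.assoc\<close>)
    have "?A *\<^sub>v v = (complex_of_real m * ev) \<cdot>\<^sub>v v"
    proof (rule eq_vecI)
      fix i assume i: "i < dim_vec ((complex_of_real m * ev) \<cdot>\<^sub>v v)"
      then have "(B *\<^sub>v v) $ i = complex_of_real (1 / m) * (?A *\<^sub>v v) $ i"
        unfolding Bv using A v(1) by simp
      then show "(?A *\<^sub>v v) $ i = ((complex_of_real m * ev) \<cdot>\<^sub>v v) $ i"
        using m0 i v(1) unfolding v(3) by (simp add: field_simps)
    qed (use A v(1) in auto)
    then have "eigenvalue ?A (complex_of_real m * ev)"
      using v A unfolding eigenvalue_def eigenvector_def by auto
    then have "norm (complex_of_real m * ev) \<le> rho \<alpha> G"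
      unfolding rho_def by (intro spectral_radius_mem_max(2)[OF A n(1)]) (auto simp: spectrum_def)
    then have "m * norm ev \<le> rho \<alpha> G" using m0 by (simp add: norm_mult)
    then have "m * norm ev < m * 1" using m(1) by linarith
    then show ?thesis using m0 ev(2) by (simp only: mult_less_cancel_left_pos)
  qed
  from spectral_radius_jnf_norm_bound_less_1_upper_triangular[OF B sr]
  obtain c where c: "\<And>k. norm_bound (B ^\<^sub>m k) c" by auto
  \<comment> \<open>The same iteration on real functions; \<open>Bvec\<close> and \<open>pow\<close>
    identify it with the powers of the complex matrix.\<close>
  define T where "T = (\<lambda>y v. act ?E y v / m)"
  define y where "y = (\<lambda>k. (T ^^ k) x)"
  have Bvec: "B *\<^sub>v vec n (\<lambda>i. complex_of_real (z i)) = vec n (\<lambda>i. complex_of_real (T z i))" for z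
  proof (rule eq_vecI)
    fix i assume "i < dim_vec (vec n (\<lambda>i. complex_of_real (T z i)))"
    then have i: "i < n" by simp
    have sub: "w < n" if "w \<in> ?E `` {i}" for w using that n(4) by (auto simp: Field_def)
    have "(B *\<^sub>v vec n (\<lambda>i. complex_of_real (z i))) $ i
        = complex_of_real (1 / m) * (?A *\<^sub>v vec n (\<lambda>i. complex_of_real (z i))) $ i"
      unfolding B_def using A i by (auto simp: scalar_prod_def sum_distrib_left mult.assoc)
    also have "(?A *\<^sub>v vec n (\<lambda>i. complex_of_real (z i))) $ i = complex_of_real (act ?E z i)"
      by (subst A_alpha_mult_vec[OF n(2,4) i])
        (use i sub in \<open>auto simp: act_def intro!: sum.cong\<close>)
    finally show "(B *\<^sub>v vec n (\<lambda>i. complex_of_real (z i))) $ i = vec n (\<lambda>i. complex_of_real (T z i)) $ i"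
      using i by (simp add: T_def)
  qed (use B in auto)
  have pow: "B ^\<^sub>m k *\<^sub>v vec n (\<lambda>i. complex_of_real (z i)) = vec n (\<lambda>i. complex_of_real ((T ^^ k) z i))" for k z
  proof (induction k arbitrary: z)
    case 0
    then show ?case using B by simp
  next
    case (Suc k)
    have "B ^\<^sub>m Suc k *\<^sub>v vec n (\<lambda>i. complex_of_real (z i))
        = B ^\<^sub>m k *\<^sub>v (B *\<^sub>v vec n (\<lambda>i. complex_of_real (z i)))"
      using assoc_mult_mat_vec[OF pow_carrier_mat[OF B] B] by simp
    then show ?case unfolding Bvec Suc by (simp add: funpow_swap1)
  qed
  define M where "M = (\<Sum>j\<in>?V. c * \<bar>x j\<bar>)"
  have bd: "\<bar>y k i\<bar> \<le> M" if i: "i < n" for k i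
  proof -
    have Bk: "B ^\<^sub>m k \<in> carrier_mat n n" using B by simp
    have "complex_of_real (y k i) = (B ^\<^sub>m k *\<^sub>v vec n (\<lambda>i. complex_of_real (x i))) $ i"
      unfolding pow using i by (simp add: y_def)
    also have "\<dots> = (\<Sum>j\<in>?V. (B ^\<^sub>m k) $$ (i, j) * complex_of_real (x j))"
      using Bk i by (auto simp: scalar_prod_def simp del: pow_mat_dim intro!: sum.cong)
    finally have "norm (complex_of_real (y k i)) \<le> (\<Sum>j\<in>?V. norm ((B ^\<^sub>m k) $$ (i, j) * complex_of_real (x j)))"
      by (simp only: norm_sum)
    also have "\<dots> \<le> M"
      unfolding M_def
    proof (rule sum_mono)
      fix j assume "j \<in> ?V"
      then have "norm ((B ^\<^sub>m k) $$ (i, j)) \<le> c"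
        using c[of k] i Bk unfolding norm_bound_def carrier_mat_def by auto
      then show "norm ((B ^\<^sub>m k) $$ (i, j) * complex_of_real (x j)) \<le> c * \<bar>x j\<bar>"
        by (simp add: norm_mult mult_right_mono)
    qed
    finally show ?thesis by simp
  qed
  have ySuc: "y (Suc k) v = act ?E (y k) v / m" for k v
    by (simp add: y_def T_def)
  have "\<exists>k. (\<Sum>v\<in>?V. (y k v)\<^sup>2) > real n * M\<^sup>2"
  proof (rule selfadjoint_iterates_unbounded[OF _ s])
    fix k
    have "(\<Sum>v\<in>?V. y k v * y (Suc (Suc k)) v) = (\<Sum>v\<in>?V. y k v * act ?E (y (Suc k)) v) / m"
      by (simp add: ySuc[of "Suc k"] sum_divide_distrib)
    also have "\<dots> = (\<Sum>v\<in>?V. y (Suc k) v * act ?E (y k) v) / m"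
      by (subst act_selfadjoint[OF n(3) finite_atLeastLessThan n(4)]) (rule refl)
    also have "\<dots> = (\<Sum>v\<in>?V. (y (Suc k) v)\<^sup>2)"
      unfolding sum_divide_distrib
      by (intro sum.cong refl) (simp add: ySuc[of k] power2_eq_square)
    finally show "(\<Sum>v\<in>?V. y k v * y (Suc (Suc k)) v) = (\<Sum>v\<in>?V. (y (Suc k) v)\<^sup>2)" .
  next
    show "0 < (\<Sum>v\<in>?V. (y 0 v)\<^sup>2)" using Npos by (simp add: y_def N_def)
    have "(\<Sum>v\<in>?V. y 0 v * y 1 v) = (\<Sum>v\<in>?V. x v * act ?E x v) / m"
      unfolding sum_divide_distrib
      by (intro sum.cong refl) (simp add: y_def T_def)
    also have "\<dots> = s * N"
      using Npos unfolding s_def quad_act[OF ugraphD(1)[OF n(3)] finite_atLeastLessThan n(4)] by simp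
    finally show "s * (\<Sum>v\<in>?V. (y 0 v)\<^sup>2) \<le> (\<Sum>v\<in>?V. y 0 v * y 1 v)"
      by (simp add: y_def N_def)
  qed
  then obtain k where k: "(\<Sum>v\<in>?V. (y k v)\<^sup>2) > real n * M\<^sup>2" by auto
  have "(\<Sum>v\<in>?V. (y k v)\<^sup>2) \<le> (\<Sum>v\<in>?V. M\<^sup>2)"
    by (rule sum_mono) (use bd in \<open>metis abs_ge_zero abs_le_square_iff abs_of_nonneg atLeastLessThan_iff order_trans\<close>)
  then show False using k by simp
qed

lemma rho_eq_rad:
  assumes G: "simple_graph G"
  shows "rho \<alpha> G = rad (parcs G)"
proof (rule antisym)
  from simple_graph_facts[OF G] obtain n
    where n: "n > 0" "pverts G = {0..<n}" "ugraph (parcs G)" "Field (parcs G) \<subseteq> {0..<n}" .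
  note q = quad_act[OF ugraphD(1)[OF n(3)] finite_atLeastLessThan n(4)]
  from perron_vector[OF G] obtain x where x: "\<And>v. 0 \<le> x v" "\<exists>v\<in>pverts G. x v > 0"
    "\<And>v. v \<in> pverts G \<Longrightarrow> act (parcs G) x v \<ge> rho \<alpha> G * x v" by blast
  show "rho \<alpha> G \<le> rad (parcs G)"
  proof (rule rad_ge[OF n(3) _ n(4)])
    from x(2) show "0 < (\<Sum>v\<in>{0..<n}. (x v)\<^sup>2)"
      unfolding n(2) by (auto intro!: sum_pos2)
    have "rho \<alpha> G * (\<Sum>v\<in>{0..<n}. (x v)\<^sup>2) = (\<Sum>v\<in>{0..<n}. x v * (rho \<alpha> G * x v))"
      by (simp add: sum_distrib_left power2_eq_square mult.left_commute)
    also have "\<dots> \<le> quad (parcs G) x"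
      unfolding q by (intro sum_mono mult_left_mono) (use x n(2) in auto)
    finally show "rho \<alpha> G * (\<Sum>v\<in>{0..<n}. (x v)\<^sup>2) \<le> quad (parcs G) x" .
  qed simp
  have A: "map_mat complex_of_real (A_alpha \<alpha> G) \<in> carrier_mat n n"
    using A_alpha_carrier[OF n(2)] by simp
  have r0: "rho \<alpha> G \<ge> 0"
    using spectral_radius_mem_max(1)[OF A n(1)] by (auto simp: rho_def)
  show "rad (parcs G) \<le> rho \<alpha> G"
  proof (rule rad_le[OF n(3) r0])
    fix x :: "nat \<Rightarrow> real"
    let ?x = "\<lambda>v. if v \<in> Field (parcs G) then x v else 0"
    have "quad (parcs G) x = quad (parcs G) ?x"
      unfolding quad_def by (intro sum.cong refl) (auto simp: FieldI1 FieldI2)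
    also have "\<dots> \<le> rho \<alpha> G * (\<Sum>v\<in>{0..<n}. (?x v)\<^sup>2)"
      using quad_le_rho[OF G, of ?x] n(2) by simp
    also have "(\<Sum>v\<in>{0..<n}. (?x v)\<^sup>2) = (\<Sum>v\<in>Field (parcs G). (?x v)\<^sup>2)"
      by (rule sum.mono_neutral_right[OF _ n(4)]) auto
    finally show "quad (parcs G) x \<le> rho \<alpha> G * nsq (parcs G) x" by (simp add: nsq_def)
  qed
qed

text \<open>Pair \<open>y\<close> with the subsolution \<open>x\<close> of
  \<open>perron_vector\<close>. If rho = l, self-adjointness makes a sum of nonnegative terms
  vanish, so x e = 0 and A x = l x throughout. Zeros then spread to neighbours, and connectedness
  forces x = 0. Strictness is what later yields pairwise distinct radii.\<close>

lemma rho_less_strict_supersolution: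
  assumes G: "simple_graph G"
    and pos: "\<And>v. v \<in> pverts G \<Longrightarrow> y v > 0"
    and sup: "\<And>v. v \<in> pverts G \<Longrightarrow> act (parcs G) y v \<le> l * y v"
    and e: "e \<in> pverts G" "act (parcs G) y e < l * y e"
    and conn: "\<And>Z. e \<in> Z \<Longrightarrow> (\<And>v w. v \<in> Z \<Longrightarrow> (v, w) \<in> parcs G \<Longrightarrow> w \<in> Z) \<Longrightarrow> pverts G \<subseteq> Z"
  shows "rho \<alpha> G < l"
proof -
  from simple_graph_facts[OF G] obtain n
    where n: "n > 0" "pverts G = {0..<n}" "ugraph (parcs G)" "Field (parcs G) \<subseteq> {0..<n}" .
  let ?E = "parcs G"
  have y0: "y w \<ge> 0" if "w \<in> ?E `` {v}" for v w
    using that pos[of w] n(2,4) by (force simp: Field_def)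
  have "act ?E y e \<ge> 0"
    unfolding act_def
    by (rule sum_nonneg) (use y0 pos[OF e(1)] alpha_ge0 alpha_lt1 in \<open>auto intro!: add_nonneg_nonneg mult_nonneg_nonneg\<close>)
  then have l0: "l \<ge> 0" using e pos[OF e(1)] by (smt (verit) mult_nonpos_nonneg)
  have le: "rho \<alpha> G \<le> l"
    unfolding rho_eq_rad[OF G]
    by (rule rad_le_supersolution[OF n(3) l0, of y]) (use pos sup n(2,4) in auto)
  moreover have "rho \<alpha> G \<noteq> l"
  proof
    assume eq: "rho \<alpha> G = l"
    from perron_vector[OF G] obtain x where x: "\<And>v. 0 \<le> x v" "\<exists>v\<in>pverts G. x v > 0"
      "\<And>v. v \<in> pverts G \<Longrightarrow> act ?E x v \<ge> l * x v" unfolding eq by blast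
    let ?f = "\<lambda>v. x v * (l * y v - act ?E y v) + y v * (act ?E x v - l * x v)"
    have "(\<Sum>v\<in>{0..<n}. ?f v) = 0"
      using act_selfadjoint[OF n(3) finite_atLeastLessThan n(4), of x y]
      by (simp add: sum.distrib sum_subtractf right_diff_distrib mult.left_commute)
    moreover have t: "x v * (l * y v - act ?E y v) \<ge> 0" "y v * (act ?E x v - l * x v) \<ge> 0" if "v \<in> {0..<n}" for v
      using that x sup pos n(2) by (auto intro!: mult_nonneg_nonneg simp: less_imp_le)
    ultimately have f0: "?f v = 0" if "v \<in> {0..<n}" for v
      using that sum_nonneg_eq_0_iff[of "{0..<n}" ?f] by (auto intro!: add_nonneg_nonneg)
    have z: "x v * (l * y v - act ?E y v) = 0" "y v * (act ?E x v - l * x v) = 0" if "v \<in> {0..<n}" for v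
      using f0[OF that] t[OF that] by linarith+
    have "pverts G \<subseteq> {v \<in> pverts G. x v = 0}"
    proof (rule conn)
      show "e \<in> {v \<in> pverts G. x v = 0}" using z(1)[of e] e n(2) by simp
    next
      fix v w assume v: "v \<in> {v \<in> pverts G. x v = 0}" and vw: "(v, w) \<in> ?E"
      then have vn: "v \<in> {0..<n}" using n(2) by simp
      have "act ?E x v = 0" using z(2)[OF vn] pos[of v] v by simp
      then have "(\<Sum>w\<in>?E `` {v}. (1 - \<alpha>) * x w) = 0" using v by (simp add: act_def)
      then have "(1 - \<alpha>) * x w = 0"
        using vw x(1) alpha_lt1 ugraphD(5)[OF n(3)] by (subst (asm) sum_nonneg_eq_0_iff) auto
      then have "x w = 0" using alpha_lt1 by simp
      then show "w \<in> {v \<in> pverts G. x v = 0}" using vw n(2,4) by (force simp: Field_def)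
    qed
    then show False using x(2) by auto
  qed
  ultimately show ?thesis by simp
qed

end

section \<open>Long paths, components and deletion of an edge\<close>

text \<open>Closed sets instead of walks, because connectedness is used to show that a set closed
  under arcs is the whole graph.\<close>

definition connected_graph :: "('v \<times> 'v) set \<Rightarrow> bool" where
  "connected_graph E \<longleftrightarrow>
     (\<forall>X. (\<forall>a b. (a, b) \<in> E \<longrightarrow> a \<in> X \<longrightarrow> b \<in> X) \<longrightarrow> X \<inter> Field E \<noteq> {} \<longrightarrow> Field E \<subseteq> X)"

lemma connected_graphD:
  assumes "connected_graph E" "\<And>a b. (a, b) \<in> E \<Longrightarrow> a \<in> X \<Longrightarrow> b \<in> X" "a \<in> X" "a \<in> Field E"
  shows "Field E \<subseteq> X"
  using assms unfolding connected_graph_def by blast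

text \<open>Balls grow by a factor of at most d + 1 per step, so some vertex lies outside the ball
  of radius D. A shortest path to it is injective because its vertices have different distances from
  v.\<close>

lemma bounded_degree_long_path:
  assumes E: "ugraph E" and conn: "connected_graph E"
    and deg: "\<And>v. card (E `` {v}) \<le> d" and big: "card (Field E) > (d + 1) ^ D"
  obtains p where "inj_on p {0..D}" "\<And>i. i < D \<Longrightarrow> (p i, p (Suc i)) \<in> E"
proof -
  have "Field E \<noteq> {}" using big by auto
  then obtain v where v: "v \<in> Field E" by auto
  define B where "B = rec_nat {v} (\<lambda>_ A. A \<union> E `` A)"
  have B0: "B 0 = {v}" and BS: "B (Suc k) = B k \<union> E `` B k" for k by (simp_all add: B_def)
  have fin: "finite (B k)" for k
    by (induction k) (auto simp: B0 BS intro: ugraphD(5)[OF E])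
  have card_image: "card (E `` A) \<le> d * card A" if "finite A" for A
  proof -
    have "E `` A = (\<Union>a\<in>A. E `` {a})" by auto
    then have "card (E `` A) \<le> (\<Sum>a\<in>A. card (E `` {a}))"
      using card_UN_le[OF that] by simp
    also have "\<dots> \<le> (\<Sum>a\<in>A. d)" by (rule sum_mono) (rule deg)
    finally show ?thesis by (simp add: mult.commute)
  qed
  have cardB: "card (B k) \<le> (d + 1) ^ k" for k
  proof (induction k)
    case (Suc k)
    have "card (B (Suc k)) \<le> card (B k) + d * card (B k)"
      unfolding BS using card_Un_le[of "B k" "E `` B k"] card_image[OF fin[of k]] by linarith
    also have "\<dots> = (d + 1) * card (B k)" by simp
    also have "\<dots> \<le> (d + 1) * (d + 1) ^ k" by (rule mult_le_mono2[OF Suc])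
    finally show ?case by simp
  qed (simp add: B0)
  have mono: "B j \<subseteq> B k" if "j \<le> k" for j k
    using that by (induction rule: dec_induct) (auto simp: BS)
  have "Field E \<subseteq> (\<Union>k. B k)"
  proof (rule connected_graphD[OF conn])
    show "v \<in> (\<Union>k. B k)" using B0 by auto
    show "b \<in> (\<Union>k. B k)" if "(a, b) \<in> E" "a \<in> (\<Union>k. B k)" for a b
    proof -
      from that obtain k where "a \<in> B k" by auto
      then have "b \<in> B (Suc k)" using that by (auto simp: BS)
      then show ?thesis by auto
    qed
  qed (rule v)
  moreover have "\<not> Field E \<subseteq> B D"
  proof
    assume "Field E \<subseteq> B D"
    from card_mono[OF fin this] cardB[of D] big show False by linarith
  qed
  ultimately obtain w k0 where w: "w \<notin> B D" "w \<in> B k0" by blast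
  define k where "k = (LEAST k. w \<in> B k)"
  have wk: "w \<in> B k" unfolding k_def using w(2) by (rule LeastI)
  have wl: "w \<notin> B j" if "j < k" for j using not_less_Least that unfolding k_def by blast
  have kD: "D \<le> k"
  proof (rule ccontr)
    assume "\<not> D \<le> k"
    then have "B k \<subseteq> B D" by (intro mono) simp
    then show False using wk w(1) by auto
  qed
  \<comment> \<open>The path is traced backwards through the layers: its i-th vertex is in
    \<open>B i\<close> but in no smaller ball.\<close>
  have "\<exists>p. (\<forall>i\<le>k. p i \<in> B i \<and> (\<forall>j<i. p i \<notin> B j)) \<and> (\<forall>i<k. (p i, p (Suc i)) \<in> E)"
    if "w \<in> B k" "\<And>j. j < k \<Longrightarrow> w \<notin> B j" for w k
  proof -
    have "\<exists>p. p k = w \<and> (\<forall>i\<le>k. p i \<in> B i \<and> (\<forall>j<i. p i \<notin> B j)) \<and> (\<forall>i<k. (p i, p (Suc i)) \<in> E)"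
      using that
    proof (induction k arbitrary: w)
      case 0
      then show ?case by (intro exI[of _ "\<lambda>_. w"]) auto
    next
      case (Suc k)
      from Suc.prems(1) Suc.prems(2)[of k] obtain w' where w': "w' \<in> B k" "(w', w) \<in> E"
        by (auto simp: BS)
      have "w' \<notin> B j" if "j < k" for j
        using Suc.prems(2)[of "Suc j"] w'(2) that by (auto simp: BS)
      from Suc.IH[OF w'(1) this] obtain p where
        p: "p k = w'" "\<forall>i\<le>k. p i \<in> B i \<and> (\<forall>j<i. p i \<notin> B j)" "\<forall>i<k. (p i, p (Suc i)) \<in> E"
        by auto
      show ?case
        by (rule exI[of _ "p(Suc k := w)"])
          (use p w' Suc.prems in \<open>auto simp: le_Suc_eq less_Suc_eq\<close>)
    qed
    then show ?thesis by auto
  qed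
  from this[OF wk wl] obtain p where p: "\<And>i. i \<le> k \<Longrightarrow> p i \<in> B i"
    "\<And>i j. i \<le> k \<Longrightarrow> j < i \<Longrightarrow> p i \<notin> B j" "\<And>i. i < k \<Longrightarrow> (p i, p (Suc i)) \<in> E"
    by blast
  have "inj_on p {0..D}"
  proof (rule inj_onI)
    fix i j assume "i \<in> {0..D}" "j \<in> {0..D}" "p i = p j"
    then show "i = j"
      using p(1)[of i] p(1)[of j] p(2)[of i j] p(2)[of j i] kD by (cases i j rule: linorder_cases) auto
  qed
  then show thesis using that p(3) kD by auto
qed

context aspec
begin

definition lam :: "real \<Rightarrow> real" where
  "lam t = 2 * \<alpha> + (1 - \<alpha>) * (t + 1 / t)"

text \<open>For nonnegative vectors, omitted neighbours only lose nonnegative terms. Test vectors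
  can thus be designed for a tree although the graph may have further edges.\<close>

lemma act_ge_partial:
  assumes E: "ugraph E" and x: "\<And>w. 0 \<le> x w" and M: "M \<subseteq> E `` {v}"
  shows "(\<Sum>w\<in>M. \<alpha> * x v + (1 - \<alpha>) * x w) \<le> act E x v"
  unfolding act_def
  by (rule sum_mono2[OF ugraphD(5)[OF E] M])
    (use x alpha_ge0 alpha_lt1 in \<open>auto intro!: add_nonneg_nonneg mult_nonneg_nonneg\<close>)

text \<open>
  Extending a test vector on \<open>S\<close> along a path by powers of \<open>1 / t\<close> solves the eigenvalue equation
  for \<open>lam t\<close> except at the far end; since the squared entries do not increase along the path,
  that defect costs at most a fraction \<open>1 / (L + 1)\<close> of the squared norm.
\<close>

lemma rad_ge_path_extension:
  assumes E: "ugraph E" and t: "1 \<le> t" and S: "finite S" "u \<in> S"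
    and x: "\<And>v. v \<in> S \<Longrightarrow> 0 \<le> x v" "x u = 1"
    and N: "\<And>v. v \<in> S \<Longrightarrow> N v \<subseteq> S" "\<And>v. v \<in> S \<Longrightarrow> N v \<subseteq> E `` {v}"
    and pt: "\<And>v. v \<in> S \<Longrightarrow> v \<noteq> u \<Longrightarrow> lam t * x v \<le> (\<Sum>w\<in>N v. \<alpha> * x v + (1 - \<alpha>) * x w)"
    and ptu: "lam t - d \<le> (\<Sum>w\<in>N u. \<alpha> + (1 - \<alpha>) * x w) + (\<alpha> + (1 - \<alpha>) / t)"
    and d: "0 \<le> d" "d \<le> (1 / t) ^ (2 * L)"
    and L: "1 \<le> L" and z: "inj_on z {0..L}" "z 0 = u" "z ` {1..L} \<inter> S = {}"
    and zE: "\<And>i. i < L \<Longrightarrow> (z i, z (Suc i)) \<in> E"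
  shows "lam t - 2 / (real L + 1) \<le> rad E"
proof -
  define r where "r = 1 / t"
  have r: "0 < r" "r \<le> 1" using t by (simp_all add: r_def)
  define X where "X = (\<lambda>v. if v \<in> S then x v else if v \<in> z ` {1..L} then r ^ the_inv_into {0..L} z v else 0)"
  define W where "W = S \<union> z ` {1..L}"
  define V where "V = Field E \<union> W"
  have finW: "finite W" and finV: "finite V" using S(1) ugraphD(4)[OF E] by (simp_all add: W_def V_def)
  have zS: "z i \<notin> S" if "1 \<le> i" "i \<le> L" for i
    using that z(3) by (auto simp: disjoint_iff)
  have Xz: "X (z i) = r ^ i" if "i \<le> L" for i
  proof (cases "i = 0")
    case True
    then show ?thesis using z(2) S(2) x(2) by (simp add: X_def)
  next
    case False
    then show ?thesis
      using that zS[of i] the_inv_into_f_f[OF z(1), of i] by (simp add: X_def)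
  qed
  have XS: "X v = x v" if "v \<in> S" for v using that by (simp add: X_def)
  have X0: "0 \<le> X v" for v using x(1) r by (auto simp: X_def)
  have z_ne: "z i \<noteq> z j" if "i \<le> L" "j \<le> L" "i \<noteq> j" for i j
    using that z(1) by (auto simp: inj_on_def)
  have lamr: "lam t = 2 * \<alpha> + (1 - \<alpha>) * (1 / r + r)" by (simp add: lam_def r_def)
  \<comment> \<open>Defects of the eigenvalue equation: d at u and at most r ^ L at the far end.
    Weighted by X they amount to d + r ^ (2 * L), at most 2 * r ^ (2 * L), while the L + 1 path
    vertices carry squared entries of at least r ^ (2 * L) each.\<close>
  define e where "e = (\<lambda>v. if v = u then d else if v = z L then r ^ L else 0)"
  have main: "lam t * (X v)\<^sup>2 - X v * e v \<le> X v * act E X v" if v: "v \<in> W" for v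
  proof -
    have "lam t * X v - e v \<le> act E X v"
    proof (cases "v \<in> S")
      case True
      have sumN: "(\<Sum>w\<in>N v. \<alpha> * X v + (1 - \<alpha>) * X w) = (\<Sum>w\<in>N v. \<alpha> * x v + (1 - \<alpha>) * x w)"
        by (intro sum.cong refl) (use N(1)[OF True] True XS in auto)
      show ?thesis
      proof (cases "v = u")
        case False
        have "lam t * X v \<le> act E X v"
          using pt[OF True False] act_ge_partial[where x = X, OF E X0 N(2)[OF True]] sumN True
          by (simp add: XS)
        moreover have "v \<noteq> z L" using zS[of L] L True by auto
        ultimately show ?thesis using False by (simp add: e_def)
      next
        case vu: True
        have z1: "z 1 \<notin> N u" using zS[of 1] L N(1)[OF S(2)] by auto
        have finN: "finite (N u)" using finite_subset[OF N(1)[OF S(2)] S(1)] .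
        have "insert (z 1) (N u) \<subseteq> E `` {u}" using N(2)[OF S(2)] zE[of 0] L z(2) by auto
        from act_ge_partial[where x = X, OF E X0 this]
        have "\<alpha> * X u + (1 - \<alpha>) * X (z 1) + (\<Sum>w\<in>N u. \<alpha> * X u + (1 - \<alpha>) * X w) \<le> act E X u"
          unfolding sum.insert[OF finN z1] .
        moreover have "X (z 1) = 1 / t" using Xz[of 1] L by (simp add: r_def)
        ultimately show ?thesis
          using ptu sumN x(2) S(2) unfolding vu e_def by (simp add: XS)
      qed
    next
      case False
      then obtain i where i: "1 \<le> i" "i \<le> L" "v = z i" using v by (auto simp: W_def)
      have vu: "v \<noteq> u" using False S(2) by auto
      have Xp: "X (z (i - 1)) = r ^ (i - 1)" using Xz[of "i - 1"] i by simp
      have ri: "r ^ i = r * r ^ (i - 1)" using i(1) by (cases i) auto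
      have prev: "z (i - 1) \<in> E `` {v}"
        using zE[of "i - 1"] i ugraphD(2)[OF E] by auto
      show ?thesis
      proof (cases "i = L")
        case True
        have "\<alpha> * X v + (1 - \<alpha>) * X (z (i - 1)) \<le> act E X v"
          using act_ge_partial[where x = X, OF E X0, of "{z (i - 1)}" v] prev by simp
        \<comment> \<open>The absent vertex beyond the end would contribute \<alpha> * r ^ L + (1 -
          \<alpha>) * r ^ (L + 1), which is at most r ^ L.\<close>
        moreover have "lam t * r ^ i - r ^ i \<le> \<alpha> * r ^ i + (1 - \<alpha>) * r ^ (i - 1)"
        proof -
          have "\<alpha> * r ^ i + (1 - \<alpha>) * r ^ (i - 1) - (lam t * r ^ i - r ^ i)
              = (1 - \<alpha>) * r ^ i * (1 - r)"
            unfolding lamr ri using r by (simp add: field_simps)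
          also have "\<dots> \<ge> 0" using r alpha_lt1 by simp
          finally show ?thesis by simp
        qed
        ultimately show ?thesis
          using vu True i Xz[of i] Xp by (simp add: e_def)
      next
        case False
        then have iL: "i < L" using i by simp
        have ne: "z (i - 1) \<noteq> z (Suc i)" using iL i by (intro z_ne) auto
        have "(\<Sum>w\<in>{z (i - 1), z (Suc i)}. \<alpha> * X v + (1 - \<alpha>) * X w) \<le> act E X v"
          by (rule act_ge_partial[where x = X, OF E X0]) (use prev zE[OF iL] i in auto)
        then have "2 * \<alpha> * X v + (1 - \<alpha>) * (X (z (i - 1)) + X (z (Suc i))) \<le> act E X v"
          using ne by (simp add: algebra_simps)
        moreover have "lam t * r ^ i = 2 * \<alpha> * r ^ i + (1 - \<alpha>) * (r ^ (i - 1) + r ^ Suc i)"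
          unfolding lamr power_Suc ri using r by (simp add: field_simps)
        moreover have "v \<noteq> z L" using i False z_ne[of i L] by auto
        ultimately show ?thesis
          using vu i iL Xz[of i] Xz[of "Suc i"] Xp by (simp add: e_def)
      qed
    qed
    then have "X v * (lam t * X v - e v) \<le> X v * act E X v" by (rule mult_left_mono[OF _ X0])
    then show ?thesis by (simp add: power2_eq_square algebra_simps)
  qed
  have WV: "W \<subseteq> V" by (simp add: V_def)
  have XW: "X v = 0" if "v \<notin> W" for v using that by (simp add: X_def W_def)
  have uW: "u \<in> W" "z L \<in> W" "u \<noteq> z L"
    using S(2) L z_ne[of 0 L] z(2) by (auto simp: W_def)
  have sumsq: "(\<Sum>v\<in>V. (X v)\<^sup>2) = (\<Sum>v\<in>W. (X v)\<^sup>2)"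
    by (rule sum.mono_neutral_right[OF finV WV]) (simp add: XW)
  have err: "(\<Sum>v\<in>W. X v * e v) = d + r ^ (2 * L)"
  proof -
    have "(\<Sum>v\<in>W. X v * e v) = (\<Sum>v\<in>{u, z L}. X v * e v)"
      by (rule sum.mono_neutral_right[OF finW]) (use uW in \<open>auto simp: e_def\<close>)
    then show ?thesis
      using uW XS[OF S(2)] x(2) Xz[of L] by (simp add: e_def mult_2 power_add)
  qed
  have big: "(real L + 1) * r ^ (2 * L) \<le> (\<Sum>v\<in>W. (X v)\<^sup>2)"
  proof -
    have zW: "z i \<in> W" if "i \<le> L" for i
      using that z(2) S(2) by (cases "i = 0") (auto simp: W_def)
    have "(real L + 1) * r ^ (2 * L) = (\<Sum>i\<in>{0..L}. r ^ (2 * L))" by simp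
    also have "\<dots> \<le> (\<Sum>i\<in>{0..L}. (X (z i))\<^sup>2)"
      by (rule sum_mono) (use Xz r in \<open>auto simp: power_mult[symmetric] mult.commute intro!: power_decreasing\<close>)
    also have "\<dots> = (\<Sum>v\<in>z ` {0..L}. (X v)\<^sup>2)" by (simp add: sum.reindex[OF z(1)])
    also have "\<dots> \<le> (\<Sum>v\<in>W. (X v)\<^sup>2)"
      by (rule sum_mono2[OF finW]) (use zW in auto)
    finally show ?thesis .
  qed
  show ?thesis
  proof (rule rad_ge[OF E finV])
    show "Field E \<subseteq> V" by (simp add: V_def)
    have "(\<Sum>v\<in>W. (X v)\<^sup>2) > 0"
      using big r by (smt (verit) mult_pos_pos of_nat_0_le_iff zero_less_power)
    then show "0 < (\<Sum>v\<in>V. (X v)\<^sup>2)" using sumsq by simp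
    have "(lam t - 2 / (real L + 1)) * (\<Sum>v\<in>W. (X v)\<^sup>2)
        \<le> lam t * (\<Sum>v\<in>W. (X v)\<^sup>2) - 2 * r ^ (2 * L)"
      using big by (simp add: field_simps)
    also have "\<dots> \<le> (\<Sum>v\<in>W. lam t * (X v)\<^sup>2 - X v * e v)"
      unfolding sum_subtractf err using d(2) by (simp add: sum_distrib_left r_def)
    also have "\<dots> \<le> (\<Sum>v\<in>W. X v * act E X v)" by (rule sum_mono) (rule main)
    also have "\<dots> = (\<Sum>v\<in>V. X v * act E X v)"
      by (rule sum.mono_neutral_left[OF finV WV]) (simp add: XW)
    also have "\<dots> = quad E X"
      by (rule quad_act[symmetric, OF ugraphD(1)[OF E] finV]) (simp add: V_def)
    finally show "(lam t - 2 / (real L + 1)) * (\<Sum>v\<in>V. (X v)\<^sup>2) \<le> quad E X"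
      unfolding sumsq .
  qed
qed

text \<open>Among the unions of components that keep the radius, one with fewest arcs is connected:
  a splitting would leave the radius on one of two smaller pieces, by
  \<open>rad_disjoint_union\<close>.\<close>

lemma connected_component_same_rad:
  assumes E: "ugraph E" "E \<noteq> {}"
  obtains K where "K \<subseteq> E" "K \<noteq> {}" "ugraph K" "rad K = rad E" "connected_graph K"
    "\<forall>a b. (a, b) \<in> E \<longrightarrow> a \<in> Field K \<longrightarrow> (a, b) \<in> K"
proof -
  define P where "P = (\<lambda>K. K \<subseteq> E \<and> K \<noteq> {} \<and> ugraph K \<and> rad K = rad E \<and>
    (\<forall>a b. (a, b) \<in> E \<longrightarrow> a \<in> Field K \<longrightarrow> (a, b) \<in> K))"
  have "P E" using E by (simp add: P_def)
  then obtain K where K: "P K" and min: "\<And>K'. P K' \<Longrightarrow> card K \<le> card K'"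
    using arg_min_natI[of P E card] arg_min_nat_le[of P _ card] by blast
  have Ku: "ugraph K" "K \<subseteq> E" "rad K = rad E" "K \<noteq> {}"
    and Kc: "\<And>a b. (a, b) \<in> E \<Longrightarrow> a \<in> Field K \<Longrightarrow> (a, b) \<in> K"
    using K by (auto simp: P_def)
  note finK = ugraphD(1)[OF Ku(1)]
  have "connected_graph K"
    unfolding connected_graph_def
  proof (intro allI impI, rule ccontr)
    fix X assume X: "\<forall>a b. (a, b) \<in> K \<longrightarrow> a \<in> X \<longrightarrow> b \<in> X" "X \<inter> Field K \<noteq> {}" "\<not> Field K \<subseteq> X"
    define K1 where "K1 = {(a, b) \<in> K. a \<in> X}"
    define K2 where "K2 = {(a, b) \<in> K. a \<notin> X}"
    have X': "b \<in> X \<longleftrightarrow> a \<in> X" if "(a, b) \<in> K" for a b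
      using that X(1) ugraphD(2)[OF Ku(1)] by blast
    have un: "K1 \<union> K2 = K" by (auto simp: K1_def K2_def)
    have ne: "K1 \<noteq> {}" "K2 \<noteq> {}"
      using X(2,3) X' by (auto simp: K1_def K2_def Field_def)
    have dis: "Field K1 \<inter> Field K2 = {}" using X' by (auto simp: K1_def K2_def Field_def)
    have dis': "K1 \<inter> K2 = {}" by (auto simp: K1_def K2_def)
    have "sym K1" "sym K2"
      using ugraphD(2)[OF Ku(1)] X' unfolding K1_def K2_def by (auto intro!: symI)
    moreover have "finite K1" "finite K2" using un finK by (metis finite_Un)+
    moreover have "irrefl K1" "irrefl K2"
      using ugraphD(3)[OF Ku(1)] unfolding irrefl_def K1_def K2_def by auto
    ultimately have u1: "ugraph K1" and u2: "ugraph K2" by (simp_all add: ugraph_def)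
    have c: "(a, b) \<in> K1" if "(a, b) \<in> E" "a \<in> Field K1" for a b
    proof -
      have "a \<in> X" "a \<in> Field K" using that(2) X' by (auto simp: K1_def Field_def)
      then show ?thesis using Kc that(1) by (auto simp: K1_def)
    qed
    have c2: "(a, b) \<in> K2" if "(a, b) \<in> E" "a \<in> Field K2" for a b
    proof -
      have "a \<notin> X" "a \<in> Field K" using that(2) X' by (auto simp: K2_def Field_def)
      then show ?thesis using Kc that(1) by (auto simp: K2_def)
    qed
    have "rad K \<le> max (rad K1) (rad K2)"
      using rad_disjoint_union[OF u1 u2 dis] un by simp
    moreover have "rad K1 \<le> rad K" "rad K2 \<le> rad K"
      using rad_mono[OF u1 Ku(1)] rad_mono[OF u2 Ku(1)] un by auto
    ultimately consider "rad K1 = rad E" | "rad K2 = rad E" using Ku(3) by linarith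
    moreover have "card K1 < card K" "card K2 < card K"
      using ne dis' un finK by (auto intro!: psubset_card_mono)
    moreover have "K1 \<subseteq> E" "K2 \<subseteq> E" using un Ku(2) by auto
    ultimately show False
      using min[of K1] min[of K2] ne u1 u2 c c2 unfolding P_def by cases auto
  qed
  then show thesis using that Ku Kc by blast
qed

text \<open>A unit vector has little weight on some edge of a long path, so deleting that edge is cheap.\<close>

lemma rad_delete_path_edge:
  assumes E: "ugraph E" and p: "inj_on p {c..c + l}" and l: "1 \<le> l"
    and pE: "\<And>i. c \<le> i \<Longrightarrow> i < c + l \<Longrightarrow> (p i, p (Suc i)) \<in> E"
  obtains i where "c \<le> i" "i < c + l"
    "rad E \<le> rad (E - {(p i, p (Suc i)), (p (Suc i), p i)}) + 2 / real l"
proof -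
  define F where "F = (\<lambda>i. E - {(p i, p (Suc i)), (p (Suc i), p i)})"
  have F: "ugraph (F i)" for i
    using E unfolding ugraph_def F_def sym_def irrefl_def by auto
  \<comment> \<open>The light edge depends on the vector, so the worst deletion is taken: m is the
    maximum over all edges of the path, and i attains it.\<close>
  define m where "m = Max ((\<lambda>i. rad (F i)) ` {c..<c + l})"
  have mge: "rad (F i) \<le> m" if "c \<le> i" "i < c + l" for i
    unfolding m_def by (rule Max_ge) (use that in auto)
  have "m \<in> (\<lambda>i. rad (F i)) ` {c..<c + l}"
    unfolding m_def by (rule Max_in) (use l in auto)
  then obtain i where i: "c \<le> i" "i < c + l" "m = rad (F i)" by auto
  have m0: "0 \<le> m" using rad_nonneg[OF F] i by simp
  have "rad E \<le> m + 2 / real l"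
  proof (rule rad_le[OF E])
    show "0 \<le> m + 2 / real l" using m0 by simp
    fix x :: "'a \<Rightarrow> real"
    let ?w = "\<lambda>i. (x (p i))\<^sup>2"
    have pF: "p i \<in> Field E" if "c \<le> i" "i \<le> c + l" for i
    proof (cases "i = c + l")
      case True
      then have "(p (i - 1), p i) \<in> E" using pE[of "i - 1"] l by simp
      then show ?thesis by (rule FieldI2)
    next
      case False
      then show ?thesis using pE[of i] that by (auto intro: FieldI1)
    qed
    have part: "(\<Sum>i\<in>I. (x (p i))\<^sup>2) \<le> nsq E x" if "I \<subseteq> {c..c + l}" for I
    proof -
      have "(\<Sum>i\<in>I. (x (p i))\<^sup>2) = (\<Sum>v\<in>p ` I. (x v)\<^sup>2)"
        using inj_on_subset[OF p that] by (simp add: sum.reindex)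
      also have "\<dots> \<le> nsq E x"
        unfolding nsq_def by (rule sum_mono2[OF ugraphD(4)[OF E]]) (use pF that in auto)
      finally show ?thesis .
    qed
    \<comment> \<open>Averaging: each vertex lies on at most two of the l edges, so the edge weights
      add up to at most twice the squared norm.\<close>
    have "\<exists>j. c \<le> j \<and> j < c + l \<and> ?w j + ?w (Suc j) \<le> 2 / real l * nsq E x"
    proof (rule ccontr)
      assume "\<not> ?thesis"
      then have gt: "2 / real l * nsq E x < ?w j + ?w (Suc j)" if "j \<in> {c..<c + l}" for j
        using that by force
      have "real l * (2 / real l * nsq E x) = (\<Sum>j\<in>{c..<c + l}. 2 / real l * nsq E x)" by simp
      also have "\<dots> < (\<Sum>j\<in>{c..<c + l}. ?w j + ?w (Suc j))"
        by (rule sum_strict_mono) (use gt l in auto)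
      also have "\<dots> = (\<Sum>j\<in>{c..<c + l}. ?w j) + (\<Sum>j\<in>{Suc c..<Suc (c + l)}. ?w j)"
        by (simp add: sum.distrib sum.atLeast_Suc_lessThan_Suc_shift del: sum.op_ivl_Suc)
      also have "\<dots> \<le> nsq E x + nsq E x"
        by (intro add_mono part) auto
      finally show False using l by simp
    qed
    then obtain j where j: "c \<le> j" "j < c + l" "?w j + ?w (Suc j) \<le> 2 / real l * nsq E x" by auto
    let ?a = "p j" and ?b = "p (Suc j)"
    have ab: "(?a, ?b) \<in> E" "(?b, ?a) \<in> E" using pE[OF j(1,2)] ugraphD(2)[OF E] by auto
    have neq: "?a \<noteq> ?b" using ab ugraphD(3)[OF E] by auto
    have Eq: "E = insert (?a, ?b) (insert (?b, ?a) (F j))" using ab by (auto simp: F_def)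
    have nin: "(?a, ?b) \<notin> insert (?b, ?a) (F j)" "(?b, ?a) \<notin> F j" using neq by (auto simp: F_def)
    have "quad E x = quad (F j) x + (\<alpha> * (?w j + ?w (Suc j)) + (1 - \<alpha>) * (2 * (x ?a * x ?b)))"
      by (subst Eq) (use nin ugraphD(1)[OF F] in \<open>simp add: quad_def algebra_simps\<close>)
    also have "\<dots> \<le> m * nsq E x + 2 / real l * nsq E x"
    proof (rule add_mono)
      have "nsq (F j) x \<le> nsq E x"
        unfolding nsq_def
        by (rule sum_mono2[OF ugraphD(4)[OF E]]) (auto simp: F_def Field_def)
      then have "rad (F j) * nsq (F j) x \<le> m * nsq E x"
        by (intro mult_mono mge j m0 nsq_nonneg)
      then show "quad (F j) x \<le> m * nsq E x" using quad_le_rad[OF F, of j x] by linarith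
      have "2 * (x ?a * x ?b) \<le> ?w j + ?w (Suc j)"
        using sum_squares_bound[of "x ?a" "x ?b"] by simp
      then have "(1 - \<alpha>) * (2 * (x ?a * x ?b)) \<le> (1 - \<alpha>) * (?w j + ?w (Suc j))"
        using alpha_lt1 by (intro mult_left_mono) auto
      then have "\<alpha> * (?w j + ?w (Suc j)) + (1 - \<alpha>) * (2 * (x ?a * x ?b)) \<le> ?w j + ?w (Suc j)"
        by (simp add: algebra_simps)
      then show "\<alpha> * (?w j + ?w (Suc j)) + (1 - \<alpha>) * (2 * (x ?a * x ?b)) \<le> 2 / real l * nsq E x"
        using j(3) by linarith
    qed
    finally show "quad E x \<le> (m + 2 / real l) * nsq E x" by (simp add: distrib_right)
  qed
  then show thesis using that[of i] i by (simp add: F_def)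
qed

end

section \<open>The polynomials and their roots\<close>

context aspec
begin

text \<open>
  Multiplying the eigenvalue equation for \<open>lam t\<close> at the branching vertex of the infinite tree with
  branches of lengths \<open>1\<close>, \<open>\<infinity>\<close>, \<open>\<infinity>\<close> by \<open>lam t - \<alpha>\<close> gives \<open>psi_fun t = 0\<close>.
\<close>

definition psi_fun :: "real \<Rightarrow> real" where
  "psi_fun t = (1 - \<alpha>)\<^sup>2 * t\<^sup>2 - \<alpha>\<^sup>2 - (1 - \<alpha>)\<^sup>2 - 2 * \<alpha> * (1 - \<alpha>) / t - (1 - \<alpha>)\<^sup>2 / t\<^sup>2"

text \<open>The substitution x = t^2 removes the half-integral powers, and the factor t^2 - 1
  telescopes both sums. What remains is \<open>psi_fun\<close>, independent of n, and a positive
  correction that decays with n when t > 1.\<close>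

lemma Phi_tilde_closed_form:
  assumes t: "t > 0" and n: "n \<ge> 1"
  shows "(t\<^sup>2 - 1) * Phi_tilde \<alpha> n (t\<^sup>2)
    = t ^ (2 * n + 2) * (psi_fun t + (1 / t) ^ (2 * n) * (\<alpha> + (1 - \<alpha>) / t)\<^sup>2)"
proof -
  define b where "b = 1 - \<alpha>"
  define X where "X = (t\<^sup>2) ^ n"
  have X0: "X > 0" using t by (simp add: X_def)
  have s1: "(\<Sum>i = 1..n. (t\<^sup>2) powr (real n - real i + 1 / 2)) = t * (\<Sum>j<n. (t\<^sup>2) ^ j)"
  proof -
    have "(\<Sum>i = 1..n. (t\<^sup>2) powr (real n - real i + 1 / 2)) = (\<Sum>i = 1..n. t * (t\<^sup>2) ^ (n - i))"
    proof (intro sum.cong refl)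
      fix i assume i: "i \<in> {1..n}"
      have "(t\<^sup>2) powr (real n - real i + 1 / 2) = (t\<^sup>2) powr real (n - i) * (t\<^sup>2) powr (1 / 2)"
        using i unfolding powr_add[symmetric] by (simp add: of_nat_diff)
      also have "(t\<^sup>2) powr real (n - i) = (t\<^sup>2) ^ (n - i)" using t by (simp add: powr_realpow)
      also have "(t\<^sup>2) powr (1 / 2) = t" using t by (simp add: powr_half_sqrt)
      finally show "(t\<^sup>2) powr (real n - real i + 1 / 2) = t * (t\<^sup>2) ^ (n - i)" by simp
    qed
    also have "\<dots> = (\<Sum>j<n. t * (t\<^sup>2) ^ j)"
      by (rule sum.reindex_bij_witness[of _ "\<lambda>j. n - j" "\<lambda>i. n - i"]) auto
    finally show ?thesis by (simp add: sum_distrib_left)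
  qed
  have s2: "(t\<^sup>2 - 1) * (\<Sum>j<n. (t\<^sup>2) ^ j) = X - 1"
    unfolding X_def by (rule power_diff_1_eq[symmetric])
  have "{..<n} = insert 0 {1..n - 1}" using n by auto
  then have s3: "(\<Sum>j<n. (t\<^sup>2) ^ j) = 1 + (\<Sum>i = 1..n - 1. (t\<^sup>2) ^ i)" by simp
  have s4: "(t\<^sup>2 - 1) * (\<Sum>i = 1..n - 1. (t\<^sup>2) ^ i) = X - t\<^sup>2"
    using s2 unfolding s3 by (simp add: algebra_simps)
  have "(t\<^sup>2 - 1) * Phi_tilde \<alpha> n (t\<^sup>2)
      = (t\<^sup>2 - 1) * (b\<^sup>2 * (t\<^sup>2 * X) - \<alpha>\<^sup>2 * X - b\<^sup>2)
        - 2 * \<alpha> * b * t * ((t\<^sup>2 - 1) * (\<Sum>j<n. (t\<^sup>2) ^ j))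
        - (\<alpha>\<^sup>2 + b\<^sup>2) * ((t\<^sup>2 - 1) * (\<Sum>i = 1..n - 1. (t\<^sup>2) ^ i))"
  proof -
    have c: "1 - 2 * \<alpha> + 2 * \<alpha>\<^sup>2 = \<alpha>\<^sup>2 + b\<^sup>2" by (simp add: b_def power2_eq_square algebra_simps)
    show ?thesis
      unfolding Phi_tilde_def s1 c X_def b_def[symmetric] by (simp add: algebra_simps)
  qed
  also have "\<dots> = t\<^sup>2 * X * (psi_fun t + (1 / X) * (\<alpha> + b / t)\<^sup>2)"
    unfolding s2 s4 psi_fun_def b_def[symmetric] using t X0
    by (simp add: field_simps power2_eq_square)
  also have "t\<^sup>2 * X = t ^ (2 * n + 2)"
    by (simp add: X_def power_mult power2_eq_square)
  also have "1 / X = (1 / t) ^ (2 * n)"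
    by (simp add: X_def power_mult power_divide)
  finally show ?thesis by (simp add: b_def)
qed

lemma Phi_tilde_at_1:
  assumes "n \<ge> 1"
  shows "Phi_tilde \<alpha> n 1 = (1 - \<alpha>)\<^sup>2 - real n"
  using assms unfolding Phi_tilde_def by (simp add: power2_eq_square algebra_simps of_nat_diff)

text \<open>Only the leading term has a positive coefficient. Scaling x by c multiplies it by c ^ (n
  + 1) and every other term by at most that factor, the constant term by strictly less. This plays
  the role of Descartes' rule of signs for uniqueness of the root.\<close>

lemma Phi_tilde_scale:
  assumes x: "x > 0" and c: "c > 1" and n: "n \<ge> 1"
  shows "c ^ (n + 1) * Phi_tilde \<alpha> n x < Phi_tilde \<alpha> n (c * x)"
proof -
  have pw: "(c * x) ^ k \<le> c ^ (n + 1) * x ^ k" if "k \<le> n + 1" for k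
    using that c x unfolding power_mult_distrib by (intro mult_right_mono power_increasing) auto
  have pr: "(c * x) powr (real n - real i + 1 / 2) \<le> c ^ (n + 1) * x powr (real n - real i + 1 / 2)"
    if "i \<in> {1..n}" for i
  proof -
    have "c powr (real n - real i + 1 / 2) \<le> c powr real (n + 1)"
      using c that by (intro powr_mono) auto
    also have "\<dots> = c ^ (n + 1)" using c by (subst powr_realpow) auto
    finally show ?thesis using c x by (simp add: powr_mult mult_right_mono)
  qed
  have "(\<Sum>i = 1..n. (c * x) powr (real n - real i + 1 / 2))
      \<le> c ^ (n + 1) * (\<Sum>i = 1..n. x powr (real n - real i + 1 / 2))"
    unfolding sum_distrib_left by (intro sum_mono pr)
  then have 1: "2 * \<alpha> * (1 - \<alpha>) * (\<Sum>i = 1..n. (c * x) powr (real n - real i + 1 / 2))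
      \<le> 2 * \<alpha> * (1 - \<alpha>) * (c ^ (n + 1) * (\<Sum>i = 1..n. x powr (real n - real i + 1 / 2)))"
    using alpha_ge0 alpha_lt1 by (intro mult_left_mono) auto
  have "(\<Sum>i = 1..n - 1. (c * x) ^ i) \<le> c ^ (n + 1) * (\<Sum>i = 1..n - 1. x ^ i)"
    unfolding sum_distrib_left by (intro sum_mono pw) auto
  moreover have "1 - 2 * \<alpha> + 2 * \<alpha>\<^sup>2 \<ge> 0"
    using sum_squares_ge_zero[of "1 - \<alpha>" \<alpha>] by (simp add: power2_eq_square algebra_simps)
  ultimately have 2: "(1 - 2 * \<alpha> + 2 * \<alpha>\<^sup>2) * (\<Sum>i = 1..n - 1. (c * x) ^ i)
      \<le> (1 - 2 * \<alpha> + 2 * \<alpha>\<^sup>2) * (c ^ (n + 1) * (\<Sum>i = 1..n - 1. x ^ i))"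
    by (intro mult_left_mono) auto
  have 3: "\<alpha>\<^sup>2 * (c * x) ^ n \<le> \<alpha>\<^sup>2 * (c ^ (n + 1) * x ^ n)"
    by (intro mult_left_mono pw) auto
  have "1 < c ^ (n + 1)" using c by (intro one_less_power) auto
  then have 4: "(1 - \<alpha>)\<^sup>2 * 1 < (1 - \<alpha>)\<^sup>2 * c ^ (n + 1)"
    using alpha_lt1 by (intro mult_strict_left_mono) auto
  have 5: "(1 - \<alpha>)\<^sup>2 * (c * x) ^ (n + 1) = c ^ (n + 1) * ((1 - \<alpha>)\<^sup>2 * x ^ (n + 1))"
    by (simp only: power_mult_distrib ac_simps)
  have "c ^ (n + 1) * Phi_tilde \<alpha> n x
      = c ^ (n + 1) * ((1 - \<alpha>)\<^sup>2 * x ^ (n + 1)) - \<alpha>\<^sup>2 * (c ^ (n + 1) * x ^ n)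
        - 2 * \<alpha> * (1 - \<alpha>) * (c ^ (n + 1) * (\<Sum>i = 1..n. x powr (real n - real i + 1 / 2)))
        - (1 - 2 * \<alpha> + 2 * \<alpha>\<^sup>2) * (c ^ (n + 1) * (\<Sum>i = 1..n - 1. x ^ i))
        - (1 - \<alpha>)\<^sup>2 * c ^ (n + 1)"
    unfolding Phi_tilde_def by (simp only: right_diff_distrib ac_simps)
  then show ?thesis unfolding Phi_tilde_def 5[symmetric] using 1 2 3 4 by linarith
qed

lemma divide_le_self:
  fixes c t :: real
  assumes "0 \<le> c" "1 \<le> t"
  shows "c / t \<le> c"
  using mult_left_mono[OF assms(2,1)] assms(2) by (simp add: divide_le_eq)

lemma psi_fun_bound:
  assumes "t \<ge> 1"
  shows "(1 - \<alpha>)\<^sup>2 * t\<^sup>2 - 2 \<le> psi_fun t"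
proof -
  have "2 * \<alpha> * (1 - \<alpha>) / t \<le> 2 * \<alpha> * (1 - \<alpha>)"
    using assms alpha_ge0 alpha_lt1 by (intro divide_le_self) auto
  moreover have "(1 - \<alpha>)\<^sup>2 / t\<^sup>2 \<le> (1 - \<alpha>)\<^sup>2"
    using assms by (intro divide_le_self one_le_power) auto
  moreover have "\<alpha>\<^sup>2 + (1 - \<alpha>)\<^sup>2 + 2 * \<alpha> * (1 - \<alpha>) = 1" by (simp add: power2_eq_square algebra_simps)
  moreover have "(1 - \<alpha>)\<^sup>2 \<le> 1" using alpha_ge0 alpha_lt1 by (simp add: power_le_one)
  ultimately show ?thesis unfolding psi_fun_def by linarith
qed

lemma Phi_tilde_root:
  assumes n: "n \<ge> 1"
  shows "\<exists>x\<ge>1. Phi_tilde \<alpha> n x = 0"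
proof -
  \<comment> \<open>Chosen so that (1 - \<alpha>) * t = 2, where \<open>psi_fun_bound\<close> gives
    psi_fun t \<ge> 2.\<close>
  define t where "t = 2 / (1 - \<alpha>)"
  have t: "t \<ge> 2" using alpha_ge0 alpha_lt1 by (simp add: t_def field_simps)
  have t2: "t\<^sup>2 - 1 > 0" using t by (simp add: one_less_power)
  have "(1 - \<alpha>) * t = 2"
    unfolding t_def times_divide_eq_right
    by (rule nonzero_mult_div_cancel_left) (use alpha_lt1 in simp)
  then have "((1 - \<alpha>) * t)\<^sup>2 = 4" by simp
  then have "(1 - \<alpha>)\<^sup>2 * t\<^sup>2 = 4" by (simp only: power_mult_distrib)
  then have "psi_fun t > 0" using psi_fun_bound[of t] t by simp
  moreover have "(1 / t) ^ (2 * n) * (\<alpha> + (1 - \<alpha>) / t)\<^sup>2 \<ge> 0" using t by simp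
  ultimately have "(t\<^sup>2 - 1) * Phi_tilde \<alpha> n (t\<^sup>2) > 0"
    using t by (subst Phi_tilde_closed_form[OF _ n]) (auto intro!: mult_pos_pos add_pos_nonneg)
  then have pos: "Phi_tilde \<alpha> n (t\<^sup>2) > 0" using t2 by (simp add: zero_less_mult_iff)
  have "(1 - \<alpha>)\<^sup>2 \<le> 1" using alpha_ge0 alpha_lt1 by (simp add: power_le_one)
  then have "Phi_tilde \<alpha> n 1 \<le> 0" using n by (simp add: Phi_tilde_at_1[OF n])
  moreover have "continuous_on {1..t\<^sup>2} (Phi_tilde \<alpha> n)"
    unfolding Phi_tilde_def by (intro continuous_intros) auto
  ultimately have "\<exists>x. 1 \<le> x \<and> x \<le> t\<^sup>2 \<and> Phi_tilde \<alpha> n x = 0"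
    using pos t2 by (intro IVT') auto
  then show ?thesis by auto
qed

lemma Phi_tilde_less_root:
  assumes n: "n \<ge> 1" and xy: "0 < x" "0 < y" and "Phi_tilde \<alpha> n x \<le> 0" "Phi_tilde \<alpha> n y \<ge> 0" "x \<noteq> y"
  shows "x < y"
proof (rule ccontr)
  assume "\<not> x < y"
  define c where "c = x / y"
  have c: "c > 1" "c * y = x" using \<open>\<not> x < y\<close> assms by (simp_all add: c_def)
  have "c ^ (n + 1) * Phi_tilde \<alpha> n y < Phi_tilde \<alpha> n x"
    using Phi_tilde_scale[OF xy(2) c(1) n] unfolding c(2) .
  moreover have "c ^ (n + 1) * Phi_tilde \<alpha> n y \<ge> 0"
    using assms c(1) by (intro mult_nonneg_nonneg) auto
  ultimately show False using assms by linarith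
qed

lemma Phi_tilde_ex1:
  assumes n: "n \<ge> 1"
  shows "\<exists>!x. x > 0 \<and> Phi_tilde \<alpha> n x = 0"
proof -
  from Phi_tilde_root[OF n] obtain x where "x \<ge> 1" "Phi_tilde \<alpha> n x = 0" by auto
  then have x: "0 < x" "Phi_tilde \<alpha> n x = 0" by simp_all
  show ?thesis
  proof (rule ex1I[of _ x])
    show "0 < x \<and> Phi_tilde \<alpha> n x = 0" using x by simp
    fix y assume y: "0 < y \<and> Phi_tilde \<alpha> n y = 0"
    show "y = x"
    proof (rule ccontr)
      assume "y \<noteq> x"
      then show False
        using Phi_tilde_less_root[OF n, of x y] Phi_tilde_less_root[OF n, of y x] x y by linarith
    qed
  qed
qed

section \<open>The roots in the variable t = sqrt x\<close>

definition t_root :: "nat \<Rightarrow> real" where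
  "t_root n = sqrt (gamma_tilde \<alpha> n)"

lemma gamma_tilde_root:
  assumes n: "n \<ge> 1"
  shows "gamma_tilde \<alpha> n > 0" "Phi_tilde \<alpha> n (gamma_tilde \<alpha> n) = 0"
  using theI'[OF Phi_tilde_ex1[OF n]] n by (auto simp: gamma_tilde_def)

lemma gamma_tilde_ge1: "gamma_tilde \<alpha> n \<ge> 1"
proof (cases "n = 0")
  case False
  then have n: "n \<ge> 1" by simp
  from Phi_tilde_root[OF n] obtain x where x: "x \<ge> 1" "Phi_tilde \<alpha> n x = 0" by auto
  then have "x > 0 \<and> Phi_tilde \<alpha> n x = 0" by simp
  from the1_equality[OF Phi_tilde_ex1[OF n] this] show ?thesis
    using False x(1) by (simp add: gamma_tilde_def)
qed (simp add: gamma_tilde_def)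

lemma gamma_tilde_gt1:
  assumes "n \<ge> 2 \<or> (n \<ge> 1 \<and> \<alpha> > 0)"
  shows "gamma_tilde \<alpha> n > 1"
proof -
  have n: "n \<ge> 1" using assms by auto
  have "(1 - \<alpha>)\<^sup>2 < real n"
  proof -
    have "(1 - \<alpha>)\<^sup>2 \<le> 1" using alpha_ge0 alpha_lt1 by (simp add: power_le_one)
    moreover have "(1 - \<alpha>)\<^sup>2 < 1" if "\<alpha> > 0"
      using that alpha_lt1 by (simp add: power_less_one_iff abs_square_less_1)
    ultimately show ?thesis using assms by fastforce
  qed
  then have "Phi_tilde \<alpha> n 1 < 0" by (simp add: Phi_tilde_at_1[OF n])
  then have "gamma_tilde \<alpha> n \<noteq> 1" using gamma_tilde_root(2)[OF n] by auto
  then show ?thesis using gamma_tilde_ge1[of n] by simp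
qed

lemma t_root_ge1: "t_root n \<ge> 1"
  using gamma_tilde_ge1[of n] by (simp add: t_root_def)

lemma t_root_gt1: "n \<ge> 2 \<or> (n \<ge> 1 \<and> \<alpha> > 0) \<Longrightarrow> t_root n > 1"
  using gamma_tilde_gt1[of n] by (simp add: t_root_def)

lemma t_root_square: "(t_root n)\<^sup>2 = gamma_tilde \<alpha> n"
  using gamma_tilde_ge1[of n] by (simp add: t_root_def)

lemma t_root_0: "t_root 0 = 1"
  by (simp add: t_root_def gamma_tilde_def)

text \<open>When the root is 1, the factor t^2 - 1 of the closed form vanishes and yields no
  information about \<open>psi_fun\<close>. This confines the situation to one case, for which
  \<open>chain_vector\<close> uses a different vector.\<close>

lemma t_root_eq1:
  assumes n: "n \<ge> 1" and 1: "t_root n = 1"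
  shows "n = 1" "\<alpha> = 0"
proof -
  have "\<not> (n \<ge> 2 \<or> (n \<ge> 1 \<and> \<alpha> > 0))" using t_root_gt1[of n] 1 by auto
  then show "n = 1" "\<alpha> = 0" using n alpha_ge0 by auto
qed

lemma eta_eq_lam: "eta \<alpha> n = lam (t_root n)"
proof -
  have "gamma_tilde \<alpha> n powr (1 / 2) = t_root n"
    using gamma_tilde_ge1[of n] by (simp add: t_root_def powr_half_sqrt)
  moreover have "gamma_tilde \<alpha> n powr (- 1 / 2) = 1 / t_root n"
    using gamma_tilde_ge1[of n] powr_minus_divide[of "gamma_tilde \<alpha> n" "1 / 2"]
    by (simp add: t_root_def powr_half_sqrt)
  ultimately show ?thesis by (simp add: eta_def lam_def algebra_simps)
qed

lemma lam_strict_mono: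
  assumes "1 \<le> x" "x < y"
  shows "lam x < lam y"
proof -
  have "lam y - lam x = (1 - \<alpha>) * ((y - x) * (1 - 1 / (x * y)))"
    using assms by (simp add: lam_def field_simps)
  moreover have "1 * y \<le> x * y" using assms by (intro mult_right_mono) auto
  then have "x * y > 1" using assms by linarith
  ultimately have "lam y - lam x > 0"
    using assms alpha_lt1 by (simp add: mult_pos_pos)
  then show ?thesis by simp
qed

lemma psi_fun_t_root:
  assumes "n \<ge> 1" "t_root n > 1"
  shows "psi_fun (t_root n) = - ((1 / t_root n) ^ (2 * n) * (\<alpha> + (1 - \<alpha>) / t_root n)\<^sup>2)"
proof -
  have "t_root n ^ (2 * n + 2) * (psi_fun (t_root n) + (1 / t_root n) ^ (2 * n) * (\<alpha> + (1 - \<alpha>) / t_root n)\<^sup>2) = 0"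
    using Phi_tilde_closed_form[of "t_root n" n] assms gamma_tilde_root(2)[OF assms(1)]
    by (simp add: t_root_square)
  moreover have "t_root n ^ (2 * n + 2) \<noteq> 0" using assms by simp
  ultimately have "psi_fun (t_root n) + (1 / t_root n) ^ (2 * n) * (\<alpha> + (1 - \<alpha>) / t_root n)\<^sup>2 = 0"
    by (metis mult_eq_0_iff)
  then show ?thesis by simp
qed

text \<open>At t = t_root n > 1, passing to n + 1 only shrinks the positive correction to
  \<open>psi_fun\<close>. The polynomial of index n + 1 is therefore negative at t^2, and its root
  lies further to the right.\<close>

lemma t_root_strict_mono:
  assumes n: "n \<ge> 1 \<or> \<alpha> > 0"
  shows "t_root n < t_root (Suc n)"
proof (cases "t_root n = 1")
  case True
  have "Suc n \<ge> 2 \<or> (Suc n \<ge> 1 \<and> \<alpha> > 0)" using n by auto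
  then show ?thesis using t_root_gt1[of "Suc n"] True by simp
next
  case False
  then have n1: "n \<ge> 1" using t_root_0 by (cases n) auto
  define t where "t = t_root n"
  have t: "t > 1" using False t_root_ge1[of n] by (simp add: t_def)
  have "(1 / t) ^ (2 * Suc n) < (1 / t) ^ (2 * n)"
    using t by (intro power_strict_decreasing) auto
  moreover have "\<alpha> + (1 - \<alpha>) / t > 0" using t alpha_ge0 alpha_lt1 by (simp add: add_nonneg_pos)
  ultimately have "(1 / t) ^ (2 * Suc n) * (\<alpha> + (1 - \<alpha>) / t)\<^sup>2 < (1 / t) ^ (2 * n) * (\<alpha> + (1 - \<alpha>) / t)\<^sup>2"
    by (intro mult_strict_right_mono) auto
  then have "psi_fun t + (1 / t) ^ (2 * Suc n) * (\<alpha> + (1 - \<alpha>) / t)\<^sup>2 < 0"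
    using psi_fun_t_root[OF n1] t by (simp add: t_def)
  then have "(t\<^sup>2 - 1) * Phi_tilde \<alpha> (Suc n) (t\<^sup>2) < 0"
    using t by (subst Phi_tilde_closed_form) (auto intro!: mult_pos_neg)
  moreover have "t\<^sup>2 - 1 > 0" using t by (simp add: one_less_power)
  ultimately have neg: "Phi_tilde \<alpha> (Suc n) (t\<^sup>2) < 0" by (simp add: mult_less_0_iff)
  have r: "gamma_tilde \<alpha> (Suc n) > 0" "Phi_tilde \<alpha> (Suc n) (gamma_tilde \<alpha> (Suc n)) = 0"
    using gamma_tilde_root[of "Suc n"] by simp_all
  have "t\<^sup>2 < gamma_tilde \<alpha> (Suc n)"
    by (rule Phi_tilde_less_root[of "Suc n"]) (use neg r t in auto)
  then have "t\<^sup>2 < (t_root (Suc n))\<^sup>2" by (simp add: t_root_square)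
  then show ?thesis unfolding t_def[symmetric] using t_root_ge1[of "Suc n"] by (simp add: power_less_imp_less_base)
qed

lemma eta_strict_mono: "n \<ge> 1 \<or> \<alpha> > 0 \<Longrightarrow> eta \<alpha> n < eta \<alpha> (Suc n)"
  unfolding eta_eq_lam by (rule lam_strict_mono[OF t_root_ge1 t_root_strict_mono])

lemma eta_0: "eta \<alpha> 0 = 2"
  by (simp add: eta_eq_lam t_root_0 lam_def)

lemma eta_mono: "m \<le> n \<Longrightarrow> eta \<alpha> m \<le> eta \<alpha> n"
proof (rule lift_Suc_mono_le[of "eta \<alpha>"])
  fix n
  show "eta \<alpha> n \<le> eta \<alpha> (Suc n)"
  proof (cases "n \<ge> 1 \<or> \<alpha> > 0")
    case True
    then show ?thesis using eta_strict_mono by (simp add: less_imp_le)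
  next
    case False
    then have "t_root n \<le> t_root (Suc n)" using t_root_0 t_root_ge1 by (cases n) auto
    then show ?thesis
      unfolding eta_eq_lam using lam_strict_mono[OF t_root_ge1[of n], of "t_root (Suc n)"] by fastforce
  qed
qed

definition t_lim :: real where
  "t_lim = lim t_root"

lemma t_root_bound: "t_root n < 2 / (1 - \<alpha>)"
proof (cases "n \<ge> 1 \<and> t_root n > 1")
  case True
  have "psi_fun (t_root n) \<le> 0" using psi_fun_t_root[of n] True by simp
  then have "((1 - \<alpha>) * t_root n)\<^sup>2 < 2\<^sup>2"
    using psi_fun_bound[of "t_root n"] True by (simp add: power_mult_distrib)
  then have "(1 - \<alpha>) * t_root n < 2" by (rule power_less_imp_less_base) simp
  then show ?thesis using alpha_lt1 by (simp add: field_simps)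
next
  case False
  then have "t_root n = 1" using t_root_0 t_root_ge1[of n] by (cases n) auto
  then show ?thesis using alpha_ge0 alpha_lt1 by (simp add: field_simps)
qed

lemma t_root_tendsto: "t_root \<longlonglongrightarrow> t_lim" and t_root_less_t_lim: "n \<ge> 1 \<Longrightarrow> t_root n < t_lim"
proof -
  \<comment> \<open>Shifted by one because for \<alpha> = 0 strict growth starts only at index
    1.\<close>
  have "incseq (\<lambda>n. t_root (Suc n))"
    by (rule incseq_SucI) (use t_root_strict_mono in \<open>simp add: less_imp_le\<close>)
  moreover have "t_root (Suc n) \<le> 2 / (1 - \<alpha>)" for n using t_root_bound[of "Suc n"] by simp
  ultimately obtain T where T: "(\<lambda>n. t_root (Suc n)) \<longlonglongrightarrow> T" "\<And>n. t_root (Suc n) \<le> T"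
    using incseq_convergent[of "\<lambda>n. t_root (Suc n)"] by auto
  then have lim: "t_root \<longlonglongrightarrow> T" by (simp add: filterlim_sequentially_Suc)
  then have eq: "t_lim = T" unfolding t_lim_def by (rule limI)
  show "t_root \<longlonglongrightarrow> t_lim" using lim eq by simp
  assume n: "n \<ge> 1"
  then show "t_root n < t_lim"
    using t_root_strict_mono[of n] T(2)[of n] eq by simp
qed

lemma t_lim_gt1: "t_lim > 1"
  using t_root_less_t_lim[of 1] t_root_ge1[of 1] by simp

text \<open>From index 2 on, the roots stay above \<open>t_root 2\<close> > 1, so the correction in
  \<open>psi_fun_t_root\<close> tends to 0 geometrically. Index 2 is the first whose root exceeds 1
  for every \<alpha>.\<close>

lemma psi_fun_t_lim: "psi_fun t_lim = 0"
proof (rule LIMSEQ_unique)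
  show "(\<lambda>n. psi_fun (t_root n)) \<longlonglongrightarrow> psi_fun t_lim"
    unfolding psi_fun_def by (intro tendsto_intros t_root_tendsto) (use t_lim_gt1 in auto)
  show "(\<lambda>n. psi_fun (t_root n)) \<longlonglongrightarrow> 0"
  proof (rule tendsto_0_le[where K = 1])
    define r where "r = 1 / t_root 2"
    have t2: "t_root 2 > 1" by (rule t_root_gt1) simp
    have "t_root 2 \<le> t_root n" if "n \<ge> 2" for n
      using that
    proof (induction rule: dec_induct)
      case (step m)
      then show ?case using t_root_strict_mono[of m] by simp
    qed simp
    then have "norm (psi_fun (t_root n)) \<le> r ^ n" if "n \<ge> 2" for n
    proof -
      assume mono: "\<And>n. 2 \<le> n \<Longrightarrow> t_root 2 \<le> t_root n"
      have g: "t_root n > 1" using that by (intro t_root_gt1) simp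
      have le: "1 / t_root n \<le> r" using mono[OF that] t2 by (simp add: r_def frac_le)
      have "\<alpha> + (1 - \<alpha>) / t_root n \<le> 1"
        using g alpha_lt1 by (smt (verit) divide_le_eq_1 divide_less_eq mult_le_cancel_left1 mult_less_cancel_left_pos)
      moreover have "\<alpha> + (1 - \<alpha>) / t_root n \<ge> 0" using g alpha_ge0 alpha_lt1 by simp
      ultimately have sq: "(\<alpha> + (1 - \<alpha>) / t_root n)\<^sup>2 \<le> 1" by (simp add: power_le_one)
      have "norm (psi_fun (t_root n)) = (1 / t_root n) ^ (2 * n) * (\<alpha> + (1 - \<alpha>) / t_root n)\<^sup>2"
        using psi_fun_t_root[of n] that g by (simp add: abs_mult)
      also have "\<dots> \<le> (1 / t_root n) ^ (2 * n)"
        using sq g by (simp add: mult_left_le)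
      also have "\<dots> \<le> r ^ (2 * n)" using le g by (intro power_mono) auto
      also have "\<dots> \<le> r ^ n" using t2 by (intro power_decreasing) (auto simp: r_def)
      finally show ?thesis .
    qed
    then have "norm (psi_fun (t_root n)) \<le> norm (r ^ n) * 1" if "n \<ge> 2" for n
      using that t2 by (simp add: r_def)
    then show "eventually (\<lambda>n. norm (psi_fun (t_root n)) \<le> norm (r ^ n) * 1) sequentially"
      unfolding eventually_sequentially by blast
    show "(\<lambda>n. r ^ n) \<longlonglongrightarrow> 0"
      using t2 by (intro LIMSEQ_power_zero) (simp add: r_def)
  qed
qed

lemma eta_tendsto: "eta \<alpha> \<longlonglongrightarrow> lam t_lim"
proof -
  have "(\<lambda>n. lam (t_root n)) \<longlonglongrightarrow> lam t_lim"
    unfolding lam_def by (intro tendsto_intros t_root_tendsto) (use t_lim_gt1 in auto)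
  then show ?thesis by (simp add: eta_eq_lam[abs_def])
qed

lemma eta_less_lam_t_lim: "eta \<alpha> n < lam t_lim"
proof -
  have "eta \<alpha> n \<le> eta \<alpha> (Suc n)" by (rule eta_mono) simp
  also have "\<dots> < lam t_lim"
    unfolding eta_eq_lam by (intro lam_strict_mono t_root_ge1 t_root_less_t_lim) simp
  finally show ?thesis .
qed

section \<open>Eigenvalue equations at branching and pendant vertices\<close>

lemma lam_minus_alpha: "t > 0 \<Longrightarrow> lam t - \<alpha> = \<alpha> + (1 - \<alpha>) * t + (1 - \<alpha>) / t"
  by (simp add: lam_def algebra_simps add_divide_distrib)

lemma lam_minus_alpha_pos: "t \<ge> 1 \<Longrightarrow> lam t - \<alpha> > 0"
  using alpha_ge0 alpha_lt1 by (simp add: lam_minus_alpha add_nonneg_pos)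

text \<open>The eigenvalue equation at the branching vertex of the limit tree: each infinite branch
  contributes (1 - \<alpha>) / t_lim, and the pendant vertex contributes the right-hand side. It is
  \<open>psi_fun t_lim = 0\<close> divided by lam t_lim - \<alpha>.\<close>

lemma t_lim_equation:
  "lam t_lim - 3 * \<alpha> - 2 * (1 - \<alpha>) / t_lim = (1 - \<alpha>)\<^sup>2 / (lam t_lim - \<alpha>)"
proof -
  define t where "t = t_lim"
  define b where "b = 1 - \<alpha>"
  have t: "t > 0" using t_lim_gt1 by (simp add: t_def)
  have p: "\<alpha> + b * t + b / t > 0" using t alpha_ge0 alpha_lt1 by (simp add: b_def add_nonneg_pos)
  have "(b * t - \<alpha> - b / t) * (\<alpha> + b * t + b / t) = psi_fun t + b\<^sup>2"
    unfolding psi_fun_def b_def[symmetric] using t by (simp add: field_simps power2_eq_square)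
  then have "(b * t - \<alpha> - b / t) * (\<alpha> + b * t + b / t) = b\<^sup>2"
    using psi_fun_t_lim by (simp add: t_def)
  then have "b * t - \<alpha> - b / t = b\<^sup>2 / (\<alpha> + b * t + b / t)" using p by (subst eq_divide_eq) simp
  moreover have "lam t - 3 * \<alpha> - 2 * b / t = b * t - \<alpha> - b / t"
    using t by (simp add: lam_def b_def field_simps)
  ultimately show ?thesis
    using lam_minus_alpha[OF t] unfolding t_def[symmetric] b_def[symmetric] by simp
qed

text \<open>Two pendant vertices, with the \<alpha> of the additional degree, contribute at least
  the (1 - \<alpha>) / t of an infinite ray. In lower bounds a ray may thus be replaced by two
  pendant vertices.\<close>

lemma pendant_pair_bound:
  assumes t: "t \<ge> 1"
  shows "(1 - \<alpha>) / t - \<alpha> \<le> 2 * (1 - \<alpha>)\<^sup>2 / (lam t - \<alpha>)"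
proof -
  define b where "b = 1 - \<alpha>"
  have b: "b > 0" using alpha_lt1 by (simp add: b_def)
  have t0: "t > 0" using t by simp
  have p: "\<alpha> + b * t + b / t > 0" using t0 alpha_ge0 b by (simp add: add_nonneg_pos)
  have "(b / t - \<alpha>) * (\<alpha> + b * t + b / t) = b\<^sup>2 + (b / t)\<^sup>2 - \<alpha>\<^sup>2 - \<alpha> * b * t"
    using t0 by (simp add: field_simps power2_eq_square)
  also have "\<dots> \<le> 2 * b\<^sup>2"
  proof -
    have "(b / t)\<^sup>2 \<le> b\<^sup>2" using t b by (intro power_mono divide_le_self) auto
    moreover have "\<alpha> * b * t \<ge> 0" using alpha_ge0 b t0 by simp
    ultimately show ?thesis using zero_le_power2[of \<alpha>] by linarith
  qed
  finally have "b / t - \<alpha> \<le> 2 * b\<^sup>2 / (\<alpha> + b * t + b / t)" using p by (simp add: pos_le_divide_eq)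
  then show ?thesis unfolding lam_minus_alpha[OF t0] b_def[symmetric] .
qed

text \<open>Entries of a test vector at the two neighbours of \<open>u\<close> in \<open>rad_ge_two_long_branches\<close>.\<close>

lemma two_branches_entry:
  obtains y where "y > 0"
    "2 * \<alpha> * y + (1 - \<alpha>) + (1 - \<alpha>)\<^sup>2 / (lam t_lim - \<alpha>) * y = lam t_lim * y"
    "lam t_lim \<le> 3 * \<alpha> + 2 * (1 - \<alpha>) * y + (1 - \<alpha>) / t_lim"
    "(1 - \<alpha>)\<^sup>2 / (lam t_lim - \<alpha>) \<le> 1 - \<alpha>"
proof -
  define t where "t = t_lim"
  define b where "b = 1 - \<alpha>"
  have b: "b > 0" using alpha_lt1 by (simp add: b_def)
  have t: "t > 1" using t_lim_gt1 by (simp add: t_def)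
  have lm: "lam t - \<alpha> = \<alpha> + b * t + b / t" using lam_minus_alpha[of t] t by (simp add: b_def)
  have p: "\<alpha> + b * t + b / t > 0" using t alpha_ge0 b by (simp add: add_nonneg_pos)
  define q where "q = b\<^sup>2 / (lam t - \<alpha>)"
  have lam_t: "lam t = 2 * \<alpha> + b * t + b / t" using t by (simp add: lam_def b_def field_simps)
  have q: "q = b * t - \<alpha> - b / t"
  proof -
    have "lam t - 3 * \<alpha> - 2 * b / t = q"
      using t_lim_equation unfolding t_def[symmetric] b_def[symmetric] q_def[symmetric] .
    then show ?thesis unfolding lam_t by simp
  qed
  have qb: "q \<le> b / t"
  proof -
    have "b * t \<le> \<alpha> + b * t + b / t" using alpha_ge0 b t by simp
    then have "b * b * t \<le> b * (\<alpha> + b * t + b / t)" using b by (simp add: mult.assoc)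
    then show ?thesis unfolding q_def lm using p t by (simp add: field_simps power2_eq_square)
  qed
  have bt: "b / t \<le> b" using b t by (intro divide_le_self) auto
  have den: "2 * b / t + \<alpha> > 0" using b t alpha_ge0 by (simp add: add_pos_nonneg)
  \<comment> \<open>Solves the equation at the neighbours of u, where lam t - 2 * \<alpha> - q = 2 *
    b / t + \<alpha>.\<close>
  define y where "y = b / (2 * b / t + \<alpha>)"
  have y: "y > 0" using b den by (simp add: y_def)
  have yd: "y * (2 * b / t + \<alpha>) = b" using den by (simp add: y_def)
  have "2 * \<alpha> * y + b + q * y = lam t * y"
    unfolding lam_t q using yd by (simp add: algebra_simps)
  moreover have "lam t \<le> 3 * \<alpha> + 2 * b * y + b / t"
  proof -
    \<comment> \<open>Cleared of denominators, the inequality at u says that \<alpha> times this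
      quantity is nonpositive; the quantity itself is q - b / t.\<close>
    have "b * t - 2 * b / t - \<alpha> \<le> 0" using q qb by simp
    then have "\<alpha> * (b * t - 2 * b / t - \<alpha>) \<le> 0" by (rule mult_nonneg_nonpos[OF alpha_ge0])
    moreover have "(b * t - \<alpha>) * (2 * b / t + \<alpha>) = 2 * b * b + \<alpha> * (b * t - 2 * b / t - \<alpha>)"
      using t by (simp add: field_simps)
    ultimately have "(b * t - \<alpha>) * (2 * b / t + \<alpha>) \<le> 2 * b * b" by simp
    then have "b * t - \<alpha> \<le> 2 * b * y" using den by (simp add: y_def pos_le_divide_eq)
    then show ?thesis unfolding lam_t by simp
  qed
  ultimately show thesis
    using that[of y] y qb bt unfolding q_def t_def[symmetric] b_def[symmetric] by simp
qed

text \<open>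
  The sequence \<open>w\<close> solves the eigenvalue equation for \<open>eta \<alpha> n\<close> along the branch of length \<open>n\<close>,
  indexed by the distance from its end-vertex.
\<close>

lemma chain_vector:
  assumes n: "n \<ge> 1"
  obtains w where "\<And>k. w k > 0"
    "\<alpha> * w 0 + (1 - \<alpha>) * w 1 = lam (t_root n) * w 0"
    "\<And>k. 2 * \<alpha> * w (Suc k) + (1 - \<alpha>) * (w k + w (Suc (Suc k))) = lam (t_root n) * w (Suc k)"
    "3 * \<alpha> * w n + (1 - \<alpha>) * w (n - 1) + (1 - \<alpha>) / t_root n * w n
      + (1 - \<alpha>)\<^sup>2 / (lam (t_root n) - \<alpha>) * w n = lam (t_root n) * w n"
proof (cases "t_root n = 1")
  case True
  from t_root_eq1[OF n True] have 0: "n = 1" "\<alpha> = 0" by auto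
  have l: "lam 1 = 2" by (simp add: lam_def)
  \<comment> \<open>At t = 1 the two exponential solutions coincide, and the linear solution k + 1
    takes their place.\<close>
  show thesis
    by (rule that[of "\<lambda>k. real k + 1"]; (unfold True l)?) (simp_all add: 0)
next
  case False
  define t where "t = t_root n"
  define b where "b = 1 - \<alpha>"
  have b: "b > 0" using alpha_lt1 by (simp add: b_def)
  have t: "t > 1" using False t_root_ge1[of n] by (simp add: t_def)
  have lam_t: "lam t = 2 * \<alpha> + b * t + b / t" using t by (simp add: lam_def b_def field_simps)
  have p: "\<alpha> + b * t + b / t > 0" using t alpha_ge0 b by (simp add: add_nonneg_pos)
  \<comment> \<open>For A t^k + B t^(-k) the end-vertex equation reads A * c2 + B * c1 = 0, which
    suggests A = c1 and B = - c2.\<close>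
  define c1 where "c1 = \<alpha> + b * t"
  define c2 where "c2 = \<alpha> + b / t"
  define w where "w = (\<lambda>k. c1 * t ^ k - c2 * (1 / t) ^ k)"
  have c2: "c2 > 0" using alpha_ge0 b t by (simp add: c2_def add_nonneg_pos)
  have "b / t \<le> b" using b t by (intro divide_le_self) auto
  also have "b < b * t" using b t by simp
  finally have "b / t < b * t" .
  then have c12: "c2 < c1" by (simp add: c1_def c2_def)
  have wpos: "w k > 0" for k
  proof -
    have "c2 * (1 / t) ^ k \<le> c2 * 1" using c2 t by (intro mult_left_mono power_le_one) auto
    also have "\<dots> < c1 * 1" using c12 by simp
    also have "\<dots> \<le> c1 * t ^ k" using c2 c12 t by (intro mult_left_mono one_le_power) auto
    finally show ?thesis by (simp add: w_def)
  qed
  have w0: "\<alpha> * w 0 + b * w 1 = lam t * w 0"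
    unfolding lam_t w_def c1_def c2_def using t by (simp add: field_simps)
  have wS: "2 * \<alpha> * w (Suc k) + b * (w k + w (Suc (Suc k))) = lam t * w (Suc k)" for k
    unfolding lam_t w_def using t by (simp add: field_simps)
  have wn: "3 * \<alpha> * w n + b * w (n - 1) + b / t * w n + b\<^sup>2 / (lam t - \<alpha>) * w n = lam t * w n"
  proof -
    obtain k where k: "n = Suc k" using n by (cases n) auto
    define s where "s = t ^ n"
    have s: "s > 0" using t by (simp add: s_def)
    have tk: "t ^ k = s / t" using t by (simp add: s_def k)
    have "psi_fun t = - ((1 / s)\<^sup>2 * c2\<^sup>2)"
      using psi_fun_t_root[OF n] t unfolding t_def[symmetric] b_def[symmetric] c2_def[symmetric]
      by (simp add: s_def power_mult power2_eq_square power_divide power_mult_distrib mult.commute[of 2])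
    then have e: "s * psi_fun t + c2\<^sup>2 / s = 0" using s by (simp add: field_simps power2_eq_square)
    have wn: "w n = c1 * s - c2 / s" "w (n - 1) = c1 * s / t - c2 * t / s"
      using t by (simp_all add: w_def s_def k field_simps)
    have c12p: "c1 * c2 = \<alpha>\<^sup>2 + b\<^sup>2 + \<alpha> * b * (t + 1 / t)"
      using t by (simp add: c1_def c2_def field_simps power2_eq_square)
    \<comment> \<open>The equation at the branching vertex, multiplied by lam t - \<alpha>. The
      growing solution is multiplied by \<open>psi_fun t\<close>, the decaying one by - c1 * c2, and
      the root equation makes the total vanish.\<close>
    have D: "((b * t - \<alpha>) * (\<alpha> + b * t + b / t) - b\<^sup>2) * w n - b * (\<alpha> + b * t + b / t) * w (n - 1)
        = c1 * (s * psi_fun t + c2\<^sup>2 / s)"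
    proof -
      have 1: "(b * t - \<alpha>) * (\<alpha> + b * t + b / t) - b\<^sup>2 - b / t * (\<alpha> + b * t + b / t) = psi_fun t"
        unfolding psi_fun_def b_def[symmetric] using t by (simp add: field_simps power2_eq_square)
      have 2: "(b * t - \<alpha>) * (\<alpha> + b * t + b / t) - b\<^sup>2 - b * t * (\<alpha> + b * t + b / t) = - (c1 * c2)"
        unfolding c12p using t by (simp add: field_simps power2_eq_square)
      define P where "P = (b * t - \<alpha>) * (\<alpha> + b * t + b / t) - b\<^sup>2"
      define R where "R = \<alpha> + b * t + b / t"
      have "P * w n - b * R * w (n - 1) = c1 * s * (P - b / t * R) - c2 / s * (P - b * t * R)"
        unfolding wn using t s by (simp add: field_simps)
      also have "\<dots> = c1 * s * psi_fun t + c2 / s * (c1 * c2)"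
        unfolding P_def R_def 1 2 by simp
      finally show ?thesis unfolding P_def R_def by (simp add: algebra_simps power2_eq_square)
    qed
    then have "((b * t - \<alpha>) * (\<alpha> + b * t + b / t) - b\<^sup>2) * w n = b * (\<alpha> + b * t + b / t) * w (n - 1)"
      using e by simp
    moreover have "(A - b\<^sup>2 / R) * W = b * V" if "(A * R - b\<^sup>2) * W = b * R * V" "R > 0" for A R V W
      using that by (simp add: field_simps)
    ultimately have "(b * t - \<alpha> - b\<^sup>2 / (\<alpha> + b * t + b / t)) * w n = b * w (n - 1)"
      using p by blast
    moreover have "lam t - \<alpha> = \<alpha> + b * t + b / t" by (simp add: lam_t)
    ultimately show ?thesis by (simp add: lam_t algebra_simps)
  qed
  show thesis
    using that[of w] wpos w0 wS wn unfolding t_def b_def by blast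
qed

end

section \<open>Test vectors on trees with few branching vertices\<close>

definition path_on :: "('v \<times> 'v) set \<Rightarrow> (nat \<Rightarrow> 'v) \<Rightarrow> nat \<Rightarrow> bool" where
  "path_on E z L \<longleftrightarrow> inj_on z {0..L} \<and> (\<forall>i<L. (z i, z (Suc i)) \<in> E)"

lemma path_onD:
  assumes "path_on E z L"
  shows "inj_on z {0..L}" "\<And>i. i < L \<Longrightarrow> (z i, z (Suc i)) \<in> E"
    "\<And>i j. i \<le> L \<Longrightarrow> j \<le> L \<Longrightarrow> z i = z j \<longleftrightarrow> i = j"
  using assms by (auto simp: path_on_def inj_on_def)

text \<open>
  A tree with one branching vertex \<open>z 0 = y 0\<close>, from which emanate the path \<open>z\<close> of length \<open>L\<close>,
  the path \<open>y\<close> of length \<open>m\<close> and the edge to \<open>q\<close>.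
\<close>

definition fork_on :: "('v \<times> 'v) set \<Rightarrow> (nat \<Rightarrow> 'v) \<Rightarrow> nat \<Rightarrow> 'v \<Rightarrow> (nat \<Rightarrow> 'v) \<Rightarrow> nat \<Rightarrow> bool" where
  "fork_on E z L q y m \<longleftrightarrow> path_on E z L \<and> path_on E y m \<and> y 0 = z 0 \<and> (z 0, q) \<in> E \<and>
     y ` {1..m} \<inter> z ` {0..L} = {} \<and> q \<notin> y ` {0..m} \<and> q \<notin> z ` {0..L}"

context aspec
begin

lemma rad_ge_path_extension':
  assumes E: "ugraph E" and t: "1 \<le> t" and S: "finite S" "z 0 \<in> S"
    and x: "\<And>v. v \<in> S \<Longrightarrow> 0 \<le> x v" "x (z 0) = 1"
    and pt: "\<And>v. v \<in> S \<Longrightarrow> v \<noteq> z 0 \<Longrightarrow>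
      \<exists>M. M \<subseteq> S \<and> M \<subseteq> E `` {v} \<and> lam t * x v \<le> (\<Sum>w\<in>M. \<alpha> * x v + (1 - \<alpha>) * x w)"
    and Mu: "Mu \<subseteq> S" "Mu \<subseteq> E `` {z 0}"
    and ptu: "lam t \<le> (\<Sum>w\<in>Mu. \<alpha> + (1 - \<alpha>) * x w) + (\<alpha> + (1 - \<alpha>) / t)"
    and L: "1 \<le> L" and z: "path_on E z L" "z ` {1..L} \<inter> S = {}"
  shows "lam t - 2 / (real L + 1) \<le> rad E"
proof -
  have "\<forall>v\<in>S - {z 0}. \<exists>M. M \<subseteq> S \<and> M \<subseteq> E `` {v} \<and> lam t * x v \<le> (\<Sum>w\<in>M. \<alpha> * x v + (1 - \<alpha>) * x w)"
    using pt by auto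
  then obtain N where N: "\<forall>v\<in>S - {z 0}. N v \<subseteq> S \<and> N v \<subseteq> E `` {v} \<and>
      lam t * x v \<le> (\<Sum>w\<in>N v. \<alpha> * x v + (1 - \<alpha>) * x w)"
    using bchoice by meson
  show ?thesis
  proof (rule rad_ge_path_extension[where N = "N(z 0 := Mu)" and d = 0 and u = "z 0" and x = x, OF E t S x])
    show "\<And>v. v \<in> S \<Longrightarrow> (N(z 0 := Mu)) v \<subseteq> S" "\<And>v. v \<in> S \<Longrightarrow> (N(z 0 := Mu)) v \<subseteq> E `` {v}"
      using N Mu by auto
    show "\<And>v. v \<in> S \<Longrightarrow> v \<noteq> z 0 \<Longrightarrow>
        lam t * x v \<le> (\<Sum>w\<in>(N(z 0 := Mu)) v. \<alpha> * x v + (1 - \<alpha>) * x w)"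
      using N by auto
    show "lam t - 0 \<le> (\<Sum>w\<in>(N(z 0 := Mu)) (z 0). \<alpha> + (1 - \<alpha>) * x w) + (\<alpha> + (1 - \<alpha>) / t)"
      using ptu by simp
  qed (use t L z path_onD[OF z(1)] in auto)
qed

lemma sum_two_neighbours:
  assumes "a \<noteq> b"
  shows "(\<Sum>w\<in>{a, b}. \<alpha> * s + (1 - \<alpha>) * f w) = 2 * \<alpha> * s + (1 - \<alpha>) * (f b + f a)"
  using assms by (simp add: algebra_simps)

text \<open>c is the entry at a pendant vertex whose neighbour has entry 1. The last equation is the
  form in which the pendant vertex enters the equation of that neighbour.\<close>

lemma pendant_entry:
  assumes "t \<ge> 1"
  obtains c where "c > 0" "lam t * c = \<alpha> * c + (1 - \<alpha>)" "(1 - \<alpha>) * c = (1 - \<alpha>)\<^sup>2 / (lam t - \<alpha>)"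
proof
  define c where "c = (1 - \<alpha>) / (lam t - \<alpha>)"
  have p: "lam t - \<alpha> > 0" by (rule lam_minus_alpha_pos[OF assms])
  show "c > 0" using p alpha_lt1 by (simp add: c_def)
  have "c * (lam t - \<alpha>) = 1 - \<alpha>" using p by (simp add: c_def)
  then show "lam t * c = \<alpha> * c + (1 - \<alpha>)" by (simp add: algebra_simps)
  show "(1 - \<alpha>) * c = (1 - \<alpha>)\<^sup>2 / (lam t - \<alpha>)" by (simp add: c_def power2_eq_square)
qed

text \<open>The three neighbours get the pendant entry c. Compared with
  \<open>t_lim_equation\<close>, two of them and the additional degree replace one infinite branch,
  which \<open>pendant_pair_bound\<close> permits.\<close>

lemma rad_ge_three_extra_neighbours:
  assumes E: "ugraph E" and L: "1 \<le> L" and z: "path_on E z L"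
    and N: "N \<subseteq> E `` {z 0}" "card N = 3" "N \<inter> z ` {0..L} = {}"
  shows "lam t_lim - 2 / (real L + 1) \<le> rad E"
proof -
  have t: "1 \<le> t_lim" using t_lim_gt1 by simp
  from pendant_entry[OF t] obtain c where c: "c > 0" "lam t_lim * c = \<alpha> * c + (1 - \<alpha>)"
    "(1 - \<alpha>) * c = (1 - \<alpha>)\<^sup>2 / (lam t_lim - \<alpha>)" .
  define x where "x = (\<lambda>v. if v = z 0 then 1 else c)"
  have finN: "finite N" using N(2) by (metis card.infinite zero_neq_numeral)
  have uN: "z 0 \<notin> N" using N(3) by auto
  have xN: "(\<Sum>w\<in>N. \<alpha> + (1 - \<alpha>) * x w) = 3 * (\<alpha> + (1 - \<alpha>) * c)"
  proof -
    have "(\<Sum>w\<in>N. \<alpha> + (1 - \<alpha>) * x w) = (\<Sum>w\<in>N. \<alpha> + (1 - \<alpha>) * c)"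
      by (intro sum.cong refl) (use uN in \<open>auto simp: x_def\<close>)
    then show ?thesis using N(2) by simp
  qed
  show ?thesis
  proof (rule rad_ge_path_extension'[where S = "insert (z 0) N" and x = x and Mu = N, OF E t])
    show "0 \<le> x v" for v using c(1) by (simp add: x_def)
    show "x (z 0) = 1" by (simp add: x_def)
    fix v assume v: "v \<in> insert (z 0) N" "v \<noteq> z 0"
    show "\<exists>M. M \<subseteq> insert (z 0) N \<and> M \<subseteq> E `` {v} \<and>
        lam t_lim * x v \<le> (\<Sum>w\<in>M. \<alpha> * x v + (1 - \<alpha>) * x w)"
      by (rule exI[of _ "{z 0}"]) (use v N(1) ugraphD(2)[OF E] c(2) in \<open>auto simp: x_def\<close>)
  next
    show "lam t_lim \<le> (\<Sum>w\<in>N. \<alpha> + (1 - \<alpha>) * x w) + (\<alpha> + (1 - \<alpha>) / t_lim)"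
    proof -
      have "lam t_lim = 3 * \<alpha> + 2 * ((1 - \<alpha>) / t_lim) + (1 - \<alpha>) * c"
        using t_lim_equation c(3) by simp
      moreover have "(1 - \<alpha>) / t_lim - \<alpha> \<le> 2 * ((1 - \<alpha>) * c)"
        using pendant_pair_bound[OF t] c(3) by simp
      ultimately show ?thesis unfolding xN distrib_left by linarith
    qed
    show "z ` {1..L} \<inter> insert (z 0) N = {}"
      using N(3) path_onD(3)[OF z, of _ 0] by (fastforce simp: disjoint_iff)
  qed (use finN N L z in auto)
qed

text \<open>P and Q get the entry e of \<open>two_branches_entry\<close>, the vertices beyond them c
  * e. P' may coincide with Q' or with Q: every entry off z 0 is at least c * e because c \<le> 1,
  so the lower bounds survive short cycles.\<close>

lemma rad_ge_two_long_branches: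
  assumes E: "ugraph E" and L: "1 \<le> L" and z: "path_on E z L"
    and P: "(z 0, P) \<in> E" "P \<notin> z ` {0..L}" "(P, P') \<in> E" "P' \<notin> z ` {0..L}"
    and Q: "(z 0, Q) \<in> E" "Q \<notin> z ` {0..L}" "(Q, Q') \<in> E" "Q' \<notin> z ` {0..L}"
    and PQ: "P \<noteq> Q"
  shows "lam t_lim - 2 / (real L + 1) \<le> rad E"
proof -
  have t: "1 \<le> t_lim" using t_lim_gt1 by simp
  note sy = ugraphD(2)[OF E] and ir = ugraphD(3)[OF E]
  from pendant_entry[OF t] obtain c where c: "c > 0" "lam t_lim * c = \<alpha> * c + (1 - \<alpha>)"
    "(1 - \<alpha>) * c = (1 - \<alpha>)\<^sup>2 / (lam t_lim - \<alpha>)" .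
  from two_branches_entry obtain e where e: "e > 0"
    "2 * \<alpha> * e + (1 - \<alpha>) + (1 - \<alpha>) * c * e = lam t_lim * e"
    "lam t_lim \<le> 3 * \<alpha> + 2 * (1 - \<alpha>) * e + (1 - \<alpha>) / t_lim"
    "(1 - \<alpha>) * c \<le> 1 - \<alpha>" unfolding c(3) .
  have u: "z 0 \<noteq> P" "z 0 \<noteq> Q" "z 0 \<noteq> P'" "z 0 \<noteq> Q'" using P Q by auto
  have c1: "c \<le> 1" using e(4) alpha_lt1 by (simp add: mult_le_cancel_left1)
  define x where "x = (\<lambda>v. if v = z 0 then 1 else if v = P \<or> v = Q then e else c * e)"
  have xs: "x (z 0) = 1" "x P = e" "x Q = e" using u by (simp_all add: x_def)
  have xw: "x v \<ge> c * e" if "v \<noteq> z 0" for v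
    using that c1 e(1) by (auto simp: x_def mult_le_cancel_right1)
  have P1: "P \<noteq> P'" "Q \<noteq> Q'" using P Q ir by auto
  let ?S = "{z 0, P, Q, P', Q'}"
  show ?thesis
  proof (rule rad_ge_path_extension'[where S = ?S and x = x and Mu = "{P, Q}", OF E t])
    show "0 \<le> x v" for v using c(1) e(1) by (simp add: x_def)
    show "lam t_lim \<le> (\<Sum>w\<in>{P, Q}. \<alpha> + (1 - \<alpha>) * x w) + (\<alpha> + (1 - \<alpha>) / t_lim)"
    proof -
      have "(\<Sum>w\<in>{P, Q}. \<alpha> + (1 - \<alpha>) * x w) = 2 * (\<alpha> + (1 - \<alpha>) * e)"
        using PQ xs by simp
      then show ?thesis using e(3) unfolding mult.assoc distrib_left by linarith
    qed
    show "z ` {1..L} \<inter> ?S = {}"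
      using P Q path_onD(3)[OF z, of _ 0] by (fastforce simp: disjoint_iff)
    fix v assume v: "v \<in> ?S" "v \<noteq> z 0"
    have branch: "\<exists>M. M \<subseteq> ?S \<and> M \<subseteq> E `` {a} \<and> lam t_lim * x a \<le> (\<Sum>w\<in>M. \<alpha> * x a + (1 - \<alpha>) * x w)"
      if a: "(z 0, a) \<in> E" "(a, a') \<in> E" "a' \<noteq> z 0" "a' \<in> ?S" "x a = e" for a a'
    proof (rule exI[of _ "{z 0, a'}"], intro conjI)
      have "(1 - \<alpha>) * (c * e) \<le> (1 - \<alpha>) * x a'" using xw[OF a(3)] alpha_lt1 by simp
      then show "lam t_lim * x a \<le> (\<Sum>w\<in>{z 0, a'}. \<alpha> * x a + (1 - \<alpha>) * x w)"
        using a(3,5) e(2) xs(1) by (simp add: algebra_simps)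
    qed (use a sy in auto)
    have leaf: "\<exists>M. M \<subseteq> ?S \<and> M \<subseteq> E `` {a} \<and> lam t_lim * x a \<le> (\<Sum>w\<in>M. \<alpha> * x a + (1 - \<alpha>) * x w)"
      if a: "(a', a) \<in> E" "x a' = e" "a' \<in> ?S" "x a = c * e" for a a'
    proof (rule exI[of _ "{a'}"], intro conjI)
      have "lam t_lim * (c * e) = \<alpha> * (c * e) + (1 - \<alpha>) * e"
        using c(2) by (simp only: mult.assoc[symmetric] distrib_right)
      then show "lam t_lim * x a \<le> (\<Sum>w\<in>{a'}. \<alpha> * x a + (1 - \<alpha>) * x w)"
        using a by simp
    qed (use a sy in auto)
    show "\<exists>M. M \<subseteq> ?S \<and> M \<subseteq> E `` {v} \<and> lam t_lim * x v \<le> (\<Sum>w\<in>M. \<alpha> * x v + (1 - \<alpha>) * x w)"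
    proof (cases "v = P \<or> v = Q")
      case True
      then show ?thesis
      proof
        assume "v = P"
        then show ?thesis using branch[OF P(1,3)] u(3) xs(2) by simp
      next
        assume "v = Q"
        then show ?thesis using branch[OF Q(1,3)] u(4) xs(3) by simp
      qed
    next
      case False
      then have vv: "v = P' \<or> v = Q'" and xv: "x v = c * e" using v by (auto simp: x_def)
      from vv show ?thesis
      proof
        assume "v = P'"
        then show ?thesis using leaf[OF P(3) xs(2)] xv by simp
      next
        assume "v = Q'"
        then show ?thesis using leaf[OF Q(3) xs(3)] xv by simp
      qed
    qed
  qed (use P Q L z xs in auto)
qed

text \<open>Up to y m the vector is that of the limit tree with two infinite branches. At y m the
  rest of the second branch is replaced by s1 and s2 with entries c * r ^ m, at no loss by
  \<open>pendant_pair_bound\<close>.\<close>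

lemma rad_ge_second_branching:
  assumes E: "ugraph E" and L: "1 \<le> L" and m: "1 \<le> m" and F: "fork_on E z L q y m"
    and s: "(y m, s1) \<in> E" "(y m, s2) \<in> E" "s1 \<noteq> s2"
    and d1: "s1 \<notin> y ` {0..m}" "s1 \<notin> z ` {0..L}" "s1 \<noteq> q"
    and d2: "s2 \<notin> y ` {0..m}" "s2 \<notin> z ` {0..L}" "s2 \<noteq> q"
  shows "lam t_lim - 2 / (real L + 1) \<le> rad E"
proof -
  have t: "1 \<le> t_lim" using t_lim_gt1 by simp
  note sy = ugraphD(2)[OF E]
  from F have z: "path_on E z L" and y: "path_on E y m" and y0: "y 0 = z 0" and q: "(z 0, q) \<in> E"
    and dis: "y ` {1..m} \<inter> z ` {0..L} = {}" "q \<notin> y ` {0..m}" "q \<notin> z ` {0..L}"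
    by (auto simp: fork_on_def)
  from pendant_entry[OF t] obtain c where c: "c > 0" "lam t_lim * c = \<alpha> * c + (1 - \<alpha>)"
    "(1 - \<alpha>) * c = (1 - \<alpha>)\<^sup>2 / (lam t_lim - \<alpha>)" .
  define r where "r = 1 / t_lim"
  have r: "0 < r" "r \<le> 1" using t by (auto simp: r_def)
  have lamr: "lam t_lim = 2 * \<alpha> + (1 - \<alpha>) * (1 / r + r)" by (simp add: lam_def r_def)
  have ep: "lam t_lim = 3 * \<alpha> + 2 * (1 - \<alpha>) * r + (1 - \<alpha>) * c"
    using t_lim_equation c(3) by (simp add: r_def)
  have pp: "(1 - \<alpha>) * r - \<alpha> \<le> 2 * ((1 - \<alpha>) * c)"
    using pendant_pair_bound[OF t] c(3) by (simp add: r_def)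
  define x where "x = (\<lambda>v. if v = q then c else if v = s1 \<or> v = s2 then c * r ^ m
    else r ^ the_inv_into {0..m} y v)"
  have xy: "x (y j) = r ^ j" if "j \<le> m" for j
  proof -
    have "y j \<in> y ` {0..m}" using that by auto
    then have "y j \<noteq> q" "y j \<noteq> s1" "y j \<noteq> s2" using dis d1 d2 by auto
    then show ?thesis using the_inv_into_f_f[OF path_onD(1)[OF y], of j] that by (simp add: x_def)
  qed
  have xq: "x q = c" "x s1 = c * r ^ m" "x s2 = c * r ^ m" using d1 d2 by (simp_all add: x_def)
  have x0: "x (z 0) = 1" using xy[of 0] y0 by simp
  let ?S = "{q, s1, s2} \<union> y ` {0..m}"
  have y1: "y 1 \<noteq> q" using dis m by auto
  have qy: "y j \<in> ?S" if "j \<le> m" for j using that by auto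
  show ?thesis
  proof (rule rad_ge_path_extension'[where S = ?S and x = x and Mu = "{q, y 1}", OF E t])
    show "0 \<le> x v" for v using c(1) r by (simp add: x_def)
    show "{q, y 1} \<subseteq> E `` {z 0}" using q path_onD(2)[OF y, of 0] m y0 by auto
    show "lam t_lim \<le> (\<Sum>w\<in>{q, y 1}. \<alpha> + (1 - \<alpha>) * x w) + (\<alpha> + (1 - \<alpha>) / t_lim)"
    proof -
      have "(\<Sum>w\<in>{q, y 1}. \<alpha> + (1 - \<alpha>) * x w) = 2 * \<alpha> + (1 - \<alpha>) * c + (1 - \<alpha>) * r"
        using y1 xq xy[of 1] m by simp
      moreover have "(1 - \<alpha>) / t_lim = (1 - \<alpha>) * r" by (simp add: r_def)
      ultimately show ?thesis using ep unfolding mult.assoc by linarith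
    qed
    show "z ` {1..L} \<inter> ?S = {}"
    proof -
      have "z i \<noteq> y j" if i: "1 \<le> i" "i \<le> L" and j: "j \<le> m" for i j
      proof (cases "j = 0")
        case True
        then show ?thesis using path_onD(3)[OF z, of i 0] i y0 by auto
      next
        case False
        then have "y j \<in> y ` {1..m}" "z i \<in> z ` {0..L}" using i j by auto
        then show ?thesis using dis(1) by auto
      qed
      moreover have "z ` {1..L} \<subseteq> z ` {0..L}" by auto
      ultimately show ?thesis using dis(3) d1(2) d2(2) by fastforce
    qed
    fix v assume v: "v \<in> ?S" "v \<noteq> z 0"
    consider "v = q" | "v = s1 \<or> v = s2" | j where "v = y j" "1 \<le> j" "j < m" | "v = y m"
    proof -
      have "v = q \<or> (v = s1 \<or> v = s2) \<or> (\<exists>j. v = y j \<and> 1 \<le> j \<and> j < m) \<or> v = y m"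
      proof (rule ccontr)
        assume n: "\<not> ?thesis"
        then obtain j where j: "v = y j" "j \<le> m" using v(1) by auto
        then have "j \<noteq> 0" using v(2) y0 by (cases j) auto
        moreover have "j \<noteq> m" using n j by auto
        ultimately have "1 \<le> j" "j < m" using j(2) by simp_all
        then show False using n j(1) by blast
      qed
      then show ?thesis using that by blast
    qed
    then show "\<exists>M. M \<subseteq> ?S \<and> M \<subseteq> E `` {v} \<and> lam t_lim * x v \<le> (\<Sum>w\<in>M. \<alpha> * x v + (1 - \<alpha>) * x w)"
    proof cases
      case 1
      have "y 0 \<in> ?S" by auto
      then show ?thesis
        by (intro exI[of _ "{z 0}"]) (use 1 q sy y0 c(2) xq x0 in auto)
    next
      case 2
      have "lam t_lim * (c * r ^ m) = \<alpha> * (c * r ^ m) + (1 - \<alpha>) * r ^ m"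
        using c(2) by (simp only: mult.assoc[symmetric] distrib_right)
      then show ?thesis
        by (intro exI[of _ "{y m}"]) (use 2 s sy xq xy[of m] in auto)
    next
      case 3
      have ne: "y (j - 1) \<noteq> y (Suc j)" using path_onD(3)[OF y, of "j - 1" "Suc j"] 3 by auto
      have Em: "(y (j - 1), y j) \<in> E" "(y j, y (Suc j)) \<in> E"
        using path_onD(2)[OF y, of "j - 1"] path_onD(2)[OF y, of j] 3 by auto
      have rj: "r ^ j = r * r ^ (j - 1)" using 3(2) by (cases j) auto
      show ?thesis
      proof (intro exI[of _ "{y (j - 1), y (Suc j)}"] conjI)
        show "{y (j - 1), y (Suc j)} \<subseteq> ?S" using qy[of "j - 1"] qy[of "Suc j"] 3 by simp
        show "{y (j - 1), y (Suc j)} \<subseteq> E `` {v}" using Em 3(1) sy by auto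
        have "lam t_lim * r ^ j = 2 * \<alpha> * r ^ j + (1 - \<alpha>) * (r ^ (j - 1) + r ^ Suc j)"
          unfolding lamr power_Suc rj using r by (simp add: field_simps)
        then show "lam t_lim * x v \<le> (\<Sum>w\<in>{y (j - 1), y (Suc j)}. \<alpha> * x v + (1 - \<alpha>) * x w)"
          using ne 3 xy[of "j - 1"] xy[of j] xy[of "Suc j"] by (simp add: algebra_simps)
      qed
    next
      case 4
      have Em: "(y (m - 1), y m) \<in> E" using path_onD(2)[OF y, of "m - 1"] m by simp
      have ne: "y (m - 1) \<noteq> s1" "y (m - 1) \<noteq> s2" using d1(1) d2(1) by auto
      have rj: "r ^ m = r * r ^ (m - 1)" using m by (cases m) auto
      show ?thesis
      proof (intro exI[of _ "{y (m - 1), s1, s2}"] conjI)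
        show "{y (m - 1), s1, s2} \<subseteq> ?S" using qy[of "m - 1"] by simp
        show "{y (m - 1), s1, s2} \<subseteq> E `` {v}" using Em 4 s sy by auto
        have "3 * \<alpha> * r ^ m + (1 - \<alpha>) * r ^ (m - 1) + 2 * ((1 - \<alpha>) * c) * r ^ m - lam t_lim * r ^ m
            = r ^ m * (2 * ((1 - \<alpha>) * c) - ((1 - \<alpha>) * r - \<alpha>))"
          unfolding lamr rj using r by (simp add: field_simps)
        also have "\<dots> \<ge> 0" using pp r by (intro mult_nonneg_nonneg) auto
        finally show "lam t_lim * x v \<le> (\<Sum>w\<in>{y (m - 1), s1, s2}. \<alpha> * x v + (1 - \<alpha>) * x w)"
          using ne s(3) 4 xq xy[of "m - 1"] xy[of m] by (simp add: algebra_simps)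
      qed
    qed
  qed (use L z x0 m imageI[of 0 "{0..m}" y] y0 in auto)
qed

text \<open>The branch y carries the chain vector, scaled to 1 at the branching vertex. As
  \<open>chain_vector\<close> counts from the end-vertex, y j gets the index m - j.\<close>

lemma rad_ge_fork:
  assumes E: "ugraph E" and L: "1 \<le> L" and m: "1 \<le> m" and F: "fork_on E z L q y m"
  shows "eta \<alpha> m - 2 / (real L + 1) \<le> rad E"
proof -
  define t where "t = t_root m"
  have t: "1 \<le> t" by (simp add: t_def t_root_ge1)
  note sy = ugraphD(2)[OF E]
  from F have z: "path_on E z L" and y: "path_on E y m" and y0: "y 0 = z 0" and q: "(z 0, q) \<in> E"
    and dis: "y ` {1..m} \<inter> z ` {0..L} = {}" "q \<notin> y ` {0..m}" "q \<notin> z ` {0..L}"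
    by (auto simp: fork_on_def)
  from pendant_entry[OF t] obtain c where c: "c > 0" "lam t * c = \<alpha> * c + (1 - \<alpha>)"
    "(1 - \<alpha>) * c = (1 - \<alpha>)\<^sup>2 / (lam t - \<alpha>)" .
  from chain_vector[OF m] obtain w where w: "\<And>k. w k > 0"
    "\<alpha> * w 0 + (1 - \<alpha>) * w 1 = lam t * w 0"
    "\<And>k. 2 * \<alpha> * w (Suc k) + (1 - \<alpha>) * (w k + w (Suc (Suc k))) = lam t * w (Suc k)"
    "3 * \<alpha> * w m + (1 - \<alpha>) * w (m - 1) + (1 - \<alpha>) / t * w m + (1 - \<alpha>) * c * w m = lam t * w m"
    unfolding t_def[symmetric] c(3)[symmetric] by blast
  define x where "x = (\<lambda>v. if v = q then c else w (m - the_inv_into {0..m} y v) / w m)"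
  have xy: "x (y j) = w (m - j) / w m" if "j \<le> m" for j
  proof -
    have "y j \<in> y ` {0..m}" using that by auto
    then have "y j \<noteq> q" using dis by auto
    then show ?thesis using the_inv_into_f_f[OF path_onD(1)[OF y], of j] that by (simp add: x_def)
  qed
  have wm: "w m > 0" "w m \<noteq> 0" using w(1)[of m] by simp_all
  have xq: "x q = c" by (simp add: x_def)
  have x0: "x (z 0) = 1" using xy[of 0] y0 wm by simp
  let ?S = "{q} \<union> y ` {0..m}"
  have y1: "y 1 \<noteq> q" using dis m by auto
  have qy: "y j \<in> ?S" if "j \<le> m" for j using that by auto
  have "lam t - 2 / (real L + 1) \<le> rad E"
  proof (rule rad_ge_path_extension'[where S = ?S and x = x and Mu = "{q, y 1}", OF E t])
    show "0 \<le> x v" for v using c(1) w(1) by (simp add: x_def less_imp_le)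
    show "{q, y 1} \<subseteq> E `` {z 0}" using q path_onD(2)[OF y, of 0] m y0 by auto
    have "lam t = 3 * \<alpha> + (1 - \<alpha>) * (w (m - 1) / w m) + (1 - \<alpha>) / t + (1 - \<alpha>) * c"
      using w(4) wm(2) by (simp add: field_simps)
    then show "lam t \<le> (\<Sum>w\<in>{q, y 1}. \<alpha> + (1 - \<alpha>) * x w) + (\<alpha> + (1 - \<alpha>) / t)"
      using y1 xq xy[of 1] m by simp
    show "z ` {1..L} \<inter> ?S = {}"
    proof -
      have "z i \<noteq> y j" if i: "1 \<le> i" "i \<le> L" and j: "j \<le> m" for i j
      proof (cases "j = 0")
        case True
        then show ?thesis using path_onD(3)[OF z, of i 0] i y0 by auto
      next
        case False
        then have "y j \<in> y ` {1..m}" "z i \<in> z ` {0..L}" using i j by auto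
        then show ?thesis using dis(1) by auto
      qed
      moreover have "z ` {1..L} \<subseteq> z ` {0..L}" by auto
      ultimately show ?thesis using dis(3) by fastforce
    qed
    fix v assume v: "v \<in> ?S" "v \<noteq> z 0"
    consider "v = q" | j where "v = y j" "1 \<le> j" "j < m" | "v = y m"
    proof -
      have "v = q \<or> (\<exists>j. v = y j \<and> 1 \<le> j \<and> j < m) \<or> v = y m"
      proof (rule ccontr)
        assume n: "\<not> ?thesis"
        then obtain j where j: "v = y j" "j \<le> m" using v(1) by auto
        then have "j \<noteq> 0" using v(2) y0 by (cases j) auto
        moreover have "j \<noteq> m" using n j by auto
        ultimately have "1 \<le> j" "j < m" using j(2) by simp_all
        then show False using n j(1) by blast
      qed
      then show ?thesis using that by blast
    qed
    then show "\<exists>M. M \<subseteq> ?S \<and> M \<subseteq> E `` {v} \<and> lam t * x v \<le> (\<Sum>w\<in>M. \<alpha> * x v + (1 - \<alpha>) * x w)"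
    proof cases
      case 1
      have "y 0 \<in> ?S" by auto
      then show ?thesis
        by (intro exI[of _ "{z 0}"]) (use 1 q sy y0 c(2) xq x0 in auto)
    next
      case 2
      have ne: "y (j - 1) \<noteq> y (Suc j)" using path_onD(3)[OF y, of "j - 1" "Suc j"] 2 by auto
      have Em: "(y (j - 1), y j) \<in> E" "(y j, y (Suc j)) \<in> E"
        using path_onD(2)[OF y, of "j - 1"] path_onD(2)[OF y, of j] 2 by auto
      show ?thesis
      proof (intro exI[of _ "{y (j - 1), y (Suc j)}"] conjI)
        show "{y (j - 1), y (Suc j)} \<subseteq> ?S" using qy[of "j - 1"] qy[of "Suc j"] 2 by simp
        show "{y (j - 1), y (Suc j)} \<subseteq> E `` {v}" using Em 2(1) sy by auto
        define k where "k = m - Suc j"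
        have k: "m - j = Suc k" "m - (j - 1) = Suc (Suc k)" "m - Suc j = k"
          using 2 by (auto simp: k_def)
        have "x v = w (Suc k) / w m" "x (y (j - 1)) = w (Suc (Suc k)) / w m" "x (y (Suc j)) = w k / w m"
          using 2 xy[of j] xy[of "j - 1"] xy[of "Suc j"] k by simp_all
        moreover have "lam t * (w (Suc k) / w m)
            = 2 * \<alpha> * (w (Suc k) / w m) + (1 - \<alpha>) * (w k / w m + w (Suc (Suc k)) / w m)"
          using w(3)[of k] wm(2) by (simp add: field_simps)
        ultimately show "lam t * x v \<le> (\<Sum>w\<in>{y (j - 1), y (Suc j)}. \<alpha> * x v + (1 - \<alpha>) * x w)"
          unfolding sum_two_neighbours[OF ne] by simp
      qed
    next
      case 3
      have Em: "(y (m - 1), y m) \<in> E" using path_onD(2)[OF y, of "m - 1"] m by simp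
      show ?thesis
      proof (intro exI[of _ "{y (m - 1)}"] conjI)
        show "{y (m - 1)} \<subseteq> ?S" using qy[of "m - 1"] by simp
        show "{y (m - 1)} \<subseteq> E `` {v}" using Em 3 sy by auto
        have "x v = w 0 / w m" "x (y (m - 1)) = w 1 / w m"
          using 3 xy[of m] xy[of "m - 1"] m by simp_all
        moreover have "lam t * (w 0 / w m) = \<alpha> * (w 0 / w m) + (1 - \<alpha>) * (w 1 / w m)"
          using w(2) wm(2) by (simp add: field_simps)
        ultimately show "lam t * x v \<le> (\<Sum>w\<in>{y (m - 1)}. \<alpha> * x v + (1 - \<alpha>) * x w)" by simp
      qed
    qed
  qed (use L z x0 m imageI[of 0 "{0..m}" y] y0 in auto)
  then show ?thesis by (simp add: eta_eq_lam t_def)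
qed

text \<open>The prescribed neighbourhoods leave no further edges, so the vector of
  \<open>rad_ge_fork\<close> solves the equation exactly. Only at z L, where the ray is cut off,
  positive terms are missing; this is the strict inequality that
  \<open>rho_less_strict_supersolution\<close> asks for.\<close>

lemma fork_supersolution:
  assumes L: "1 \<le> L" and m: "1 \<le> m" and F: "fork_on E z L q y m"
    and nq: "E `` {q} = {z 0}" and nu: "E `` {z 0} = {q, y 1, z 1}"
    and ny: "\<And>j. 1 \<le> j \<Longrightarrow> j < m \<Longrightarrow> E `` {y j} = {y (j - 1), y (Suc j)}"
    and nym: "E `` {y m} = {y (m - 1)}"
    and nz: "\<And>i. 1 \<le> i \<Longrightarrow> i < L \<Longrightarrow> E `` {z i} = {z (i - 1), z (Suc i)}"
    and nzL: "E `` {z L} = {z (L - 1)}"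
  obtains X where "\<forall>v. X v > 0"
    "\<forall>v\<in>{q} \<union> y ` {0..m} \<union> z ` {0..L}. act E X v \<le> eta \<alpha> m * X v"
    "act E X (z L) < eta \<alpha> m * X (z L)"
proof -
  define t where "t = t_root m"
  have t: "1 \<le> t" by (simp add: t_def t_root_ge1)
  from F have z: "path_on E z L" and y: "path_on E y m" and y0: "y 0 = z 0"
    and dis: "y ` {1..m} \<inter> z ` {0..L} = {}" "q \<notin> y ` {0..m}" "q \<notin> z ` {0..L}"
    by (auto simp: fork_on_def)
  from pendant_entry[OF t] obtain c where c: "c > 0" "lam t * c = \<alpha> * c + (1 - \<alpha>)"
    "(1 - \<alpha>) * c = (1 - \<alpha>)\<^sup>2 / (lam t - \<alpha>)" .
  from chain_vector[OF m] obtain w where w: "\<And>k. w k > 0"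
    "\<alpha> * w 0 + (1 - \<alpha>) * w 1 = lam t * w 0"
    "\<And>k. 2 * \<alpha> * w (Suc k) + (1 - \<alpha>) * (w k + w (Suc (Suc k))) = lam t * w (Suc k)"
    "3 * \<alpha> * w m + (1 - \<alpha>) * w (m - 1) + (1 - \<alpha>) / t * w m + (1 - \<alpha>) * c * w m = lam t * w m"
    unfolding t_def[symmetric] c(3)[symmetric] by blast
  have wm: "w m > 0" "w m \<noteq> 0" using w(1)[of m] by simp_all
  define r where "r = 1 / t"
  have r: "0 < r" using t by (simp add: r_def)
  have lamr: "lam t = 2 * \<alpha> + (1 - \<alpha>) * (1 / r + r)" by (simp add: lam_def r_def)
  define X where "X = (\<lambda>v. if v = q then c else if v \<in> z ` {0..L} then r ^ the_inv_into {0..L} z v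
    else w (m - the_inv_into {0..m} y v) / w m)"
  have Xq: "X q = c" by (simp add: X_def)
  have Xz: "X (z i) = r ^ i" if "i \<le> L" for i
  proof -
    have "z i \<in> z ` {0..L}" using that by auto
    moreover from this have "z i \<noteq> q" using dis by auto
    ultimately show ?thesis using the_inv_into_f_f[OF path_onD(1)[OF z], of i] that by (simp add: X_def)
  qed
  have Xy: "X (y j) = w (m - j) / w m" if "j \<le> m" for j
  proof (cases "j = 0")
    case True
    then show ?thesis using Xz[of 0] y0 wm by simp
  next
    case False
    then have j: "y j \<in> y ` {1..m}" "y j \<in> y ` {0..m}" using that by auto
    have "y j \<notin> z ` {0..L}" "y j \<noteq> q" using j dis by auto
    then show ?thesis using the_inv_into_f_f[OF path_onD(1)[OF y], of j] that by (simp add: X_def)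
  qed
  have pos: "X v > 0" for v using c(1) r w(1) by (simp add: X_def)
  have aq: "act E X q = lam t * X q"
    using Xz[of 0] Xq c(2) by (simp add: act_def nq)
  have au: "act E X (z 0) = lam t * X (z 0)"
  proof -
    have "y 1 \<noteq> q" using dis m by auto
    moreover have "z 1 \<noteq> q" using dis L by auto
    moreover have "y 1 \<in> y ` {1..m}" "z 1 \<in> z ` {0..L}" using m L by auto
    then have "y 1 \<noteq> z 1" using dis(1) by (metis disjoint_iff)
    moreover have "lam t = 3 * \<alpha> + (1 - \<alpha>) * (w (m - 1) / w m) + (1 - \<alpha>) / t + (1 - \<alpha>) * c"
      using w(4) wm(2) by (simp add: field_simps)
    ultimately show ?thesis
      using Xz[of 0] Xz[of 1] Xy[of 1] Xq m L by (simp add: act_def nu r_def)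
  qed
  have ay: "act E X (y j) = lam t * X (y j)" if j: "1 \<le> j" "j < m" for j
  proof -
    have ne: "y (j - 1) \<noteq> y (Suc j)" using path_onD(3)[OF y, of "j - 1" "Suc j"] j by auto
    define k where "k = m - Suc j"
    have k: "m - j = Suc k" "m - (j - 1) = Suc (Suc k)" "m - Suc j = k"
      using j by (auto simp: k_def)
    have "X (y j) = w (Suc k) / w m" "X (y (j - 1)) = w (Suc (Suc k)) / w m" "X (y (Suc j)) = w k / w m"
      using j Xy[of j] Xy[of "j - 1"] Xy[of "Suc j"] k by simp_all
    moreover have "lam t * (w (Suc k) / w m)
        = 2 * \<alpha> * (w (Suc k) / w m) + (1 - \<alpha>) * (w k / w m + w (Suc (Suc k)) / w m)"
      using w(3)[of k] wm(2) by (simp add: field_simps)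
    ultimately show ?thesis
      unfolding act_def ny[OF j] sum_two_neighbours[OF ne] by simp
  qed
  have aym: "act E X (y m) = lam t * X (y m)"
  proof -
    have "X (y m) = w 0 / w m" "X (y (m - 1)) = w 1 / w m"
      using Xy[of m] Xy[of "m - 1"] m by simp_all
    moreover have "lam t * (w 0 / w m) = \<alpha> * (w 0 / w m) + (1 - \<alpha>) * (w 1 / w m)"
      using w(2) wm(2) by (simp add: field_simps)
    ultimately show ?thesis by (simp add: act_def nym)
  qed
  have az: "act E X (z i) = lam t * X (z i)" if i: "1 \<le> i" "i < L" for i
  proof -
    have ne: "z (i - 1) \<noteq> z (Suc i)" using path_onD(3)[OF z, of "i - 1" "Suc i"] i by auto
    have ri: "r ^ i = r * r ^ (i - 1)" using i(1) by (cases i) auto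
    have "lam t * r ^ i = 2 * \<alpha> * r ^ i + (1 - \<alpha>) * (r ^ (i - 1) + r ^ Suc i)"
      unfolding lamr power_Suc ri using r by (simp add: field_simps)
    then show ?thesis
      using ne i Xz[of "i - 1"] Xz[of i] Xz[of "Suc i"] by (simp add: act_def nz[OF i] algebra_simps)
  qed
  have azL: "act E X (z L) < lam t * X (z L)"
  proof -
    have ri: "r ^ L = r * r ^ (L - 1)" using L by (cases L) auto
    have "lam t * r ^ L - (\<alpha> * r ^ L + (1 - \<alpha>) * r ^ (L - 1)) = (\<alpha> + (1 - \<alpha>) * r) * r ^ L"
      unfolding lamr ri using r by (simp add: field_simps)
    also have "\<dots> > 0" using r alpha_ge0 alpha_lt1 by (intro mult_pos_pos add_nonneg_pos) auto
    finally show ?thesis using Xz[of L] Xz[of "L - 1"] by (simp add: act_def nzL)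
  qed
  have "act E X v \<le> lam t * X v" if v: "v \<in> {q} \<union> y ` {0..m} \<union> z ` {0..L}" for v
  proof -
    consider "v = q" | j where "v = y j" "j \<le> m" | i where "v = z i" "i \<le> L" using v by auto
    then show ?thesis
    proof cases
      case 2
      then consider "j = 0" | "1 \<le> j" "j < m" | "j = m" by linarith
      then show ?thesis using 2 au y0 ay aym by cases auto
    next
      case 3
      then consider "i = 0" | "1 \<le> i" "i < L" | "i = L" by linarith
      then show ?thesis using 3 au az azL by cases auto
    qed (use aq in simp)
  qed
  then show thesis using that[of X] pos azL unfolding eta_eq_lam t_def by blast
qed

end

section \<open>Graphs with a long path and small spectral radius\<close>

lemma notin_image_upto: "(\<And>i. i \<le> r \<Longrightarrow> w \<noteq> z i) \<Longrightarrow> w \<notin> z ` {0..r}"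
  for r :: nat
  by fastforce

lemma path_on_shift: "path_on E p D \<Longrightarrow> i + K \<le> D \<Longrightarrow> path_on E (\<lambda>k. p (i + k)) K"
  using path_onD(2,3)[of E p D] by (force simp: path_on_def[of _ "\<lambda>k. p (i + k)"] intro!: inj_onI)

lemma path_on_reverse:
  assumes E: "ugraph E" and p: "path_on E p D" and i: "i \<le> D" "K \<le> i"
  shows "path_on E (\<lambda>k. p (i - k)) K"
  unfolding path_on_def
proof (intro conjI allI impI)
  show "inj_on (\<lambda>k. p (i - k)) {0..K}"
    by (rule inj_onI) (use path_onD(3)[OF p] i in \<open>auto simp: eq_diff_iff\<close>)
  fix k assume "k < K"
  then have "(p (i - Suc k), p (Suc (i - Suc k))) \<in> E" "Suc (i - Suc k) = i - k"
    using path_onD(2)[OF p, of "i - Suc k"] i by auto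
  then show "(p (i - k), p (i - Suc k)) \<in> E" using ugraphD(2)[OF E] by simp
qed

definition stretch_on :: "('v \<times> 'v) set \<Rightarrow> (nat \<Rightarrow> 'v) \<Rightarrow> nat \<Rightarrow> bool" where
  "stretch_on E y m \<longleftrightarrow> 1 \<le> m \<and> inj_on y {0..m} \<and> (y 0, y 1) \<in> E \<and>
     (\<forall>j. 1 \<le> j \<longrightarrow> j < m \<longrightarrow> E `` {y j} = {y (j - 1), y (Suc j)})"

lemma stretch_onD:
  assumes "stretch_on E y m"
  shows "1 \<le> m" "(y 0, y 1) \<in> E" "\<And>j. 1 \<le> j \<Longrightarrow> j < m \<Longrightarrow> E `` {y j} = {y (j - 1), y (Suc j)}"
    "path_on E y m" "\<And>i j. i \<le> m \<Longrightarrow> j \<le> m \<Longrightarrow> y i = y j \<longleftrightarrow> i = j"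
proof -
  show *: "1 \<le> m" "(y 0, y 1) \<in> E" "\<And>j. 1 \<le> j \<Longrightarrow> j < m \<Longrightarrow> E `` {y j} = {y (j - 1), y (Suc j)}"
    using assms by (auto simp: stretch_on_def)
  have "(y j, y (Suc j)) \<in> E" if "j < m" for j
    using that *(2) *(3)[of j] by (cases j) auto
  then show "path_on E y m" using assms by (auto simp: stretch_on_def path_on_def)
  then show "\<And>i j. i \<le> m \<Longrightarrow> j \<le> m \<Longrightarrow> y i = y j \<longleftrightarrow> i = j" by (rule path_onD(3))
qed

lemma stretch_on_extend:
  assumes y: "stretch_on E y m" and w: "E `` {y m} = {y (m - 1), w}" "w \<notin> y ` {0..m}"
  shows "stretch_on E (y(Suc m := w)) (Suc m)"
  unfolding stretch_on_def
proof (intro conjI allI impI)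
  show "inj_on (y(Suc m := w)) {0..Suc m}"
    using y w(2) by (auto simp: stretch_on_def inj_on_def le_Suc_eq)
  show "((y(Suc m := w)) 0, (y(Suc m := w)) 1) \<in> E" using stretch_onD(1,2)[OF y] by auto
  fix j assume "1 \<le> j" "j < Suc m"
  then show "E `` {(y(Suc m := w)) j} = {(y(Suc m := w)) (j - 1), (y(Suc m := w)) (Suc j)}"
    using stretch_onD(3)[OF y, of j] w(1) by (cases "j = m") auto
qed simp

text \<open>The length is bounded by the number of vertices, so a longest extension exists. It stops
  where the degree is not two or where the next neighbour is already on the stretch.\<close>

lemma maximal_stretch:
  assumes E: "ugraph E" and y: "stretch_on E y m"
  obtains y' m' where "m \<le> m'" "stretch_on E y' m'" "y' 0 = y 0" "y' 1 = y 1"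
    "\<forall>w. E `` {y' m'} = {y' (m' - 1), w} \<longrightarrow> w \<in> y' ` {0..m'}"
proof -
  define P where "P = (\<lambda>k. \<exists>y'. m \<le> k \<and> stretch_on E y' k \<and> y' 0 = y 0 \<and> y' 1 = y 1)"
  have "P m" using y by (auto simp: P_def)
  moreover have "k \<le> card (Field E)" if "P k" for k
  proof -
    from that obtain y' where y': "stretch_on E y' k" by (auto simp: P_def)
    note p = stretch_onD(4)[OF y']
    have "y' ` {0..k} \<subseteq> Field E"
    proof clarify
      fix j assume "j \<in> {0..k}"
      then show "y' j \<in> Field E"
        using path_onD(2)[OF p, of j] path_onD(2)[OF p, of "j - 1"] stretch_onD(1)[OF y']
        by (cases "j = k") (auto intro: FieldI1, metis FieldI2 One_nat_def Suc_pred diff_less less_le_trans zero_less_Suc)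
    qed
    from card_mono[OF ugraphD(4)[OF E] this] show ?thesis
      by (simp add: card_image[OF path_onD(1)[OF p]])
  qed
  ultimately obtain k where k: "P k" "\<And>j. P j \<Longrightarrow> j \<le> k"
    using GreatestI_nat[of P m "card (Field E)"] Greatest_le_nat[of P _ "card (Field E)"] by blast
  then obtain y' where y': "m \<le> k" "stretch_on E y' k" "y' 0 = y 0" "y' 1 = y 1"
    by (auto simp: P_def)
  have "w \<in> y' ` {0..k}" if "E `` {y' k} = {y' (k - 1), w}" for w
  proof (rule ccontr)
    assume "w \<notin> y' ` {0..k}"
    from stretch_on_extend[OF y'(2) that this] have "P (Suc k)"
      using y' stretch_onD(1)[OF y'(2)] by (auto simp: P_def intro!: exI[of _ "y'(Suc k := w)"])
    then show False using k(2) by fastforce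
  qed
  then show thesis using that y' by blast
qed

text \<open>Inner vertices of a stretch are saturated, so its last vertex can only be adjacent to the first one.\<close>

lemma stretch_on_back_edge:
  assumes E: "ugraph E" and y: "stretch_on E y m"
    and w: "(y m, y j) \<in> E" "j \<le> m" "j \<noteq> m - 1"
  shows "j = 0"
proof (rule ccontr)
  assume "j \<noteq> 0"
  moreover have "j \<noteq> m" using w(1) ugraphD(3)[OF E] by auto
  ultimately have j: "1 \<le> j" "j < m" using w(2) by auto
  have "y m \<in> E `` {y j}" using w(1) ugraphD(2)[OF E] by auto
  then have "y m = y (j - 1) \<or> y m = y (Suc j)" using stretch_onD(3)[OF y j] by auto
  then show False using stretch_onD(5)[OF y, of m "j - 1"] stretch_onD(5)[OF y, of m "Suc j"] j w(3) by auto
qed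

context aspec
begin

text \<open>A threshold that tends to Psi. Below it, \<open>rad_ge_fork\<close> excludes forks with
  two arms of length L, and \<open>cutoff_less\<close> makes room to exclude every configuration
  that forces Psi up to 2 / (L + 1).\<close>

definition cutoff :: "nat \<Rightarrow> real" where
  "cutoff L = eta \<alpha> L - 2 / (real L + 1)"

lemma cutoff_less: "cutoff L < lam t_lim - 2 / (real L + 1)"
  using eta_less_lam_t_lim[of L] by (simp add: cutoff_def)

lemma rad_ge_path:
  assumes E: "ugraph E" and L: "1 \<le> L" and z: "path_on E z L"
  shows "2 - 2 / (real L + 1) \<le> rad E"
proof -
  have "lam 1 - 2 / (real L + 1) \<le> rad E"
    by (rule rad_ge_path_extension[where S = "{z 0}" and u = "z 0" and z = z and x = "\<lambda>_. 1" and N = "\<lambda>_. {}"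
          and d = 1, OF E])
      (use L path_onD[OF z] in \<open>auto simp: lam_def\<close>)
  then show ?thesis by (simp add: lam_def)
qed

text \<open>A further neighbour w outside the window i - L, ..., i + L yields a fork with two arms
  of length L. If w is in the window, the half of the path away from w serves as the ray, and w and
  the path neighbour on the side of w both continue along the path.\<close>

lemma middle_degree_two:
  assumes E: "ugraph E" and L: "1 \<le> L" and p: "path_on E p D" and small: "rad E < cutoff L"
    and i: "L + 1 \<le> i" "i + L + 1 \<le> D"
  shows "E `` {p i} = {p (i - 1), p (Suc i)}"
proof (rule antisym)
  note sy = ugraphD(2)[OF E] and ir = ugraphD(3)[OF E] and pe = path_onD(2)[OF p] and pi = path_onD(3)[OF p]
  show "{p (i - 1), p (Suc i)} \<subseteq> E `` {p i}"
    using pe[of "i - 1"] pe[of i] i sy by auto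
  let ?f = "\<lambda>k. p (i + k)"
  let ?b = "\<lambda>k. p (i - k)"
  have f: "path_on E ?f L" by (rule path_on_shift[OF p]) (use i in auto)
  have b: "path_on E ?b L" by (rule path_on_reverse[OF E p]) (use i in auto)
  have big: False if "lam t_lim - 2 / (real L + 1) \<le> rad E"
    using that small cutoff_less[of L] by simp
  show "E `` {p i} \<subseteq> {p (i - 1), p (Suc i)}"
  proof (rule ccontr)
    assume "\<not> ?thesis"
    then obtain w where w: "(p i, w) \<in> E" "w \<noteq> p (i - 1)" "w \<noteq> p (Suc i)" by auto
    show False
    proof (cases "w \<in> p ` {i - L..i + L}")
      case False
      have "fork_on E ?f L w ?b L"
        unfolding fork_on_def
      proof (intro conjI f b)
        show "?b ` {1..L} \<inter> ?f ` {0..L} = {}"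
        proof (rule ccontr)
          assume "\<not> ?thesis"
          then obtain k l where "p (i - k) = p (i + l)" "1 \<le> k" "k \<le> L" "l \<le> L" by auto
          then show False using pi[of "i - k" "i + l"] i by simp
        qed
        have wne: "w \<noteq> p k" if "i - L \<le> k" "k \<le> i + L" for k using False that by auto
        show "w \<notin> ?b ` {0..L}"
        proof
          assume "w \<in> ?b ` {0..L}"
          then obtain k where "k \<le> L" "w = p (i - k)" by auto
          then show False using wne[of "i - k"] by simp
        qed
        show "w \<notin> ?f ` {0..L}" by (rule notin_image_upto, rule wne) auto
      qed (use w in auto)
      from rad_ge_fork[OF E L L this] show False using small by (simp add: cutoff_def)
    next
      case True
      then obtain j where j: "w = p j" "i - L \<le> j" "j \<le> i + L" by auto
      have ji: "j \<noteq> i" "j \<noteq> i - 1" "j \<noteq> Suc i" using w j(1) ir by auto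
      show False
      proof (cases "j < i")
        case True
        have nf: "p k \<notin> ?f ` {0..L}" if "k < i" for k
        proof (rule notin_image_upto)
          fix l assume "l \<le> L"
          then show "p k \<noteq> p (i + l)" using that pi[of k "i + l"] i by simp
        qed
        \<comment> \<open>As p j may be the first vertex of the window, its predecessor needs the
          margin L + 1.\<close>
        have e: "(p (i - 1), p (i - 2)) \<in> E" "(p j, p (j - 1)) \<in> E" "(p i, p (i - 1)) \<in> E"
          using pe[of "i - 2"] pe[of "j - 1"] pe[of "i - 1"] i j True sy
          by (simp_all add: numeral_2_eq_2 Suc_diff_Suc)
        show False
        proof (rule big, rule rad_ge_two_long_branches[OF E L f])
          show "(?f 0, p (i - 1)) \<in> E" "(p (i - 1), p (i - 2)) \<in> E" using e by simp_all
          show "(?f 0, p j) \<in> E" "(p j, p (j - 1)) \<in> E" using e w(1) j(1) by simp_all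
          show "p (i - 1) \<noteq> p j" using pi[of "i - 1" j] i ji True by simp
        qed (use nf i j True in simp_all)
      next
        case False
        then have j2: "Suc (Suc i) \<le> j" using ji by simp
        have nb: "p k \<notin> ?b ` {0..L}" if "i < k" "k \<le> D" for k
        proof
          assume "p k \<in> ?b ` {0..L}"
          then obtain l where "p k = p (i - l)" by auto
          then show False using that pi[of k "i - l"] i by simp
        qed
        have e: "(p (Suc i), p (Suc (Suc i))) \<in> E" "(p j, p (Suc j)) \<in> E" "(p i, p (Suc i)) \<in> E"
          using pe[of "Suc i"] pe[of j] pe[of i] i j L by simp_all
        show False
        proof (rule big, rule rad_ge_two_long_branches[OF E L b])
          show "(?b 0, p (Suc i)) \<in> E" "(p (Suc i), p (Suc (Suc i))) \<in> E" using e by simp_all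
          show "(?b 0, p j) \<in> E" "(p j, p (Suc j)) \<in> E" using e w(1) j(1) by simp_all
          show "p (Suc i) \<noteq> p j" using pi[of "Suc i" j] i j j2 by simp
          show "p (Suc i) \<notin> ?b ` {0..L}" "p (Suc (Suc i)) \<notin> ?b ` {0..L}"
            "p j \<notin> ?b ` {0..L}" "p (Suc j) \<notin> ?b ` {0..L}"
            by (rule nb; use i j L j2 in simp)+
        qed
      qed
    qed
  qed
qed

text \<open>The branch through P is followed to its end. It can neither return nor branch again
  (\<open>rad_ge_second_branching\<close>), so it ends in a leaf. By connectedness the graph is then
  exactly a fork, which is bounded from both sides.\<close>

lemma classify_pendant_branch:
  assumes E: "ugraph E" "connected_graph E" and L: "1 \<le> L" and small: "rad E < cutoff L"
    and z: "stretch_on E z r" "E `` {z 0} = {z 1}" "L \<le> r"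
    and u: "E `` {z r} = {z (r - 1), P, Q}" "P \<noteq> Q" "P \<notin> z ` {0..r}" "Q \<notin> z ` {0..r}"
    and Q: "E `` {Q} = {z r}"
  shows "\<exists>m<L. eta \<alpha> m - 2 / (real L + 1) \<le> rad E \<and> rad E \<le> eta \<alpha> m"
proof -
  note sy = ugraphD(2)[OF E(1)] and ir = ugraphD(3)[OF E(1)]
  note zi = stretch_onD(5)[OF z(1)]
  have r1: "1 \<le> r" using L z(3) by simp
  have big: False if "lam t_lim - 2 / (real L + 1) \<le> rad E"
    using that small cutoff_less[of L] by simp
  let ?t = "\<lambda>k. z (r - k)"
  have tail: "path_on E ?t k" if "k \<le> r" for k
    by (rule path_on_reverse[OF E(1) stretch_onD(4)[OF z(1)]]) (use that in auto)
  \<comment> \<open>No arc leaves the pendant path before its last vertex z r.\<close>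
  have sat: "w \<in> z ` {0..r}" if "(z i, w) \<in> E" "i < r" for i w
  proof (cases "i = 0")
    case True
    then have "w = z 1" using that z(2) by auto
    then show ?thesis using r1 by auto
  next
    case False
    then have "w = z (i - 1) \<or> w = z (Suc i)" using stretch_onD(3)[OF z(1), of i] that by auto
    then show ?thesis using that(2) by auto
  qed
  define y0 where "y0 = (\<lambda>j::nat. if j = 0 then z r else P)"
  have "stretch_on E y0 1"
    using u by (auto simp: stretch_on_def inj_on_def y0_def)
  from maximal_stretch[OF E(1) this] obtain y m where y': "stretch_on E y m" "y 0 = y0 0" "y 1 = y0 1"
    and ymax: "\<forall>w. E `` {y m} = {y (m - 1), w} \<longrightarrow> w \<in> y ` {0..m}" .
  have y: "stretch_on E y m" "y 0 = z r" "y 1 = P" using y' by (simp_all add: y0_def)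
  note yi = stretch_onD(5)[OF y(1)] and m1 = stretch_onD(1)[OF y(1)]
  have yz: "y j \<notin> z ` {0..r} \<and> y j \<noteq> Q" if "1 \<le> j" "j \<le> m" for j
    using that
  proof (induction j rule: dec_induct)
    case base
    then show ?case using y(3) u by simp
  next
    case (step j)
    then have j: "1 \<le> j" "j < m" by auto
    have e: "(y j, y (Suc j)) \<in> E" "(y (Suc j), y j) \<in> E"
      using path_onD(2)[OF stretch_onD(4)[OF y(1)] j(2)] sy by auto
    have IH: "y j \<notin> z ` {0..r}" "y j \<noteq> Q" using step by auto
    have "y (Suc j) \<noteq> z i" if i: "i \<le> r" for i
    proof (cases "i = r")
      case True
      then show ?thesis using yi[of "Suc j" 0] y(2) j by auto
    next
      case False
      then show ?thesis using sat[of i "y j"] e IH i by auto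
    qed
    then have "y (Suc j) \<notin> z ` {0..r}" by (rule notin_image_upto)
    moreover have "y (Suc j) \<noteq> Q"
    proof
      assume "y (Suc j) = Q"
      then have "y j = z r" using e Q by auto
      then show False using IH by auto
    qed
    ultimately show ?case by auto
  qed
  have dis: "y ` {1..m} \<inter> z ` {0..r} = {}" "Q \<notin> y ` {0..m}"
  proof -
    show "y ` {1..m} \<inter> z ` {0..r} = {}" using yz by fastforce
    have "Q \<noteq> y j" if "j \<le> m" for j
      using that yz[of j] y(2) u(4) by (cases "j = 0") auto
    then show "Q \<notin> y ` {0..m}" by (rule notin_image_upto)
  qed
  have tz: "?t ` {0..k} \<subseteq> z ` {0..r}" for k by auto
  have fork: "fork_on E ?t k Q y m" if "k \<le> r" for k
    unfolding fork_on_def using tail[OF that] stretch_onD(4)[OF y(1)] y(2) u dis tz[of k] by auto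
  have prev: "(y m, y (m - 1)) \<in> E"
    using path_onD(2)[OF stretch_onD(4)[OF y(1)], of "m - 1"] m1 sy by auto
  define B where "B = E `` {y m} - {y (m - 1)}"
  have By: "w \<notin> y ` {0..m}" if "w \<in> B" for w
  proof
    assume "w \<in> y ` {0..m}"
    then obtain j where j: "w = y j" "j \<le> m" by auto
    have wE: "(y m, y j) \<in> E" "j \<noteq> m - 1" using that j by (auto simp: B_def)
    then have "j = 0" using stretch_on_back_edge[OF E(1) y(1)] j(2) by blast
    then have "(z r, y m) \<in> E" "m \<noteq> 1" using wE sy y(2) by auto
    then have "y m \<in> {z (r - 1), P, Q}" using u(1) by blast
    moreover have "y m \<noteq> z (r - 1)" "y m \<noteq> Q" using yz[of m] m1 by auto
    moreover have "y m \<noteq> P" using yi[of m 1] m1 y(3) \<open>m \<noteq> 1\<close> by simp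
    ultimately show False by simp
  qed
  have Bz: "w \<notin> z ` {0..r} \<and> w \<noteq> Q" if "w \<in> B" for w
  proof -
    have e: "(y m, w) \<in> E" "(w, y m) \<in> E" using that sy by (auto simp: B_def)
    have "w \<noteq> z i" if i: "i \<le> r" for i
    proof (cases "i = r")
      case True
      then show ?thesis using By[OF \<open>w \<in> B\<close>] y(2) by force
    next
      case False
      then show ?thesis using sat[of i "y m"] e yz[of m] m1 i by auto
    qed
    then have "w \<notin> z ` {0..r}" by (rule notin_image_upto)
    moreover have "w \<noteq> Q" using e Q yz[of m] m1 by force
    ultimately show ?thesis by auto
  qed
  \<comment> \<open>One further neighbour would prolong the maximal stretch; two would form a second
    branching.\<close>
  have "B = {}"
  proof (rule ccontr)
    assume "B \<noteq> {}"
    then obtain s1 where s1: "s1 \<in> B" by auto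
    have "B \<noteq> {s1}"
    proof
      assume "B = {s1}"
      then have "E `` {y m} = {y (m - 1), s1}" using prev by (auto simp: B_def)
      from ymax[rule_format, OF this] By[OF s1] show False by simp
    qed
    then obtain s2 where s2: "s2 \<in> B" "s1 \<noteq> s2" using s1 by auto
    show False
    proof (rule big, rule rad_ge_second_branching[OF E(1) L m1 fork[OF z(3)]])
      show "(y m, s1) \<in> E" "(y m, s2) \<in> E" using s1 s2 by (auto simp: B_def)
      show "s1 \<notin> ?t ` {0..L}" "s2 \<notin> ?t ` {0..L}" using Bz s1 s2(1) tz[of L] by blast+
    qed (use s1 s2 By Bz in auto)
  qed
  then have yend: "E `` {y m} = {y (m - 1)}" using prev by (auto simp: B_def)
  have nz: "E `` {?t i} = {?t (i - 1), ?t (Suc i)}" if "1 \<le> i" "i < r" for i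
    using stretch_onD(3)[OF z(1), of "r - i"] that
    by (auto simp: Suc_diff_le)
  have nq: "E `` {Q} = {?t 0}" using Q by simp
  have nu: "E `` {?t 0} = {Q, y 1, ?t 1}" using u(1) y(3) by auto
  have nzr: "E `` {?t r} = {?t (r - 1)}" using z(2) r1 by simp
  from fork_supersolution[OF r1 m1 fork[OF order_refl] nq nu stretch_onD(3)[OF y(1)] yend nz nzr]
  obtain X where X: "\<forall>v. X v > 0"
    "\<forall>v\<in>{Q} \<union> y ` {0..m} \<union> ?t ` {0..r}. act E X v \<le> eta \<alpha> m * X v"
    "act E X (?t r) < eta \<alpha> m * X (?t r)" .
  have tr: "?t ` {0..r} = z ` {0..r}"
  proof
    show "z ` {0..r} \<subseteq> ?t ` {0..r}"
    proof clarify
      fix k assume "k \<in> {0..r}"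
      then have "z k = ?t (r - k)" "r - k \<in> {0..r}" by auto
      then show "z k \<in> ?t ` {0..r}" by blast
    qed
  qed auto
  have fld: "Field E \<subseteq> {Q} \<union> y ` {0..m} \<union> ?t ` {0..r}"
  proof (rule connected_graphD[OF E(2)])
    show "Q \<in> {Q} \<union> y ` {0..m} \<union> ?t ` {0..r}" by simp
    show "Q \<in> Field E" using Q by (auto simp: Field_def)
    fix a b assume ab: "(a, b) \<in> E" "a \<in> {Q} \<union> y ` {0..m} \<union> ?t ` {0..r}"
    have yin: "y j \<in> y ` {0..m}" if "j \<le> m" for j using that by auto
    have zin: "z i \<in> z ` {0..r}" if "i \<le> r" for i using that by auto
    consider "a = Q" | j where "a = y j" "1 \<le> j" "j \<le> m" | i where "a = z i" "i \<le> r"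
    proof -
      have "a = Q \<or> (\<exists>j. a = y j \<and> 1 \<le> j \<and> j \<le> m) \<or> (\<exists>i. a = z i \<and> i \<le> r)"
      proof (rule ccontr)
        assume n: "\<not> ?thesis"
        then obtain j where j: "a = y j" "j \<le> m" using ab(2) unfolding tr by auto
        then have "j = 0" using n by (cases j) auto
        then show False using n j y(2) by auto
      qed
      then show ?thesis using that by blast
    qed
    then have "b \<in> {Q} \<union> y ` {0..m} \<union> z ` {0..r}"
    proof cases
      case 1
      then have "b = z r" using ab Q by auto
      then show ?thesis using zin[of r] by simp
    next
      case 2
      then have "b = y (j - 1) \<or> (j < m \<and> b = y (Suc j))"
        using ab(1) yend stretch_onD(3)[OF y(1), of j] by (cases "j = m") auto
      then show ?thesis using yin[of "j - 1"] yin[of "Suc j"] 2 by auto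
    next
      case 3
      show ?thesis
      proof (cases "i = r")
        case True
        then have "b = z (r - 1) \<or> b = y 1 \<or> b = Q" using ab(1) 3 u(1) y(3) by auto
        then show ?thesis using zin[of "r - 1"] yin[of 1] m1 by auto
      next
        case False
        then show ?thesis using sat[of i b] ab(1) 3 by auto
      qed
    qed
    then show "b \<in> {Q} \<union> y ` {0..m} \<union> ?t ` {0..r}" unfolding tr .
  qed
  have e0: "eta \<alpha> m \<ge> 0" using eta_mono[of 0 m] eta_0 by simp
  have up: "rad E \<le> eta \<alpha> m"
    by (rule rad_le_supersolution[OF E(1) e0, of X]) (use X fld in auto)
  have low: "eta \<alpha> m - 2 / (real L + 1) \<le> rad E" by (rule rad_ge_fork[OF E(1) L m1 fork[OF z(3)]])
  \<comment> \<open>An arm of length at least L would lift the radius to the cutoff.\<close>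
  have "m < L"
  proof (rule ccontr)
    assume "\<not> m < L"
    then have "eta \<alpha> L \<le> eta \<alpha> m" by (intro eta_mono) simp
    then show False using low small by (simp add: cutoff_def)
  qed
  then show ?thesis using up low by auto
qed

text \<open>The number of further neighbours where the longest stretch stops decides. None leaves a
  path, hence \<open>eta 0\<close>; one contradicts maximality; two give a fork when one of them is
  pendant, and two continuing branches otherwise. The latter, like three further neighbours,
  contradicts the cutoff.\<close>

lemma classify_pendant_path:
  assumes E: "ugraph E" "connected_graph E" and L: "1 \<le> L" and small: "rad E < cutoff L"
    and z0: "stretch_on E z0 r0" "E `` {z0 0} = {z0 1}" "L \<le> r0"
  shows "\<exists>m<L. eta \<alpha> m - 2 / (real L + 1) \<le> rad E \<and> rad E \<le> eta \<alpha> m"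
proof -
  note sy = ugraphD(2)[OF E(1)] and ir = ugraphD(3)[OF E(1)]
  have big: False if "lam t_lim - 2 / (real L + 1) \<le> rad E"
    using that small cutoff_less[of L] by simp
  from maximal_stretch[OF E(1) z0(1)] obtain z r where z: "r0 \<le> r" "stretch_on E z r" "z 0 = z0 0" "z 1 = z0 1"
    and zmax: "\<forall>w. E `` {z r} = {z (r - 1), w} \<longrightarrow> w \<in> z ` {0..r}" .
  have zend: "E `` {z 0} = {z 1}" using z z0(2) by simp
  have Lr: "L \<le> r" using z(1) z0(3) by simp
  note zi = stretch_onD(5)[OF z(2)]
  have r1: "1 \<le> r" using L Lr by simp
  let ?t = "\<lambda>k. z (r - k)"
  have tail: "path_on E ?t L"
    by (rule path_on_reverse[OF E(1) stretch_onD(4)[OF z(2)]]) (use Lr in auto)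
  have tz: "?t ` {0..L} \<subseteq> z ` {0..r}" by auto
  have zin: "z i \<in> z ` {0..r}" if "i \<le> r" for i using that by auto
  have sat: "w \<in> z ` {0..r}" if "(z i, w) \<in> E" "i < r" for i w
  proof (cases "i = 0")
    case True
    then have "w = z 1" using that zend by auto
    then show ?thesis using r1 by auto
  next
    case False
    then have "w = z (i - 1) \<or> w = z (Suc i)" using stretch_onD(3)[OF z(2), of i] that by auto
    then show ?thesis using that(2) by auto
  qed
  have prev: "(z r, z (r - 1)) \<in> E"
    using path_onD(2)[OF stretch_onD(4)[OF z(2)], of "r - 1"] r1 sy by auto
  define B where "B = E `` {z r} - {z (r - 1)}"
  have finB: "finite B" using ugraphD(5)[OF E(1)] by (simp add: B_def)
  have Bz: "w \<notin> z ` {0..r}" if "w \<in> B" for w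
  proof
    assume "w \<in> z ` {0..r}"
    then obtain j where j: "w = z j" "j \<le> r" by auto
    have wE: "(z r, z j) \<in> E" "j \<noteq> r - 1" using that j by (auto simp: B_def)
    then have "j = 0" using stretch_on_back_edge[OF E(1) z(2)] j(2) by blast
    \<comment> \<open>The only neighbour of z 0 is z 1, so an arc back to z 0 forces r = 1, where z
      0 is just the predecessor of z r.\<close>
    then have "z r = z 1" using wE sy zend by blast
    then have "r = 1" using zi[of r 1] r1 by simp
    then show False using wE(2) \<open>j = 0\<close> by simp
  qed
  consider "B = {}" | w where "B = {w}" | "card B = 2" | "3 \<le> card B"
  proof -
    have "card B = 0 \<or> card B = 1 \<or> card B = 2 \<or> 3 \<le> card B" by linarith
    then show ?thesis using that finB by (auto simp: card_1_singleton_iff)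
  qed
  then show ?thesis
  proof cases
    case 1
    then have rend: "E `` {z r} = {z (r - 1)}" using prev by (auto simp: B_def)
    have fld: "Field E \<subseteq> z ` {0..r}"
    proof (rule connected_graphD[OF E(2)])
      show "z 0 \<in> z ` {0..r}" by simp
      show "z 0 \<in> Field E" using zend by (auto simp: Field_def)
      fix a b assume ab: "(a, b) \<in> E" "a \<in> z ` {0..r}"
      then obtain i where i: "a = z i" "i \<le> r" by auto
      show "b \<in> z ` {0..r}"
      proof (cases "i = r")
        case True
        then have "b = z (r - 1)" using ab(1) i rend by auto
        then show ?thesis using zin[of "r - 1"] by simp
      next
        case False
        then show ?thesis using sat[of i b] ab(1) i by auto
      qed
    qed
    have "rad E \<le> 2"
    proof (rule rad_le_supersolution[OF E(1), of 2 "\<lambda>_. 1"])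
      fix v assume "v \<in> Field E"
      then obtain i where i: "v = z i" "i \<le> r" using fld by auto
      have "card (E `` {v}) \<le> 2"
      proof -
        consider "i = 0" | "i = r" | "1 \<le> i" "i < r" using i by linarith
        then show ?thesis
        proof cases
          case 3
          then have "E `` {v} = {z (i - 1), z (Suc i)}" using stretch_onD(3)[OF z(2)] i by simp
          then show ?thesis by (simp add: card_insert_if)
        qed (use i zend rend in auto)
      qed
      then show "act E (\<lambda>_. 1) v \<le> 2 * 1" by (simp add: act_def)
    qed simp_all
    moreover have "2 - 2 / (real L + 1) \<le> rad E" by (rule rad_ge_path[OF E(1) L tail])
    ultimately show ?thesis using L eta_0 by (intro exI[of _ 0]) auto
  next
    case 2
    then have "E `` {z r} = {z (r - 1), w}" using prev by (auto simp: B_def)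
    from zmax[rule_format, OF this] Bz[of w] 2 show ?thesis by simp
  next
    case 3
    then obtain P Q where PQ: "B = {P, Q}" "P \<noteq> Q" by (auto simp: card_2_iff)
    have u: "E `` {z r} = {z (r - 1), P, Q}" using prev PQ(1) by (auto simp: B_def)
    have PQz: "P \<notin> z ` {0..r}" "Q \<notin> z ` {0..r}" using Bz PQ by auto
    have PQe: "(z r, P) \<in> E" "(z r, Q) \<in> E" using u by auto
    show ?thesis
    proof (cases "E `` {P} = {z r} \<or> E `` {Q} = {z r}")
      case True
      then show ?thesis
      proof
        assume "E `` {Q} = {z r}"
        then show ?thesis
          using classify_pendant_branch[OF E L small z(2) zend Lr u PQ(2) PQz] by simp
      next
        assume P: "E `` {P} = {z r}"
        have u': "E `` {z r} = {z (r - 1), Q, P}" using u by auto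
        show ?thesis
          using classify_pendant_branch[OF E L small z(2) zend Lr u' PQ(2)[symmetric] PQz(2,1) P] .
      qed
    next
      case False
      have other: "\<exists>S'. (S, S') \<in> E \<and> S' \<notin> z ` {0..r}"
        if S: "(z r, S) \<in> E" "E `` {S} \<noteq> {z r}" "S \<notin> z ` {0..r}" for S
      proof -
        have "(S, z r) \<in> E" using S(1) sy by simp
        then obtain S' where S': "(S, S') \<in> E" "S' \<noteq> z r" using S(2) by blast
        have "S' \<noteq> z i" if "i \<le> r" for i
          using that S' sat[of i S] sy[of S S'] S(3) by (cases "i = r") auto
        then have "S' \<notin> z ` {0..r}" by (rule notin_image_upto)
        then show ?thesis using S'(1) by auto
      qed
      from other[OF PQe(1) _ PQz(1)] False obtain P' where P': "(P, P') \<in> E" "P' \<notin> z ` {0..r}" by auto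
      from other[OF PQe(2) _ PQz(2)] False obtain Q' where Q': "(Q, Q') \<in> E" "Q' \<notin> z ` {0..r}" by auto
      have False
        by (rule big, rule rad_ge_two_long_branches[OF E(1) L tail, of P P' Q Q'])
          (use PQe PQz P' Q' PQ(2) tz in auto)
      then show ?thesis ..
    qed
  next
    case 4
    then obtain N where N: "N \<subseteq> B" "card N = 3" using obtain_subset_with_card_n by metis
    have Nt: "N \<inter> ?t ` {0..L} = {}" using N(1) Bz tz by blast
    have Nu: "N \<subseteq> E `` {?t 0}" using N(1) by (auto simp: B_def)
    have False
      by (rule big, rule rad_ge_three_extra_neighbours[OF E(1) L tail Nu N(2) Nt])
    then show ?thesis ..
  qed
qed

text \<open>After the cut, the component that carries the radius contains an end of the deleted
  edge, since otherwise it would be closed in E. From that end the path runs as a pendant path of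
  length L, to which \<open>classify_pendant_path\<close> applies.\<close>

lemma classify_long_path:
  assumes E: "ugraph E" "connected_graph E" and L: "1 \<le> L" and small: "rad E < cutoff L"
    and p: "path_on E p (6 * L + 2)"
  shows "\<exists>m<L. \<bar>rad E - eta \<alpha> m\<bar> \<le> 2 / (real L + 1)"
proof -
  note sy = ugraphD(2)[OF E(1)] and pi = path_onD(3)[OF p] and pe = path_onD(2)[OF p]
  have deg2: "E `` {p i} = {p (i - 1), p (Suc i)}" if "L + 1 \<le> i" "i \<le> 5 * L + 1" for i
    by (rule middle_degree_two[OF E(1) L p small]) (use that in auto)
  \<comment> \<open>Positions L + 1 to 5 L + 1 have degree two. Cutting an edge that starts between
    2 L and 4 L + 1 leaves L - 1 of them beyond the cut end on either side, and these 2 (L + 1)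
    candidates keep the loss at 1 / (L + 1).\<close>
  have "inj_on p {2 * L..2 * L + 2 * (L + 1)}"
    by (rule inj_on_subset[OF path_onD(1)[OF p]]) (use L in auto)
  from rad_delete_path_edge[OF E(1) this] obtain i where i: "2 * L \<le> i" "i < 2 * L + 2 * (L + 1)"
    and cut: "rad E \<le> rad (E - {(p i, p (Suc i)), (p (Suc i), p i)}) + 2 / real (2 * (L + 1))"
    using pe L by auto
  define F where "F = E - {(p i, p (Suc i)), (p (Suc i), p i)}"
  have F: "ugraph F" "F \<subseteq> E"
    using E(1) unfolding ugraph_def F_def sym_def irrefl_def by auto
  have FE: "F `` {v} = E `` {v}" if "v \<noteq> p i" "v \<noteq> p (Suc i)" for v
    using that by (auto simp: F_def)
  have Fi: "F `` {p i} = {p (i - 1)}"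
  proof -
    have ne: "p i \<noteq> p (Suc i)" "p (i - 1) \<noteq> p (Suc i)"
      using i L pi[of i "Suc i"] pi[of "i - 1" "Suc i"] by simp_all
    have "F `` {p i} = E `` {p i} - {p (Suc i)}" using ne(1) by (auto simp: F_def)
    also have "E `` {p i} = {p (i - 1), p (Suc i)}" by (rule deg2) (use i L in auto)
    finally show ?thesis using ne(2) by auto
  qed
  have Fi': "F `` {p (Suc i)} = {p (Suc (Suc i))}"
  proof -
    have ne: "p i \<noteq> p (Suc i)" "p (Suc (Suc i)) \<noteq> p i"
      using i L pi[of i "Suc i"] pi[of "Suc (Suc i)" i] by simp_all
    have "F `` {p (Suc i)} = E `` {p (Suc i)} - {p i}" using ne(1) by (auto simp: F_def)
    also have "E `` {p (Suc i)} = {p (Suc i - 1), p (Suc (Suc i))}" by (rule deg2) (use i L in auto)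
    finally show ?thesis using ne(2) by auto
  qed
  have "F \<noteq> {}" using Fi by auto
  from connected_component_same_rad[OF F(1) this] obtain K where K: "K \<subseteq> F" "K \<noteq> {}" "ugraph K"
    "rad K = rad F" "connected_graph K" and Kc': "\<forall>a b. (a, b) \<in> F \<longrightarrow> a \<in> Field K \<longrightarrow> (a, b) \<in> K" .
  note Kc = Kc'[rule_format]
  have KF: "K `` {v} = F `` {v}" if "v \<in> Field K" for v
    using that Kc K(1) by auto
  have "p i \<in> Field K \<or> p (Suc i) \<in> Field K"
  proof (rule ccontr)
    assume n: "\<not> ?thesis"
    from K(2) obtain a b where ab: "(a, b) \<in> K" by auto
    have "Field E \<subseteq> Field K"
    proof (rule connected_graphD[OF E(2)])
      show "a \<in> Field K" using ab by (rule FieldI1)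
      show "a \<in> Field E" using ab K(1) F(2) by (auto simp: Field_def)
      fix c d assume cd: "(c, d) \<in> E" "c \<in> Field K"
      then have "(c, d) \<in> F" using n by (auto simp: F_def)
      from Kc[OF this cd(2)] show "d \<in> Field K" by (rule FieldI2)
    qed
    moreover have "p i \<in> Field E" using deg2[of i] i L by (auto simp: Field_def)
    ultimately show False using n by auto
  qed
  then have "\<exists>z. stretch_on K z L \<and> K `` {z 0} = {z 1}"
  proof
    assume pK: "p i \<in> Field K"
    let ?z = "\<lambda>k. p (i - k)"
    have z0: "K `` {?z 0} = {?z 1}" using KF[OF pK] Fi by simp
    have nF: "F `` {?z k} = {?z (k - 1), ?z (Suc k)}" if k: "1 \<le> k" "k < L" for k
    proof -
      have "Suc (i - k) = i - (k - 1)" "i - k - 1 = i - Suc k" using k i by auto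
      then have "E `` {?z k} = {?z (k - 1), ?z (Suc k)}" using deg2[of "i - k"] k i by auto
      moreover have "?z k \<noteq> p i" "?z k \<noteq> p (Suc i)"
        using pi[of "i - k" i] pi[of "i - k" "Suc i"] k i by auto
      ultimately show ?thesis using FE by simp
    qed
    have zK: "?z k \<in> Field K" if "k \<le> L" for k
      using that
    proof (induction k)
      case (Suc k)
      then have k: "?z k \<in> Field K" "k < L" by auto
      have "?z (Suc k) \<in> K `` {?z k}"
        using KF[OF k(1)] nF[of k] k(2) Fi by (cases k) auto
      then show ?case by (auto simp: Field_def)
    qed (use pK in simp)
    have "stretch_on K ?z L"
      unfolding stretch_on_def
    proof (intro conjI allI impI L)
      show "inj_on ?z {0..L}" by (rule inj_onI) (use pi i in \<open>auto simp: eq_diff_iff\<close>)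
      show "(?z 0, ?z 1) \<in> K" using z0 by auto
      show "K `` {?z j} = {?z (j - 1), ?z (Suc j)}" if "1 \<le> j" "j < L" for j
        using KF[OF zK[of j]] nF[OF that] that by simp
    qed
    then show ?thesis using z0 by blast
  next
    assume pK: "p (Suc i) \<in> Field K"
    let ?z = "\<lambda>k. p (Suc i + k)"
    have z0: "K `` {?z 0} = {?z 1}" using KF[OF pK] Fi' by simp
    have nF: "F `` {?z k} = {?z (k - 1), ?z (Suc k)}" if k: "1 \<le> k" "k < L" for k
    proof -
      have "Suc i + k - 1 = Suc i + (k - 1)" using k by auto
      then have "E `` {?z k} = {?z (k - 1), ?z (Suc k)}" using deg2[of "Suc i + k"] k i by auto
      moreover have "?z k \<noteq> p i" "?z k \<noteq> p (Suc i)"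
        using pi[of "Suc i + k" i] pi[of "Suc i + k" "Suc i"] k i by auto
      ultimately show ?thesis using FE by simp
    qed
    have zK: "?z k \<in> Field K" if "k \<le> L" for k
      using that
    proof (induction k)
      case (Suc k)
      then have k: "?z k \<in> Field K" "k < L" by auto
      have "?z (Suc k) \<in> K `` {?z k}"
        using KF[OF k(1)] nF[of k] k(2) Fi' by (cases k) auto
      then show ?case by (auto simp: Field_def)
    qed (use pK in simp)
    have "stretch_on K ?z L"
      unfolding stretch_on_def
    proof (intro conjI allI impI L)
      show "inj_on ?z {0..L}" by (rule inj_onI) (use pi i in auto)
      show "(?z 0, ?z 1) \<in> K" using z0 by auto
      show "K `` {?z j} = {?z (j - 1), ?z (Suc j)}" if "1 \<le> j" "j < L" for j
        using KF[OF zK[of j]] nF[OF that] that by simp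
    qed
    then show ?thesis using z0 by blast
  qed
  then obtain z where z: "stretch_on K z L" "K `` {z 0} = {z 1}" by blast
  have le: "rad K \<le> rad E" using rad_mono[OF F(1) E(1) F(2)] K(4) by simp
  then have "rad K < cutoff L" using small by simp
  from classify_pendant_path[OF K(3,5) L this z order_refl] obtain m where
    m: "m < L" "eta \<alpha> m - 2 / (real L + 1) \<le> rad K" "rad K \<le> eta \<alpha> m" by auto
  \<comment> \<open>The two errors do not add up: the deletion matters only for the bound from
    above, the truncation only for the bound from below.\<close>
  have "2 / real (2 * (L + 1)) \<le> 2 / (real L + 1)" by (simp add: field_simps)
  then have "\<bar>rad E - eta \<alpha> m\<bar> \<le> 2 / (real L + 1)"
    using m le cut K(4) by (simp add: F_def abs_le_iff)
  then show ?thesis using m(1) by auto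
qed

end

section \<open>The limit points\<close>

lemma P2_paths_arc_iff:
  "(v, w) \<in> parcs (P2_paths n k) \<longleftrightarrow>
    (v, w) \<in> {(0, 1), (0, 2), (0, n + 2), (1, 0), (2, 0), (n + 2, 0)} \<or>
    (w = v + 1 \<and> (2 \<le> v \<and> v \<le> n \<or> n + 2 \<le> v \<and> v \<le> n + k)) \<or>
    (v = w + 1 \<and> (2 \<le> w \<and> w \<le> n \<or> n + 2 \<le> w \<and> w \<le> n + k))"
  unfolding P2_paths_def Let_def by auto

lemma pverts_P2_paths: "pverts (P2_paths n k) = {0..<n + k + 2}"
  by (simp add: P2_paths_def Let_def)

text \<open>For n = 0 the arcs from 0 to 2 and to n + 2 coincide and the graph is a path on k + 2
  vertices. One family therefore realises \<open>eta 0\<close> as well.\<close>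

lemma simple_graph_P2_paths_any:
  assumes k: "1 \<le> k"
  shows "simple_graph (P2_paths n k)"
proof (cases "n = 0")
  case False
  then show ?thesis using simple_graph_P2_paths[of n k] k by simp
next
  case True
  let ?G = "P2_paths n k"
  have arcs: "parcs ?G \<subseteq> {0..<n + k + 2} \<times> {0..<n + k + 2}"
    using k by (auto simp: P2_paths_arc_iff)
  have "finite (parcs ?G)" using arcs by (rule finite_subset) simp
  moreover have "sym (parcs ?G)" by (rule symI) (auto simp: P2_paths_arc_iff)
  moreover have "fst e \<noteq> snd e" if "e \<in> parcs ?G" for e
    using that by (cases e) (auto simp: P2_paths_arc_iff)
  ultimately have "pair_graph ?G"
    using arcs pverts_P2_paths[of n k] by unfold_locales (auto simp: symmetric_def)
  then show ?thesis
    unfolding simple_graph_def pverts_P2_paths by (intro conjI exI[of _ "n + k + 2"]) auto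
qed

lemma P2_paths_connected:
  assumes e: "e \<in> Z" "e \<in> pverts (P2_paths n k)"
    and closed: "\<And>v w. v \<in> Z \<Longrightarrow> (v, w) \<in> parcs (P2_paths n k) \<Longrightarrow> w \<in> Z"
  shows "pverts (P2_paths n k) \<subseteq> Z"
proof -
  have "0 \<in> Z" if "v \<in> Z" "v < n + k + 2" for v
    using that
  proof (induction v rule: less_induct)
    case (less v)
    show ?case
    proof (cases "v \<in> {0, 1, 2, n + 2}")
      case True
      then show ?thesis using closed[of v 0] less.prems by (auto simp: P2_paths_arc_iff)
    next
      case False
      then have "(v, v - 1) \<in> parcs (P2_paths n k)" using less.prems(2) by (auto simp: P2_paths_arc_iff)
      then have "v - 1 \<in> Z" using closed less.prems(1) by blast
      then show ?thesis using less.IH[of "v - 1"] False less.prems(2) by simp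
    qed
  qed
  then have 0: "0 \<in> Z" using e by (auto simp: pverts_P2_paths)
  have "v \<in> Z" if "v < n + k + 2" for v
    using that
  proof (induction v rule: less_induct)
    case (less v)
    show ?case
    proof (cases "v \<in> {0, 1, 2, n + 2}")
      case True
      then show ?thesis using closed[OF 0, of v] 0 by (auto simp: P2_paths_arc_iff)
    next
      case False
      then have "(v - 1, v) \<in> parcs (P2_paths n k)" using less.prems by (auto simp: P2_paths_arc_iff)
      moreover have "v - 1 \<in> Z" using less.IH[of "v - 1"] False less.prems by simp
      ultimately show ?thesis using closed by blast
    qed
  qed
  then show ?thesis by (auto simp: pverts_P2_paths)
qed

text \<open>Each term is strictly below the limit and hence exceeded by a later one. This supplies
  the pairwise distinct radii that a limit point requires.\<close>

lemma injective_subsequence_from_below: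
  fixes f :: "nat \<Rightarrow> real"
  assumes lim: "f \<longlonglongrightarrow> l" and less: "\<And>k. f k < l"
  obtains s :: "nat \<Rightarrow> nat" where "strict_mono s" "strict_mono (f \<circ> s)"
proof -
  have "\<exists>s. \<forall>n. True \<and> (s n < s (Suc n) \<and> f (s n) < f (s (Suc n)))"
  proof (rule dependent_nat_choice)
    fix x :: nat and n :: nat
    have "eventually (\<lambda>k. f x < f k \<and> x < k) sequentially"
      using order_tendstoD(1)[OF lim less[of x]] eventually_gt_at_top[of x] by eventually_elim simp
    then show "\<exists>y. True \<and> (x < y \<and> f x < f y)" by (auto simp: eventually_sequentially)
  qed simp
  then obtain s :: "nat \<Rightarrow> nat" where "\<And>n. s n < s (Suc n)" "\<And>n. f (s n) < f (s (Suc n))" by auto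
  then show thesis using that[of s] by (simp add: strict_mono_Suc_iff)
qed

context aspec
begin

section \<open>Realisation of the numbers eta and exclusion of all others\<close>

lemma simple_graph_ugraph: "simple_graph G \<Longrightarrow> ugraph (parcs G)"
  by (erule simple_graph_facts)

lemma rho_P2_paths_bounds:
  assumes k: "1 \<le> k"
  shows "eta \<alpha> n - 2 / (real k + 1) \<le> rho \<alpha> (P2_paths n k)" "rho \<alpha> (P2_paths n k) < eta \<alpha> n"
proof -
  let ?G = "P2_paths n k"
  let ?E = "parcs ?G"
  note G = simple_graph_P2_paths_any[OF k, of n]
  have E: "ugraph ?E" by (rule simple_graph_ugraph[OF G])
  \<comment> \<open>The arm of length k starts at 0 and continues with n + 2, ..., n + k +
    1.\<close>
  define z where "z = (\<lambda>i. if i = 0 then 0 else n + 1 + i)"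
  have z: "path_on ?E z k"
    unfolding path_on_def
  proof (intro conjI allI impI)
    show "inj_on z {0..k}" by (auto simp: z_def inj_on_def)
    show "(z i, z (Suc i)) \<in> ?E" if "i < k" for i
      using that by (cases "i = 0") (simp_all add: z_def P2_paths_arc_iff)
  qed
  have zk: "z k \<in> pverts ?G" using k by (simp add: z_def pverts_P2_paths)
  have "eta \<alpha> n - 2 / (real k + 1) \<le> rho \<alpha> ?G \<and> rho \<alpha> ?G < eta \<alpha> n"
  proof (cases "n = 0")
    case True
    have "card (?E `` {v}) \<le> 2" for v
    proof -
      \<comment> \<open>The path has the order 1, 0, 2, 3, ..., k + 1; its end-vertex 1 makes the
        constant supersolution strict.\<close>
      have "?E `` {v} \<subseteq> {if v = 0 then 1 else if v = 2 then 0 else v - 1, if v = 0 then 2 else v + 1}"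
        using True k by (auto simp: P2_paths_arc_iff)
      moreover have "card {a, b} \<le> 2" for a b :: nat by (simp add: card_insert_if)
      ultimately show ?thesis by (meson card_mono finite.emptyI finite.insertI order_trans)
    qed
    then have sup: "act ?E (\<lambda>_. 1) v \<le> 2 * 1" for v by (simp add: act_def)
    have "?E `` {1} = {0}" using True by (auto simp: P2_paths_arc_iff)
    then have strict: "act ?E (\<lambda>_. 1) 1 < 2 * 1" by (simp add: act_def)
    have "rho \<alpha> ?G < 2"
    proof (rule rho_less_strict_supersolution[OF G, of "\<lambda>_. 1" 2 1])
      show "(1::nat) \<in> pverts ?G" by (simp add: pverts_P2_paths)
      then show "pverts ?G \<subseteq> Z" if "1 \<in> Z" "\<And>v w. v \<in> Z \<Longrightarrow> (v, w) \<in> ?E \<Longrightarrow> w \<in> Z" for Z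
        using P2_paths_connected[of 1 Z n k] that by blast
    qed (use sup strict in auto)
    then show ?thesis
      using rad_ge_path[OF E k z] True unfolding rho_eq_rad[OF G, symmetric] by (simp add: eta_0)
  next
    case False
    then have n: "1 \<le> n" by simp
    define y :: "nat \<Rightarrow> nat" where "y = (\<lambda>j. if j = 0 then 0 else j + 1)"
    have y: "path_on ?E y n"
      unfolding path_on_def
    proof (intro conjI allI impI)
      show "inj_on y {0..n}" by (auto simp: y_def inj_on_def)
      show "(y i, y (Suc i)) \<in> ?E" if "i < n" for i
        using that by (cases "i = 0") (simp_all add: y_def P2_paths_arc_iff)
    qed
    have F: "fork_on ?E z k 1 y n"
      unfolding fork_on_def using z y by (auto simp: z_def y_def P2_paths_arc_iff)
    have nb: "?E `` {1} = {z 0}" "?E `` {z 0} = {1, y 1, z 1}" "?E `` {y n} = {y (n - 1)}"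
      "?E `` {z k} = {z (k - 1)}"
      using n k by (auto simp: z_def y_def P2_paths_arc_iff)
    have ny: "?E `` {y j} = {y (j - 1), y (Suc j)}" if "1 \<le> j" "j < n" for j
      using that by (auto simp: y_def P2_paths_arc_iff)
    have nz: "?E `` {z i} = {z (i - 1), z (Suc i)}" if "1 \<le> i" "i < k" for i
      using that n by (auto simp: z_def P2_paths_arc_iff)
    from fork_supersolution[OF k n F nb(1,2) ny nb(3) nz nb(4)] obtain X where
      X: "\<forall>v. X v > 0" "\<forall>v\<in>{1} \<union> y ` {0..n} \<union> z ` {0..k}. act ?E X v \<le> eta \<alpha> n * X v"
      "act ?E X (z k) < eta \<alpha> n * X (z k)" .
    have cover: "v \<in> {1} \<union> y ` {0..n} \<union> z ` {0..k}" if "v \<in> pverts ?G" for v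
    proof -
      have "v = 1 \<or> v = y 0 \<or> (2 \<le> v \<and> v \<le> n + 1 \<and> v = y (v - 1)) \<or> (n + 2 \<le> v \<and> v = z (v - n - 1))"
        by (auto simp: y_def z_def)
      moreover have "v - n - 1 \<in> {0..k}" using that by (auto simp: pverts_P2_paths)
      ultimately show ?thesis by auto
    qed
    have "rho \<alpha> ?G < eta \<alpha> n"
    proof (rule rho_less_strict_supersolution[OF G, of X "eta \<alpha> n" "z k"])
      show "pverts ?G \<subseteq> Z" if "z k \<in> Z" "\<And>v w. v \<in> Z \<Longrightarrow> (v, w) \<in> ?E \<Longrightarrow> w \<in> Z" for Z
        using P2_paths_connected[OF that(1) zk that(2)] .
    qed (use X cover zk in blast)+
    then show ?thesis using rad_ge_fork[OF E k n F] by (simp add: rho_eq_rad[OF G])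
  qed
  then show "eta \<alpha> n - 2 / (real k + 1) \<le> rho \<alpha> ?G" "rho \<alpha> ?G < eta \<alpha> n" by auto
qed

lemma two_over_tendsto: "(\<lambda>k. 2 / (real k + 1)) \<longlonglongrightarrow> 0"
proof -
  have "(\<lambda>k. 2 * (1 / real (Suc k))) \<longlonglongrightarrow> 2 * 0"
    by (intro tendsto_intros LIMSEQ_Suc lim_1_over_n)
  then show ?thesis by (simp add: add.commute)
qed

lemma rho_P2_paths_tendsto: "(\<lambda>n. rho \<alpha> (P2_paths n n)) \<longlonglongrightarrow> lam t_lim"
proof (rule real_tendsto_sandwich)
  show "\<forall>\<^sub>F n in sequentially. eta \<alpha> n - 2 / (real n + 1) \<le> rho \<alpha> (P2_paths n n)"
    "\<forall>\<^sub>F n in sequentially. rho \<alpha> (P2_paths n n) \<le> eta \<alpha> n"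
    using eventually_ge_at_top[of 1] by (eventually_elim; use rho_P2_paths_bounds in \<open>auto intro: less_imp_le\<close>)+
  show "(\<lambda>n. eta \<alpha> n - 2 / (real n + 1)) \<longlonglongrightarrow> lam t_lim"
    using tendsto_diff[OF eta_tendsto two_over_tendsto] by simp
qed (rule eta_tendsto)

lemma Psi_eq: "Psi \<alpha> = lam t_lim"
  unfolding Psi_def by (rule limI[OF rho_P2_paths_tendsto])

lemma eta_limit_point: "rho_limit_point \<alpha> (eta \<alpha> n)"
proof -
  define f where "f = (\<lambda>k. rho \<alpha> (P2_paths n (Suc k)))"
  have lim: "f \<longlonglongrightarrow> eta \<alpha> n"
  proof (rule real_tendsto_sandwich)
    show "\<forall>\<^sub>F k in sequentially. eta \<alpha> n - 2 / (real (Suc k) + 1) \<le> f k"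
      "\<forall>\<^sub>F k in sequentially. f k \<le> eta \<alpha> n"
      using rho_P2_paths_bounds[of "Suc _" n] by (auto simp: f_def less_imp_le)
    show "(\<lambda>k. eta \<alpha> n - 2 / (real (Suc k) + 1)) \<longlonglongrightarrow> eta \<alpha> n"
      using tendsto_diff[OF tendsto_const LIMSEQ_Suc[OF two_over_tendsto], of "eta \<alpha> n"] by simp
  qed simp
  have "f k < eta \<alpha> n" for k using rho_P2_paths_bounds(2)[of "Suc k" n] by (simp add: f_def)
  from injective_subsequence_from_below[OF lim this]
  obtain s :: "nat \<Rightarrow> nat" where s: "strict_mono s" "strict_mono (f \<circ> s)" .
  show ?thesis
    unfolding rho_limit_point_def
  proof (intro exI[of _ "\<lambda>k. P2_paths n (Suc (s k))"] conjI allI impI)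
    show "simple_graph (P2_paths n (Suc (s k)))" for k by (rule simple_graph_P2_paths_any) simp
    show "rho \<alpha> (P2_paths n (Suc (s i))) \<noteq> rho \<alpha> (P2_paths n (Suc (s j)))" if "i \<noteq> j" for i j
      using strict_mono_eq[OF s(2), of i j] that by (simp add: f_def)
    show "(\<lambda>k. rho \<alpha> (P2_paths n (Suc (s k)))) \<longlonglongrightarrow> eta \<alpha> n"
      using LIMSEQ_subseq_LIMSEQ[OF lim s(1)] by (simp add: f_def o_def)
  qed
qed

text \<open>Otherwise \<gamma> has positive distance from all \<open>eta\<close>. With 2 / (L + 1)
  below half of it, a late graph whose radius sits on a large component would come too close to some
  \<open>eta\<close>. The radii thus come from components of bounded size, against the existence of
  infinitely many values.\<close>

lemma limit_point_is_eta:
  assumes lp: "rho_limit_point \<alpha> \<gamma>" and less: "\<gamma> < lam t_lim"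
  shows "\<exists>n. \<gamma> = eta \<alpha> n"
proof (rule ccontr)
  assume neq: "\<nexists>n. \<gamma> = eta \<alpha> n"
  from lp obtain G where G: "\<And>k. simple_graph (G k)"
    "\<And>i j. i \<noteq> j \<Longrightarrow> rho \<alpha> (G i) \<noteq> rho \<alpha> (G j)" "(\<lambda>k. rho \<alpha> (G k)) \<longlonglongrightarrow> \<gamma>"
    unfolding rho_limit_point_def by blast
  obtain c where c: "\<gamma> < c" "c < lam t_lim" using dense[OF less] by blast
  obtain N where N: "\<And>n. n \<ge> N \<Longrightarrow> c < eta \<alpha> n"
    using order_tendstoD(1)[OF eta_tendsto c(2)] by (auto simp: eventually_sequentially)
  \<comment> \<open>A lower bound for the distance to every \<open>eta\<close>: those of index at
    least N exceed c, and finitely many others remain.\<close>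
  define \<delta> where "\<delta> = Min (insert (c - \<gamma>) ((\<lambda>n. \<bar>\<gamma> - eta \<alpha> n\<bar>) ` {..<N}))"
  have d0: "\<delta> > 0" unfolding \<delta>_def using neq c(1) by (subst Min_gr_iff) auto
  have dle: "\<delta> \<le> \<bar>\<gamma> - eta \<alpha> n\<bar>" for n
  proof (cases "n < N")
    case True
    then show ?thesis unfolding \<delta>_def by (intro Min_le) auto
  next
    case False
    have "\<delta> \<le> c - \<gamma>" unfolding \<delta>_def by (intro Min_le) auto
    then show ?thesis using N[of n] False by simp
  qed
  have "cutoff \<longlonglongrightarrow> lam t_lim"
    using tendsto_diff[OF eta_tendsto two_over_tendsto] by (simp add: cutoff_def[abs_def])
  from order_tendstoD(1)[OF this c(2)] have 1: "\<forall>\<^sub>F L in sequentially. c < cutoff L" .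
  have 2: "\<forall>\<^sub>F L in sequentially. 2 / (real L + 1) < \<delta> / 2"
    by (rule order_tendstoD(2)[OF two_over_tendsto]) (use d0 in simp)
  from 1 2 eventually_ge_at_top[of 1]
  have "\<forall>\<^sub>F L in sequentially. c < cutoff L \<and> 2 / (real L + 1) < \<delta> / 2 \<and> 1 \<le> L"
    by eventually_elim blast
  then obtain L where L: "c < cutoff L" "2 / (real L + 1) < \<delta> / 2" "1 \<le> L"
    by (auto simp: eventually_sequentially)
  have "\<forall>\<^sub>F k in sequentially. dist (rho \<alpha> (G k)) \<gamma> < \<delta> / 2"
    by (rule tendstoD[OF G(3)]) (use d0 in simp)
  with order_tendstoD(2)[OF G(3) c(1)]
  have "\<forall>\<^sub>F k in sequentially. rho \<alpha> (G k) < c \<and> \<bar>rho \<alpha> (G k) - \<gamma>\<bar> < \<delta> / 2"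
    unfolding dist_real_def by eventually_elim blast
  then obtain K where K: "\<And>k. k \<ge> K \<Longrightarrow> rho \<alpha> (G k) < c" "\<And>k. k \<ge> K \<Longrightarrow> \<bar>rho \<alpha> (G k) - \<gamma>\<bar> < \<delta> / 2"
    by (auto simp: eventually_sequentially)
  \<comment> \<open>Degrees are at most the square of the radius, hence at most c^2. A connected
    graph with more than M vertices then contains a path of 6 L + 2 edges.\<close>
  define d where "d = nat \<lceil>c\<^sup>2\<rceil>"
  define M where "M = (d + 1) ^ (6 * L + 2)"
  let ?R = "{rad E | E :: (nat \<times> nat) set. ugraph E \<and> card (Field E) \<le> M}"
  have "rho \<alpha> (G k) \<in> ?R" if k: "k \<ge> K" for k
  proof -
    let ?E = "parcs (G k)"
    have E: "ugraph ?E" by (rule simple_graph_ugraph[OF G(1)])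
    have r: "rho \<alpha> (G k) = rad ?E" by (rule rho_eq_rad[OF G(1)])
    show ?thesis
    proof (cases "?E = {}")
      case True
      then have "card (Field ?E) \<le> M" by simp
      then show ?thesis using E r by blast
    next
      case False
      from connected_component_same_rad[OF E False] obtain C where
        "C \<subseteq> ?E" "C \<noteq> {}" and C: "ugraph C" "rad C = rad ?E" "connected_graph C"
        and "\<forall>a b. (a, b) \<in> ?E \<longrightarrow> a \<in> Field C \<longrightarrow> (a, b) \<in> C" .
      have small: "rad C < c" using K(1)[OF k] r C(2) by simp
      have deg: "card (C `` {v}) \<le> d" for v
      proof (cases "v \<in> Field C")
        case True
        then have "sqrt (real (card (C `` {v}))) \<le> c"
          using sqrt_degree_le_rad[OF C(1), of v] small by simp
        then have "(sqrt (real (card (C `` {v}))))\<^sup>2 \<le> c\<^sup>2" by (intro power_mono) auto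
        then have "real (card (C `` {v})) \<le> c\<^sup>2" by simp
        then show ?thesis unfolding d_def by linarith
      next
        case False
        then have "C `` {v} = {}" by (auto simp: Field_def)
        then show ?thesis by simp
      qed
      have "card (Field C) \<le> M"
      proof (rule ccontr)
        assume "\<not> ?thesis"
        then have "card (Field C) > (d + 1) ^ (6 * L + 2)" by (simp add: M_def)
        from bounded_degree_long_path[OF C(1,3) deg this] obtain p where
          "inj_on p {0..6 * L + 2}" "\<And>i. i < 6 * L + 2 \<Longrightarrow> (p i, p (Suc i)) \<in> C" by blast
        then have "path_on C p (6 * L + 2)" by (simp add: path_on_def)
        moreover have "rad C < cutoff L" using small L(1) by simp
        ultimately obtain m where "\<bar>rad C - eta \<alpha> m\<bar> \<le> 2 / (real L + 1)"
          using classify_long_path[OF C(1,3) L(3)] by blast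
        then have "\<bar>rho \<alpha> (G k) - eta \<alpha> m\<bar> < \<delta> / 2" using L(2) r C(2) by simp
        then have "\<bar>\<gamma> - eta \<alpha> m\<bar> < \<delta>" using K(2)[OF k] by linarith
        then show False using dle[of m] by simp
      qed
      then show ?thesis using C(1,2) r by (intro CollectI exI[of _ C]) simp
    qed
  qed
  then have "(\<lambda>k. rho \<alpha> (G k)) ` {K..} \<subseteq> ?R" by auto
  then have "finite ((\<lambda>k. rho \<alpha> (G k)) ` {K..})" using finite_rad_values finite_subset by blast
  moreover have "inj_on (\<lambda>k. rho \<alpha> (G k)) {K..}" using G(2) by (auto simp: inj_on_def)
  ultimately have "finite {K..}" by (rule finite_imageD)
  then show False using infinite_Ici by blast
qed

end

theorem theorem2p2:
  fixes \<alpha> :: real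
  assumes "0 \<le> \<alpha>" and "\<alpha> < 1"
  shows
    "(\<forall>n\<ge>1. \<exists>!x. x > 0 \<and> Phi_tilde \<alpha> n x = 0) \<and>
     gamma_tilde \<alpha> 1 \<ge> 1 \<and>
     (\<forall>n\<ge>2. gamma_tilde \<alpha> n > 1) \<and>
     convergent (\<lambda>n. rho \<alpha> (P2_paths n n)) \<and>
     (\<alpha> = 0 \<longrightarrow> eta \<alpha> 0 = 2 \<and> eta \<alpha> 1 = 2 \<and> (\<forall>n\<ge>1. eta \<alpha> n < eta \<alpha> (n + 1))) \<and>
     (\<alpha> > 0 \<longrightarrow> eta \<alpha> 0 = 2 \<and> (\<forall>n. eta \<alpha> n < eta \<alpha> (n + 1))) \<and>
     (\<lambda>n. eta \<alpha> n) \<longlonglongrightarrow> Psi \<alpha> \<and>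
     {\<gamma>. rho_limit_point \<alpha> \<gamma> \<and> \<gamma> < Psi \<alpha>} = {eta \<alpha> n | n. True}"
proof -
  interpret aspec \<alpha> using assms by unfold_locales
  have eta1: "eta \<alpha> 1 = 2" if "\<alpha> = 0"
  proof -
    have "Phi_tilde \<alpha> 1 1 = 0"
      unfolding Phi_tilde_at_1[OF order_refl] by (simp add: that)
    then have "gamma_tilde \<alpha> 1 = 1"
      using the1_equality[OF Phi_tilde_ex1[of 1], of 1] by (simp add: gamma_tilde_def)
    then show ?thesis by (simp add: eta_def)
  qed
  have "{\<gamma>. rho_limit_point \<alpha> \<gamma> \<and> \<gamma> < Psi \<alpha>} = {eta \<alpha> n | n. True}"
    using limit_point_is_eta eta_limit_point eta_less_lam_t_lim by (auto simp: Psi_eq)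
  then show ?thesis
    using Phi_tilde_ex1 gamma_tilde_ge1 gamma_tilde_gt1 rho_P2_paths_tendsto eta_0 eta1
      eta_strict_mono eta_tendsto
    by (auto simp: Psi_eq convergent_def)
qed

end
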